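(* Let $s\in\mathbb{C}$ with $-2<\operatorname{Re}s<3$ and let $y,\alpha>0$. Then \begin{align*} &PV\int_0^{\infty}x^{2-s/2}K_{s/2}(2\pi\alpha x)\left(\frac{y^{s-1}-x^{s-1}}{y^2-x^2}\right)dx\\ &=(2y)^{s/2}\Gamma\left(1+\frac s2\right)T_{-1-s/2,-s/2}(2\pi\alpha y)-\sqrt\pi\left(\frac y2\right)^{s/2}\Gamma\left(\frac{3-s}{2}\right)T_{-2+s/2,s/2}(2\pi\alpha y), \end{align*} where $T_{\mu,\nu}$ is the modified Lommel function.
   Context: $PV$ denotes the Cauchy principal value; $K_\nu$ is the modified Bessel function of the second kind. Modified Lommel functions: $T_{\mu,\nu}(y):=-i^{1-\mu}S_{\mu,\nu}(iy)$ for real $y>0$ (principal powers), where the Lommel functions are $$s_{\mu,\nu}(w)=\frac{w^{\mu+1}}{(\mu-\nu+1)(\mu+\nu+1)}\,{}_1F_2\left(1;\tfrac{\mu-\nu+3}{2},\tfrac{\mu+\nu+3}{2};-\tfrac14w^2\right),$$ $$S_{\mu,\nu}(w)=s_{\mu,\nu}(w)+\frac{2^{\mu-1}\Gamma\left(\frac{\mu-\nu+1}{2}\right)\Gamma\left(\frac{\mu+\nu+1}{2}\right)}{\sin(\nu\pi)}\left\{\cos\left(\tfrac12(\mu-\nu)\pi\right)J_{-\nu}(w)-\cos\left(\tfrac12(\mu+\nu)\pi\right)J_\nu(w)\right\}$$ for $\nu\notin\mathbb{Z}$, and $$S_{\mu,\nu}(w)=s_{\mu,\nu}(w)+2^{\mu-1}\Gamma\left(\tfrac{\mu-\nu+1}{2}\right)\Gamma\left(\tfrac{\mu+\nu+1}{2}\right)\left\{\sin\left(\tfrac12(\mu-\nu)\pi\right)J_\nu(w)-\cos\left(\tfrac12(\mu-\nu)\pi\right)Y_\nu(w)\right\}$$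 for $\nu\in\mathbb{Z}$; here ${}_1F_2(a;b,c;z)=\sum_{k\ge0}\frac{(a)_k}{(b)_k(c)_k}\frac{z^k}{k!}$ and $J_\nu,Y_\nu$ are Bessel functions. When $\mu\pm\nu$ is an odd negative integer ($s_{\mu,\nu}$ undefined), $S_{\mu,\nu}(w)$ denotes its limiting value. *)

theory Defs
  imports "HOL-Analysis.Analysis"
begin

text \<open>
  Bessel functions of complex order and argument, with the principal branch
  \<open>powr\<close>. All of them are only meant for \<open>z \<noteq> 0\<close>, since \<open>0 powr \<nu> = 0\<close> for every \<open>\<nu>\<close>.
  The entire function \<open>rGamma\<close> is \<open>1/\<Gamma>\<close>, so terms at the poles of \<open>\<Gamma>\<close> vanish.
\<close>

definition bessel_J :: "complex \<Rightarrow> complex \<Rightarrow> complex" where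
  "bessel_J \<nu> z = (z / 2) powr \<nu> *
     (\<Sum>k. (-1) ^ k * rGamma (\<nu> + of_nat k + 1) / fact k * (z / 2) ^ (2 * k))"

definition bessel_I :: "complex \<Rightarrow> complex \<Rightarrow> complex" where
  "bessel_I \<nu> z = (z / 2) powr \<nu> *
     (\<Sum>k. rGamma (\<nu> + of_nat k + 1) / fact k * (z / 2) ^ (2 * k))"

definition bessel_Y :: "complex \<Rightarrow> complex \<Rightarrow> complex" where
  "bessel_Y \<nu> z =
     (let Y = (\<lambda>\<nu>'. (cos (\<nu>' * of_real pi) * bessel_J \<nu>' z - bessel_J (- \<nu>') z)
                      / sin (\<nu>' * of_real pi))
      in if \<nu> \<in> \<int> then Lim (at \<nu>) Y else Y \<nu>)"

definition bessel_K :: "complex \<Rightarrow> complex \<Rightarrow> complex" where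
  "bessel_K \<nu> z =
     (let K = (\<lambda>\<nu>'. of_real pi / 2 * (bessel_I (- \<nu>') z - bessel_I \<nu>' z)
                      / sin (\<nu>' * of_real pi))
      in if \<nu> \<in> \<int> then Lim (at \<nu>) K else K \<nu>)"

definition hypergeom_1F2 :: "complex \<Rightarrow> complex \<Rightarrow> complex \<Rightarrow> complex \<Rightarrow> complex" where
  "hypergeom_1F2 a b c z =
     (\<Sum>k. pochhammer a k / (pochhammer b k * pochhammer c k) * (z ^ k / fact k))"

definition lommel_s :: "complex \<Rightarrow> complex \<Rightarrow> complex \<Rightarrow> complex" where
  "lommel_s \<mu> \<nu> w = w powr (\<mu> + 1) / ((\<mu> - \<nu> + 1) * (\<mu> + \<nu> + 1)) *
     hypergeom_1F2 1 ((\<mu> - \<nu> + 3) / 2) ((\<mu> + \<nu> + 3) / 2) (- (w\<^sup>2 / 4))"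

definition odd_neg_Ints :: "complex set" where
  "odd_neg_Ints = {- of_nat (2 * k + 1) | k. True}"

text \<open>
  The explicit formula for \<open>S\<^bsub>\<mu>,\<nu>\<^esub>\<close>, meaningful only if neither \<open>\<mu> - \<nu>\<close> nor \<open>\<mu> + \<nu>\<close>
  is an odd negative integer.
\<close>

definition lommel_S_regular :: "complex \<Rightarrow> complex \<Rightarrow> complex \<Rightarrow> complex" where
  "lommel_S_regular \<mu> \<nu> w =
     (if \<nu> \<in> \<int> then
        lommel_s \<mu> \<nu> w +
        2 powr (\<mu> - 1) * Gamma ((\<mu> - \<nu> + 1) / 2) * Gamma ((\<mu> + \<nu> + 1) / 2) *
          (sin ((\<mu> - \<nu>) * of_real pi / 2) * bessel_J \<nu> w
           - cos ((\<mu> - \<nu>) * of_real pi / 2) * bessel_Y \<nu> w)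
      else
        lommel_s \<mu> \<nu> w +
        2 powr (\<mu> - 1) * Gamma ((\<mu> - \<nu> + 1) / 2) * Gamma ((\<mu> + \<nu> + 1) / 2)
          / sin (\<nu> * of_real pi) *
          (cos ((\<mu> - \<nu>) * of_real pi / 2) * bessel_J (- \<nu>) w
           - cos ((\<mu> + \<nu>) * of_real pi / 2) * bessel_J \<nu> w))"

text \<open>
  At the exceptional parameters the value is the limit in \<open>\<mu>\<close> with \<open>\<nu>\<close> held fixed.
\<close>

definition lommel_S :: "complex \<Rightarrow> complex \<Rightarrow> complex \<Rightarrow> complex" where
  "lommel_S \<mu> \<nu> w =
     (if \<mu> - \<nu> \<in> odd_neg_Ints \<or> \<mu> + \<nu> \<in> odd_neg_Ints
      then Lim (at \<mu>) (\<lambda>\<mu>'. lommel_S_regular \<mu>' \<nu> w)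
      else lommel_S_regular \<mu> \<nu> w)"

definition modified_lommel_T :: "complex \<Rightarrow> complex \<Rightarrow> real \<Rightarrow> complex" where
  "modified_lommel_T \<mu> \<nu> y = - (\<i> powr (1 - \<mu>)) * lommel_S \<mu> \<nu> (\<i> * of_real y)"

text \<open>
  \<open>has_PV_integral f I A c\<close>: the Cauchy principal value of the integral of \<open>f\<close> over \<open>A\<close>,
  with respect to the point \<open>c\<close>, exists and equals \<open>I\<close>. The value of \<open>f\<close> at \<open>c\<close> is irrelevant.
\<close>

definition has_PV_integral ::
    "(real \<Rightarrow> complex) \<Rightarrow> complex \<Rightarrow> real set \<Rightarrow> real \<Rightarrow> bool" where
  "has_PV_integral f I A c \<longleftrightarrow>
     (\<forall>\<epsilon>>0. set_integrable lborel (A - ball c \<epsilon>) f) \<and>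
     ((\<lambda>\<epsilon>. LINT x : A - ball c \<epsilon> | lborel. f x) \<longlongrightarrow> I) (at_right 0)"

end

(*
  Write m = -2 + s/2 and n = -1 - s/2. After x = y t the integral becomes, up to a power of y, the integral
  over t > 0 of (t^(-m) - t^(-n)) / (1 - t^2) * K_nu(b t) with nu = s/2 and b = 2 pi alpha y, where the
  singularity at t = 1 is removable. The claim is that its value is a difference of the same function R of
  the index, taken at n and at m, where R(m) is T_{m,nu}(b) up to two Gamma factors and a power of 2.

  For non-integral nu and generic m, expand 1 / (1 - t^2) in powers of t on (0,1) and of 1/t on (1,oo). On
  (0,1) the integral of t^(z-1) K_nu(b t) is P(z), obtained by integrating the power series of K_nu termwise;
  on (1,oo) it is M(z) - P(z) with M the Mellin transform of K_nu, and this remains true where the Mellin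
  integral diverges. Summed over the expansion, the terms M(z) give the series s_{m,nu}, and the terms P(z)
  add up to Bessel functions I_{nu}, I_{-nu} times tangents by the partial fractions of the tangent. Integral
  nu and the indices at which T is defined as a limit follow because the integral is continuous in nu and m.
*)

theory Submission
  imports Defs "HOL-Real_Asymp.Real_Asymp"
begin

section \<open>Reciprocal Gamma series and the partial fractions of the tangent\<close>

text \<open>A single power cannot be used alone: in general t^(-m) K_\<nu>(b t) / (1 - t^2) has a
  simple pole at t = 1. All identities therefore concern a difference of two indices, and R(m) is
  only determined up to a term independent of m. The multiple i pi / 2 of K_\<nu>(b) that separates
  the summed expansion from T is such a term and drops out. The strip -2 < Re s < 3 is exactly Re m
  < 1 - |Re \<nu>| at the two indices, which is integrability at t = 0. The expansion on (1,oo)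
  still runs through Mellin arguments of arbitrarily negative real part; hence the explicit
  primitives, their recursion from z to z + 2, and the exclusion of z with z + \<nu> or z - \<nu>
  integral. K and Y at integral order and S at exceptional indices are defined as limits. None is
  computed: each is read off from an expression continuous in the parameter. For K this is the
  integral of u^(-\<nu>-1) exp (-u - x^2 / (4 u)), which also supplies all majorants. One term of
  the claim has order -\<nu>, so R must also be shown to be even in \<nu>.\<close>

lemma norm_of_real_powr: "t > 0 \<Longrightarrow> norm (complex_of_real t powr z) = t powr Re z"
  by (simp add: norm_powr_real_powr)

lemma fact_le_norm_pochhammer:
  fixes a :: complex
  assumes "Re a \<ge> 1"
  shows "fact n \<le> norm (pochhammer a n)"
proof (induction n)
  case (Suc n)
  have "1 + real n \<le> Re (a + of_nat n)" using assms by simp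
  also have "\<dots> \<le> norm (a + of_nat n)" by (rule complex_Re_le_cmod)
  finally have "fact n * (1 + real n) \<le> norm (pochhammer a n) * norm (a + of_nat n)"
    using Suc by (intro mult_mono) auto
  thus ?case by (simp add: pochhammer_rec' norm_mult mult_ac)
qed simp

text \<open>With \<open>m\<close> at least the radius, b = a + m + 1 has real part at least 1, and
  \<open>rGamma\<close> at b + (k - m) is \<open>rGamma b\<close> divided by a Pochhammer symbol of
  modulus at least (k - m)!. For k < m the truncated difference k - m is 0, and boundedness on a
  compact disc is enough.\<close>

lemma rGamma_uniform_bound:
  "\<exists>C m. \<forall>a k. norm (a :: complex) \<le> R \<longrightarrow> norm (rGamma (a + of_nat k + 1)) \<le> C / fact (k - m)"
proof -
  obtain m :: nat where m: "R \<le> real m" using real_arch_simple by blast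
  have "compact (rGamma ` cball (0 :: complex) (R + real m + 1))"
    by (intro compact_continuous_image continuous_intros) auto
  then obtain C where C: "\<And>z :: complex. norm z \<le> R + real m + 1 \<Longrightarrow> norm (rGamma z) \<le> C"
    by (force dest!: compact_imp_bounded simp: bounded_iff)
  have "norm (rGamma (a + of_nat k + 1)) \<le> C / fact (k - m)" if a: "norm a \<le> R" for a :: complex and k
  proof (cases "k \<ge> m")
    case False
    have "norm (a + of_nat k + 1) \<le> norm a + norm (of_nat k :: complex) + norm (1::complex)"
      by (meson add_right_mono norm_triangle_le order_refl)
    hence "norm (rGamma (a + of_nat k + 1)) \<le> C" using a False by (intro C) auto
    thus ?thesis using False by simp
  next
    case True
    define b where "b = a + of_nat m + 1"
    have "norm b \<le> norm a + norm (of_nat m :: complex) + norm (1::complex)"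
      unfolding b_def by (meson add_right_mono norm_triangle_le order_refl)
    hence Cb: "norm (rGamma b) \<le> C" using a by (intro C) auto
    have "- Re a \<le> norm a" using abs_Re_le_cmod[of a] by linarith
    hence "Re b \<ge> 1" using a m by (simp add: b_def)
    hence "fact (k - m) * norm (rGamma (a + of_nat k + 1)) \<le>
        norm (pochhammer b (k - m)) * norm (rGamma (a + of_nat k + 1))"
      by (intro mult_right_mono fact_le_norm_pochhammer) auto
    also have "\<dots> = norm (rGamma b)"
      using True pochhammer_rGamma[of b "k - m"] by (simp add: b_def norm_mult of_nat_diff algebra_simps)
    finally show ?thesis using Cb by (simp add: field_simps)
  qed
  thus ?thesis by blast
qed

lemma summable_power_div_fact_diff: "summable (\<lambda>k. C * (x :: real) ^ k / fact (k - m))"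
proof -
  have "summable (\<lambda>k. C * x ^ m * (x ^ k /\<^sub>R fact k))"
    by (intro summable_mult summable_exp_generic)
  also have "(\<lambda>k. C * x ^ m * (x ^ k /\<^sub>R fact k)) = (\<lambda>k. C * x ^ (k + m) / fact (k + m - m))"
    by (simp add: power_add field_simps)
  finally show ?thesis by (subst (asm) summable_iff_shift[of "\<lambda>k. C * x ^ k / fact (k - m)" m])
qed

text \<open>With \<open>b = 0\<close> this is the series of \<open>I\<^bsub>a\<^esub>\<close>, in general that of the function \<open>s\<^bsub>\<mu>,\<nu>\<^esub>\<close>.\<close>

definition rGamma_series2 :: "complex \<Rightarrow> complex \<Rightarrow> complex \<Rightarrow> complex" where
  "rGamma_series2 a b q = (\<Sum>k. rGamma (a + of_nat k + 1) * rGamma (b + of_nat k + 1) * q ^ k)"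

lemma rGamma_series2_term_bound:
  fixes q :: complex
  shows "\<exists>C m. \<forall>a b k. norm a \<le> R \<longrightarrow> norm b \<le> R \<longrightarrow>
     norm (rGamma (a + of_nat k + 1) * rGamma (b + of_nat k + 1) * q ^ k) \<le> C * norm q ^ k / fact (k - m)"
proof -
  obtain C m where C: "\<And>a k. norm (a :: complex) \<le> R \<Longrightarrow> norm (rGamma (a + of_nat k + 1)) \<le> C / fact (k - m)"
    using rGamma_uniform_bound by blast
  show ?thesis
  proof (intro exI allI impI)
    fix a b :: complex and k :: nat
    assume ab: "norm a \<le> R" "norm b \<le> R"
    have C0: "C \<ge> 0" using order_trans[OF norm_ge_zero C[OF ab(1), of 0]] by simp
    \<comment> \<open>The factorial decay of one factor suffices; the other is only kept
      bounded.\<close>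
    have "norm (rGamma (b + of_nat k + 1)) \<le> C / fact (k - m)" by (rule C) fact
    also have "\<dots> \<le> C / 1" using C0 by (intro divide_left_mono) auto
    finally have "norm (rGamma (a + of_nat k + 1) * rGamma (b + of_nat k + 1) * q ^ k) \<le>
          (C / fact (k - m)) * C * norm q ^ k"
      unfolding norm_mult norm_power using ab C C0 by (intro mult_mono) auto
    thus "norm (rGamma (a + of_nat k + 1) * rGamma (b + of_nat k + 1) * q ^ k) \<le> (C*C) * norm q ^ k / fact (k - m)"
      by (simp add: field_simps)
  qed
qed

lemma summable_norm_rGamma_series2:
  fixes q :: complex
  shows "summable (\<lambda>k. norm (rGamma (a + of_nat k + 1) * rGamma (b + of_nat k + 1) * q ^ k))"
proof -
  obtain C m where "\<And>k. norm (rGamma (a + of_nat k + 1) * rGamma (b + of_nat k + 1) * q ^ k) \<le> C * norm q ^ k / fact (k - m)"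
    using rGamma_series2_term_bound[of "max (norm a) (norm b)" q] by (metis max.cobounded1 max.cobounded2)
  thus ?thesis
    by (intro summable_comparison_test'[OF summable_power_div_fact_diff[of C "norm q" m]]) auto
qed

text \<open>Tannery's theorem, with a majorant uniform for both indices in a disc around their
  limits. Since both may vary along any filter, this gives continuity of the Bessel series in the
  order and of the Lommel series in order and index.\<close>

lemma tendsto_rGamma_series2:
  assumes f: "(f \<longlongrightarrow> a) F" and g: "(g \<longlongrightarrow> b) F"
  shows "((\<lambda>x. rGamma_series2 (f x) (g x) q) \<longlongrightarrow> rGamma_series2 a b q) F"
proof (cases "F = bot")
  case False
  define R where "R = max (norm a) (norm b) + 1"
  obtain C m where C: "\<And>a b k. norm a \<le> R \<Longrightarrow> norm b \<le> R \<Longrightarrow>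
     norm (rGamma (a + of_nat k + 1) * rGamma (b + of_nat k + 1) * q ^ k) \<le> C * norm q ^ k / fact (k - m)"
    using rGamma_series2_term_bound[of R q] by blast
  have ev1: "\<forall>\<^sub>F x in F. norm (f x) < R \<and> norm (g x) < R"
    using order_tendstoD(2)[OF tendsto_norm[OF f], of R] order_tendstoD(2)[OF tendsto_norm[OF g], of R]
    by (auto simp: R_def eventually_conj_iff)
  have "(\<forall>\<^sub>F x in F. summable (\<lambda>k. norm (rGamma (f x + of_nat k + 1) * rGamma (g x + of_nat k + 1) * q ^ k))) \<and>
      summable (\<lambda>k. norm (rGamma (a + of_nat k + 1) * rGamma (b + of_nat k + 1) * q ^ k)) \<and>
      ((\<lambda>x. \<Sum>k. rGamma (f x + of_nat k + 1) * rGamma (g x + of_nat k + 1) * q ^ k) \<longlongrightarrow>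
        (\<Sum>k. rGamma (a + of_nat k + 1) * rGamma (b + of_nat k + 1) * q ^ k)) F"
  proof (rule tannerys_theorem)
    have "continuous_on UNIV (rGamma :: complex \<Rightarrow> complex)" by (intro continuous_intros)
    hence r: "((\<lambda>x. rGamma (h x)) \<longlongrightarrow> rGamma l) F" if "(h \<longlongrightarrow> l) F" for h and l :: complex
      using that by (metis continuous_on_eq_continuous_at isCont_tendsto_compose iso_tuple_UNIV_I open_UNIV)
    show "((\<lambda>x. rGamma (f x + of_nat k + 1) * rGamma (g x + of_nat k + 1) * q ^ k) \<longlongrightarrow>
         rGamma (a + of_nat k + 1) * rGamma (b + of_nat k + 1) * q ^ k) F" for k
      by (intro tendsto_intros r f g)
    show "\<forall>\<^sub>F (k, x) in at_top \<times>\<^sub>F F. norm (rGamma (f x + of_nat k + 1) * rGamma (g x + of_nat k + 1) * q ^ k)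
        \<le> C * norm q ^ k / fact (k - m)"
      unfolding eventually_prod_filter using ev1
      by (intro exI[of _ "\<lambda>_. True"] exI[of _ "\<lambda>x. norm (f x) < R \<and> norm (g x) < R"]) (auto intro!: C)
  qed (use False summable_power_div_fact_diff in auto)
  thus ?thesis by (simp add: rGamma_series2_def)
qed simp

section \<open>Partial fractions of the tangent over the odd integers\<close>

lemma sin_pi_nonzero: "z \<notin> \<int> \<Longrightarrow> sin (of_real pi * z :: complex) \<noteq> 0"
  using Complex_Transcendental.sin_eq_0[of "of_real pi * z"] by auto

text \<open>The product \<open>rGamma z * rGamma (1 - z)\<close> equals sin (pi z) / pi;
  differentiating both forms and comparing gives the formula.\<close>

lemma Digamma_reflection_complex:
  fixes z :: complex
  assumes "z \<notin> \<int>"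
  shows "Digamma (1 - z) - Digamma z = of_real pi * cot (of_real pi * z)"
proof -
  have z1: "1 - z \<notin> \<int>" using assms by (metis Ints_1 Ints_diff diff_diff_eq2 add_diff_cancel_left')
  have nz: "z \<notin> \<int>\<^sub>\<le>\<^sub>0" "1 - z \<notin> \<int>\<^sub>\<le>\<^sub>0" using assms z1 nonpos_Ints_subset_Ints by auto
  have "((\<lambda>z. rGamma z * rGamma (1 - z)) has_field_derivative
      rGamma z * rGamma (1 - z) * (Digamma (1 - z) - Digamma z)) (at z)"
    using nz by (auto intro!: derivative_eq_intros simp: algebra_simps)
  moreover have "((\<lambda>z. rGamma z * rGamma (1 - z)) has_field_derivative cos (of_real pi * z)) (at z)"
    unfolding rGamma_reflection_complex by (auto intro!: derivative_eq_intros)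
  ultimately have "rGamma z * rGamma (1 - z) * (Digamma (1 - z) - Digamma z) = cos (of_real pi * z)"
    by (rule DERIV_unique)
  moreover have "sin (of_real pi * z) \<noteq> 0"
    by (rule sin_pi_nonzero) fact
  ultimately show ?thesis
    unfolding rGamma_reflection_complex by (simp add: cot_def field_simps)
qed

text \<open>The poles 2k + 1 and -(2k + 1) are kept together, since the sum converges only in this
  symmetric order. The two terms of index k will come from the k-th terms of the expansions on the
  two sides of t = 1.\<close>

definition odd_pfd :: "nat \<Rightarrow> complex \<Rightarrow> complex" where
  "odd_pfd N z = (\<Sum>k<N. 1 / (z + of_nat (2*k+1)) + 1 / (z - of_nat (2*k+1)))"

text \<open>For w = (z + 1) / 2 each pair is half of 1 / (w + n) - 1 / (1 - w + n), so the partial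
  sums are half the difference of the sequences tending to Digamma at 1 - w and at w; the logarithms
  cancel. The shift by pi / 2 turns the cotangent into minus the tangent.\<close>

lemma odd_pfd_tendsto:
  assumes "(z + 1) / 2 \<notin> \<int>"
  shows "(\<lambda>N. odd_pfd N z) \<longlonglongrightarrow> - (of_real pi / 2) * tan (of_real pi * z / 2)"
proof -
  define w where "w = (z + 1) / 2"
  have w: "w \<noteq> 0" "1 - w \<noteq> 0" "w \<notin> \<int>" using assms by (auto simp: w_def)
  have "(\<lambda>N. ((of_real (ln (real N)) - (\<Sum>n<N. inverse ((1 - w) + of_nat n))) -
        (of_real (ln (real N)) - (\<Sum>n<N. inverse (w + of_nat n)))) / 2) \<longlonglongrightarrow> (Digamma (1 - w) - Digamma w) / 2"
    using w by (intro tendsto_intros Digamma_LIMSEQ) auto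
  moreover have "((of_real (ln (real N)) - (\<Sum>n<N. inverse ((1 - w) + of_nat n))) -
        (of_real (ln (real N)) - (\<Sum>n<N. inverse (w + of_nat n)))) / 2 = odd_pfd N z" for N
  proof -
    have "((of_real (ln (real N)) - (\<Sum>n<N. inverse ((1 - w) + of_nat n))) -
        (of_real (ln (real N)) - (\<Sum>n<N. inverse (w + of_nat n)))) / 2 =
        (\<Sum>n<N. (inverse (w + of_nat n) - inverse ((1 - w) + of_nat n)) / 2)"
      by (simp add: sum_subtractf sum_divide_distrib diff_divide_distrib)
    also have "\<dots> = odd_pfd N z"
      unfolding odd_pfd_def
    proof (rule sum.cong[OF refl])
      fix n :: nat
      have e: "w + of_nat n = (z + of_nat (2*n+1)) / 2" "(1 - w) + of_nat n = - ((z - of_nat (2*n+1)) / 2)"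
        by (simp_all add: w_def field_simps)
      have i: "(inverse (x / 2) - inverse (- (y / 2))) / 2 = 1 / x + 1 / y" for x y :: complex
        by (simp add: add_divide_distrib)
      show "(inverse (w + of_nat n) - inverse ((1 - w) + of_nat n)) / 2 =
        1 / (z + of_nat (2*n+1)) + 1 / (z - of_nat (2*n+1))"
        unfolding e by (rule i)
    qed
    finally show ?thesis .
  qed
  moreover have "(Digamma (1 - w) - Digamma w) / 2 = - (of_real pi / 2) * tan (of_real pi * z / 2)"
  proof -
    have "of_real pi * w = of_real pi * z / 2 + of_real pi / 2" by (simp add: w_def field_simps)
    thus ?thesis using Digamma_reflection_complex[OF w(3)]
      by (simp add: cot_def tan_def sin_add cos_add)
  qed
  ultimately show ?thesis by simp
qed

text \<open>A shift by 2 moves each pole onto its neighbour, so both halves telescope. Their inner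
  boundary terms 1 / (z + 1) cancel and the outer ones remain.\<close>

lemma odd_pfd_shift:
  assumes "N > 0"
  shows "odd_pfd N (z + 2) = odd_pfd N z + 1 / (z + of_nat (2*N+1)) - 1 / (z + 1 - of_nat (2*N))"
  unfolding odd_pfd_def
proof -
  have "(\<Sum>k<N. 1 / (z + 2 + of_nat (2*k+1)) + 1 / (z + 2 - of_nat (2*k+1))) =
     (\<Sum>k<N. 1 / (z + of_nat (2*k+1)) + 1 / (z - of_nat (2*k+1))) +
     (\<Sum>k<N. (1 / (z + of_nat (2*Suc k+1)) - 1 / (z + of_nat (2*k+1))) -
             (1 / (z + 1 - of_nat (2*Suc k)) - 1 / (z + 1 - of_nat (2*k))))"
    by (subst sum.distrib[symmetric], intro sum.cong) (auto simp: algebra_simps)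
  also have "(\<Sum>k<N. (1 / (z + of_nat (2*Suc k+1)) - 1 / (z + of_nat (2*k+1))) -
             (1 / (z + 1 - of_nat (2*Suc k)) - 1 / (z + 1 - of_nat (2*k)))) =
     1 / (z + of_nat (2*N+1)) - 1 / (z + 1 - of_nat (2*N))"
    by (subst sum_subtractf, subst (1 2) sum_lessThan_telescope) simp
  finally show "(\<Sum>k<N. 1 / (z + 2 + of_nat (2*k+1)) + 1 / (z + 2 - of_nat (2*k+1))) =
     (\<Sum>k<N. 1 / (z + of_nat (2*k+1)) + 1 / (z - of_nat (2*k+1))) + 1 / (z + of_nat (2*N+1)) - 1 / (z + 1 - of_nat (2*N))"
    by simp
qed

lemma norm_diff_of_int_ge_pos:
  fixes z :: complex
  assumes "z \<notin> \<int>"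
  obtains d where "d > 0" "\<And>n. norm (z - of_int n) \<ge> d"
proof -
  have "open (- \<int> :: complex set)" by (intro open_Compl) (rule closed_Ints)
  then obtain d where "d > 0" "ball z d \<subseteq> - \<int>" using assms by (metis ComplI open_contains_ball)
  thus ?thesis by (intro that[of d]) (force simp: dist_norm subset_iff not_less[symmetric])+
qed

text \<open>Convergence bounds the sequence for n = 0, and each shift by 2 adds at most 2 / d, where
  d bounds the distance of z from the integers from below. Uniformity in N with linear growth in n
  is what later permits the limit N to infinity under the sum over Bessel coefficients.\<close>

lemma odd_pfd_bound:
  assumes "z \<notin> \<int>"
  shows "\<exists>C. \<forall>N n. norm (odd_pfd N (z + of_nat (2*n))) \<le> C * (1 + real n)"
proof -
  obtain d where d: "d > 0" "\<And>n. norm (z - of_int n) \<ge> d" using norm_diff_of_int_ge_pos assms by blast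
  have dd: "norm (1 / (z - of_int n)) \<le> 1 / d" for n
    using d(2)[of n] d(1) by (simp add: norm_divide frac_le)
  have "(z + 1) / 2 \<notin> \<int>"
  proof
    assume "(z + 1) / 2 \<in> \<int>"
    hence "2 * ((z + 1) / 2) - 1 \<in> \<int>" by (intro Ints_diff Ints_mult) auto
    moreover have "2 * ((z + 1) / 2) - 1 = z" by (simp add: field_simps)
    ultimately show False using assms by metis
  qed
  from odd_pfd_tendsto[OF this] have "Bseq (\<lambda>N. odd_pfd N z)" by (metis convergent_def convergent_imp_Bseq)
  then obtain B where B: "B > 0" "\<And>N. norm (odd_pfd N z) \<le> B" by (auto elim: BseqE)
  have "norm (odd_pfd N (z + of_nat (2*n))) \<le> B + real n * (2 / d)" for N n
  proof (induction n)
    case 0 thus ?case using B by simp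
  next
    case (Suc n)
    show ?case
    proof (cases "N = 0")
      case True thus ?thesis using B d by (simp add: odd_pfd_def)
    next
      case False
      define w where "w = z + of_nat (2*n)"
      have e: "z + of_nat (2 * Suc n) = w + 2" by (simp add: w_def)
      have "norm (odd_pfd N (w + 2)) \<le> norm (odd_pfd N w) + norm (1 / (w + of_nat (2*N+1))) + norm (1 / (w + 1 - of_nat (2*N)))"
        using False by (subst odd_pfd_shift) (auto intro: norm_triangle_le_diff norm_triangle_le order_trans[OF norm_triangle_ineq4] add_mono norm_triangle_ineq)
      also have "norm (1 / (w + of_nat (2*N+1))) \<le> 1 / d"
        using dd[of "- int (2*n) - int (2*N+1)"] by (simp add: w_def algebra_simps)
      also have "norm (1 / (w + 1 - of_nat (2*N))) \<le> 1 / d"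
        using dd[of "- int (2*n) - 1 + int (2*N)"] by (simp add: w_def algebra_simps)
      finally have "norm (odd_pfd N (w + 2)) \<le> norm (odd_pfd N w) + 1 / d + 1 / d" by simp
      also have "\<dots> \<le> B + real (Suc n) * (2 / d)" using Suc by (simp add: w_def add_divide_distrib algebra_simps)
      finally show ?thesis by (simp only: e)
    qed
  qed
  moreover have "B + real n * (2 / d) \<le> (B + 2 / d) * (1 + real n)" for n
  proof -
    have "(B + 2 / d) * (1 + real n) - (B + real n * (2 / d)) = B * real n + 2 / d" by (simp add: algebra_simps add_divide_distrib)
    moreover have "B * real n + 2 / d \<ge> 0" using B d by (intro add_nonneg_nonneg) auto
    ultimately show ?thesis by (metis diff_ge_0_iff_ge)
  qed
  ultimately show ?thesis by (meson order_trans)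
qed

section \<open>Integrals over half-lines and primitives of power series\<close>

lemma set_integrable_dominated:
  fixes f :: "real \<Rightarrow> 'a :: {banach, second_countable_topology}"
    and g :: "real \<Rightarrow> 'b :: {banach, second_countable_topology}"
  assumes "set_integrable lborel A f" "A \<in> sets borel" "g \<in> borel_measurable borel"
    and "\<And>x. x \<in> A \<Longrightarrow> norm (g x) \<le> norm (f x)"
  shows "set_integrable lborel A g"
  by (rule set_integrable_bound[OF assms(1)]) (use assms in \<open>auto simp: set_borel_measurable_def\<close>)

lemma set_integral_dominated_LIMSEQ:
  fixes F :: "nat \<Rightarrow> real \<Rightarrow> complex" and w :: "real \<Rightarrow> real"
  assumes w: "set_integrable lborel A w" and A: "A \<in> sets borel"
    and F: "\<And>n. F n \<in> borel_measurable borel" and f: "f \<in> borel_measurable borel"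
    and lim: "\<And>t. t \<in> A \<Longrightarrow> (\<lambda>n. F n t) \<longlonglongrightarrow> f t"
    and bound: "\<And>n t. t \<in> A \<Longrightarrow> norm (F n t) \<le> w t"
  shows "(\<lambda>n. LINT t:A|lborel. F n t) \<longlonglongrightarrow> (LINT t:A|lborel. f t)"
  unfolding set_lebesgue_integral_def
proof (rule integral_dominated_convergence[where w = "\<lambda>t. indicat_real A t *\<^sub>R w t"])
  show "integrable lborel (\<lambda>t. indicat_real A t *\<^sub>R w t)" using w by (simp only: set_integrable_def)
  show "AE t in lborel. (\<lambda>n. indicat_real A t *\<^sub>R F n t) \<longlonglongrightarrow> indicat_real A t *\<^sub>R f t"
  proof (intro AE_I2)
    fix t
    show "(\<lambda>n. indicat_real A t *\<^sub>R F n t) \<longlonglongrightarrow> indicat_real A t *\<^sub>R f t"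
      using lim[of t] by (cases "t \<in> A") auto
  qed
  show "AE t in lborel. norm (indicat_real A t *\<^sub>R F n t) \<le> indicat_real A t *\<^sub>R w t" for n
    using bound by (intro AE_I2) (auto simp: indicator_def)
qed (use A F f in auto)

lemma set_integral_real_of_complex:
  fixes F :: "real \<Rightarrow> complex" and f :: "real \<Rightarrow> real"
  assumes F: "set_integrable lborel A F" and A: "A \<in> sets borel" and e: "\<And>x. x \<in> A \<Longrightarrow> F x = of_real (f x)"
  shows "set_integrable lborel A f" "of_real (LINT x:A|lborel. f x) = (LINT x:A|lborel. F x)"
proof -
  have "set_integrable lborel A F \<longleftrightarrow> set_integrable lborel A (\<lambda>x. complex_of_real (f x))"
    by (rule set_integrable_cong[OF refl refl e])
  with F show "set_integrable lborel A f"
    unfolding set_integrable_def scaleR_conv_of_real by (simp add: complex_of_real_integrable_eq flip: of_real_mult)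
  have "(LINT x:A|lborel. F x) = (LINT x:A|lborel. complex_of_real (f x))"
    by (rule set_lebesgue_integral_cong) (use A e in auto)
  thus "of_real (LINT x:A|lborel. f x) = (LINT x:A|lborel. F x)" by (simp only: set_integral_complex_of_real)
qed

lemma set_integrable_scale_pos:
  fixes f :: "real \<Rightarrow> complex"
  assumes "c > 0"
  shows "set_integrable lborel {0<..} (\<lambda>x. f (c * x)) \<longleftrightarrow> set_integrable lborel {0<..} f"
proof -
  have "(\<lambda>x. indicat_real {0<..} x *\<^sub>R f (c * x)) = (\<lambda>x. indicat_real {0<..} (0 + c * x) *\<^sub>R f (0 + c * x))"
    using assms by (auto simp: indicator_def zero_less_mult_iff)
  thus ?thesis unfolding set_integrable_def
    using lborel_integrable_real_affine_iff[of c "\<lambda>x. indicat_real {0<..} x *\<^sub>R f x" 0] assms by simp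
qed

lemma set_integral_scale_pos:
  fixes f :: "real \<Rightarrow> complex"
  assumes "c > 0"
  shows "(LINT x:{0<..}|lborel. f x) = of_real c * (LINT x:{0<..}|lborel. f (c * x))"
proof -
  have "(\<lambda>x. indicat_real {0<..} x *\<^sub>R f (c * x)) = (\<lambda>x. indicat_real {0<..} (0 + c * x) *\<^sub>R f (0 + c * x))"
    using assms by (auto simp: indicator_def zero_less_mult_iff)
  thus ?thesis unfolding set_lebesgue_integral_def
    using lborel_integral_real_affine[of c "\<lambda>x. indicat_real {0<..} x *\<^sub>R f x" 0] assms
    by (simp add: scaleR_conv_of_real)
qed

text \<open>The principal power is discontinuous across the negative axis, so it is split by the
  sign of the base into functions that are exponentials of measurable ones.\<close>

lemma borel_measurable_of_real_powr [measurable (raw)]: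
  assumes [measurable]: "f \<in> borel_measurable M"
  shows "(\<lambda>x. complex_of_real (f x) powr z) \<in> borel_measurable M"
proof -
  have "complex_of_real t powr z = (if t = 0 then 0 else if t > 0 then exp (z * of_real (ln t))
      else exp (z * (of_real (ln (- t)) + \<i> * of_real pi)))" for t :: real
  proof (cases "t < 0")
    case True
    thus ?thesis using Ln_minus[of "of_real (- t)"] Ln_of_real[of "- t"] by (simp add: powr_def)
  qed (auto simp: powr_def Ln_of_real)
  thus ?thesis by simp
qed

lemma Gamma_integral_lborel:
  assumes z: "Re z > 0" and a: "a > 0"
  shows "set_integrable lborel {0<..} (\<lambda>t. of_real t powr (z - 1) * of_real (exp (- a * t)))" (is ?th1)
    and "(LINT t:{0<..}|lborel. of_real t powr (z - 1) * of_real (exp (- a * t))) = of_real a powr (- z) * Gamma z" (is ?th2)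
proof -
  let ?f = "\<lambda>t. of_real t powr (z - 1) / complex_of_real (exp t)"
  have m: "(\<lambda>x. indicat_real {0<..} x *\<^sub>R ?f x) \<in> borel_measurable lborel"
    by (intro borel_measurable_scaleR borel_measurable_divide borel_measurable_of_real_powr) measurable
  have int: "set_integrable lborel {0<..} ?f"
    using absolutely_integrable_Gamma_integral'[OF z] integrable_completion[OF m]
    unfolding set_integrable_def by simp
  have val: "(LINT t:{0<..}|lborel. ?f t) = Gamma z"
    using set_borel_integral_eq_integral(2)[OF int] Gamma_integral_complex'[OF z] by (simp add: integral_unique)
  have e: "?f (a * t) = of_real a powr (z - 1) * (of_real t powr (z - 1) * of_real (exp (- a * t)))" if "t > 0" for t
    using that a by (simp add: powr_times_real exp_minus field_simps)
  have nz: "of_real a powr (z - 1) \<noteq> 0" using a by simp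
  have "set_integrable lborel {0<..} (\<lambda>t. ?f (a * t))" using int set_integrable_scale_pos[OF a, of ?f] by blast
  also have "?this \<longleftrightarrow> set_integrable lborel {0<..} (\<lambda>t. of_real a powr (z - 1) * (of_real t powr (z - 1) * of_real (exp (- a * t))))"
    by (intro set_integrable_cong refl e) auto
  finally show ?th1 using nz by (simp only: set_integrable_mult_right_iff nz if_False)
  have "Gamma z = of_real a * (LINT t:{0<..}|lborel. ?f (a * t))"
    using set_integral_scale_pos[OF a, of ?f] val by simp
  also have "(LINT t:{0<..}|lborel. ?f (a * t)) =
      (LINT t:{0<..}|lborel. of_real a powr (z - 1) * (of_real t powr (z - 1) * of_real (exp (- a * t))))"
    by (rule set_lebesgue_integral_cong; (intro allI impI e)?; simp)
  also have "\<dots> = of_real a powr (z - 1) * (LINT t:{0<..}|lborel. of_real t powr (z - 1) * of_real (exp (- a * t)))"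
    by simp
  finally have "Gamma z = of_real a powr z * (LINT t:{0<..}|lborel. of_real t powr (z - 1) * of_real (exp (- a * t)))"
    using a by (simp add: powr_diff)
  thus ?th2 using a by (simp add: powr_minus field_simps)
qed

lemma primitive_tendsto_at_top:
  fixes F f :: "real \<Rightarrow> complex"
  assumes F: "\<And>t. t > 0 \<Longrightarrow> (F has_vector_derivative f t) (at t)"
    and cont: "continuous_on {0<..} f" and int: "set_integrable lborel {1<..} f"
  shows "(F \<longlongrightarrow> F 1 + (LINT t:{1<..}|lborel. f t)) at_top"
proof -
  have ae: "AE x in lborel. indicat_real {1<..} x *\<^sub>R f x = indicat_real {1..} x *\<^sub>R f x"
    using AE_lborel_singleton[of 1] by eventually_elim (auto simp: indicator_def)
  have m: "(\<lambda>x. indicat_real {1..} x *\<^sub>R f x) \<in> borel_measurable lborel"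
    using borel_measurable_continuous_on_indicator[of "{1..}" f] continuous_on_subset[OF cont, of "{1..}"] by force
  have int': "set_integrable lborel {1..} f"
    using int unfolding set_integrable_def
    by (subst integrable_cong_AE[OF m borel_measurable_integrable[OF int[unfolded set_integrable_def]]]) (use ae in auto)
  have eq: "(LINT t:{1..}|lborel. f t) = (LINT t:{1<..}|lborel. f t)"
    unfolding set_lebesgue_integral_def
    by (rule integral_cong_AE[OF m borel_measurable_integrable[OF int[unfolded set_integrable_def]]]) (use ae in auto)
  have "((\<lambda>b. LINT t:{1..b}|lborel. f t) \<longlongrightarrow> (LINT t:{1..}|lborel. f t)) at_top"
    by (rule tendsto_set_lebesgue_integral_at_top) (use int' in auto)
  hence "((\<lambda>b. F 1 + (LINT t:{1..b}|lborel. f t)) \<longlongrightarrow> F 1 + (LINT t:{1<..}|lborel. f t)) at_top"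
    unfolding eq by (intro tendsto_intros)
  moreover have "\<forall>\<^sub>F b in at_top. F 1 + (LINT t:{1..b}|lborel. f t) = F b"
    using eventually_ge_at_top[of 1]
  proof eventually_elim
    case (elim b)
    have "(LINT t:{1..b}|lborel. f t) = F b - F 1"
      unfolding set_lebesgue_integral_def
      using integral_FTC_atLeastAtMost[of 1 b F f] elim continuous_on_subset[OF cont, of "{1..b}"] F
      by (force intro: has_vector_derivative_at_within)
    thus ?case by simp
  qed
  ultimately show ?thesis by (rule Lim_transform_eventually)
qed

lemma set_integral_unit_FTC:
  fixes F f :: "real \<Rightarrow> complex"
  assumes F: "\<And>t. t > 0 \<Longrightarrow> (F has_vector_derivative f t) (at t)"
    and cont: "continuous_on {0<..} f" and int: "set_integrable lborel {0<..<1} f"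
    and lim: "(F \<longlongrightarrow> A) (at_right 0)"
  shows "(LINT t:{0<..<1}|lborel. f t) = F 1 - A"
proof -
  have ei: "einterval (ereal 0) (ereal 1) = {0<..<1}" by (auto simp: einterval_def)
  have "(LBINT x=ereal 0..ereal 1. f x) = F 1 - A"
  proof (rule interval_integral_FTC_integrable)
    show "isCont f x" if "ereal 0 < ereal x" for x
      using that cont by (auto simp: continuous_on_eq_continuous_at)
    have "isCont F 1" using F[of 1] by (auto simp: has_vector_derivative_continuous)
    hence "(F \<longlongrightarrow> F 1) (at_left 1)" by (simp add: isCont_def filterlim_at_split)
    thus "((F \<circ> real_of_ereal) \<longlongrightarrow> F 1) (at_left (ereal 1))"
      unfolding ereal_tendsto_simps by simp
    show "((F \<circ> real_of_ereal) \<longlongrightarrow> A) (at_right (ereal 0))"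
      using lim unfolding ereal_tendsto_simps by simp
  qed (use F int ei in auto)
  thus ?thesis by (simp add: interval_lebesgue_integral_def ei zero_ereal_def one_ereal_def)
qed

lemma set_integral_split_at_1:
  fixes f :: "real \<Rightarrow> complex"
  assumes int: "set_integrable lborel {0<..} f"
  shows "set_integrable lborel {0<..<1} f" "set_integrable lborel {1<..} f"
    "(LINT t:{0<..}|lborel. f t) = (LINT t:{0<..<1}|lborel. f t) + (LINT t:{1<..}|lborel. f t)"
proof -
  show 1: "set_integrable lborel {0<..<1} f" and 2: "set_integrable lborel {1<..} f"
    by (rule set_integrable_subset[OF int]; auto)+
  have "(LINT t:{0<..}|lborel. f t) = (LINT t:{0<..<1} \<union> {1<..}|lborel. f t)"
    unfolding set_lebesgue_integral_def
  proof (rule integral_cong_AE)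
    show "AE x in lborel. indicat_real {0<..} x *\<^sub>R f x = indicat_real ({0<..<1} \<union> {1<..}) x *\<^sub>R f x"
      using AE_lborel_singleton[of 1] by eventually_elim (auto simp: indicator_def)
    show "(\<lambda>x. indicat_real {0<..} x *\<^sub>R f x) \<in> borel_measurable lborel"
      using int unfolding set_integrable_def by (rule borel_measurable_integrable)
    have "set_integrable lborel ({0<..<1} \<union> {1<..}) f"
      by (rule set_integrable_subset[OF int]) auto
    thus "(\<lambda>x. indicat_real ({0<..<1} \<union> {1<..}) x *\<^sub>R f x) \<in> borel_measurable lborel"
      unfolding set_integrable_def by (rule borel_measurable_integrable)
  qed
  also have "\<dots> = (LINT t:{0<..<1}|lborel. f t) + (LINT t:{1<..}|lborel. f t)"
    by (rule set_integral_Un) (use 1 2 in auto)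
  finally show "(LINT t:{0<..}|lborel. f t) = (LINT t:{0<..<1}|lborel. f t) + (LINT t:{1<..}|lborel. f t)" .
qed

text \<open>The limit of a power series at infinity is not visible from its coefficients; here it is
  read off from a known integral.\<close>

lemma primitive_tendsto_whole_integral:
  fixes F f :: "real \<Rightarrow> complex"
  assumes F: "\<And>t. t > 0 \<Longrightarrow> (F has_vector_derivative f t) (at t)"
    and cont: "continuous_on {0<..} f" and int: "set_integrable lborel {0<..} f"
    and lim: "(F \<longlongrightarrow> 0) (at_right 0)"
  shows "(F \<longlongrightarrow> (LINT t:{0<..}|lborel. f t)) at_top"
  using primitive_tendsto_at_top[OF F cont set_integral_split_at_1(2)[OF int]]
    set_integral_unit_FTC[OF F cont set_integral_split_at_1(1)[OF int] lim] set_integral_split_at_1(3)[OF int]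
  by simp

section \<open>Power series times a complex power, differentiated termwise\<close>

definition power_series_powr :: "complex \<Rightarrow> nat \<Rightarrow> (nat \<Rightarrow> complex) \<Rightarrow> real \<Rightarrow> complex" where
  "power_series_powr w s e t = of_real t powr w * (\<Sum>n. e n * of_real t ^ (s * n))"

text \<open>With g the entire function with coefficients \<open>e\<close>, the function is t^w
  g(t^s). The product rule produces w g(q) + s q g'(q) at q = t^s, and q g'(q) has the coefficients
  n e(n). The stride \<open>s\<close> is 1 for the Gamma kernel and 2 for Bessel series.\<close>

lemma power_series_powr_has_vector_derivative:
  assumes sum: "\<And>q. summable (\<lambda>n. e n * q ^ n)" and t: "t > 0"
  shows "(power_series_powr w s e has_vector_derivative
           power_series_powr (w - 1) s (\<lambda>n. (w + of_nat (s * n)) * e n) t) (at t)"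
proof -
  define g where "g q = (\<Sum>n. e n * q ^ n)" for q
  define q where "q = complex_of_real t ^ s"
  have sd: "summable (\<lambda>n. diffs e n * x ^ n)" for x
    by (rule termdiff_converges_all) (rule sum)
  have S1: "(\<lambda>n. of_nat n * e n * q ^ n) sums (q * (\<Sum>n. diffs e n * q ^ n))"
    using sums_mult[OF diffs_equiv[OF sd], of q q]
  proof (rule back_subst[of "\<lambda>f. f sums (q * (\<Sum>n. diffs e n * q ^ n))"])
    show "(\<lambda>n. q * (of_nat n * e n * q ^ (n - Suc 0))) = (\<lambda>n. of_nat n * e n * q ^ n)"
    proof
      fix n show "q * (of_nat n * e n * q ^ (n - Suc 0)) = of_nat n * e n * q ^ n" by (cases n) simp_all
    qed
  qed
  have g: "(g has_field_derivative (\<Sum>n. diffs e n * q ^ n)) (at q)"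
    unfolding g_def by (rule termdiffs_strong_converges_everywhere) (rule sum)
  have gs: "((\<lambda>z. g (z ^ s)) has_field_derivative (\<Sum>n. diffs e n * q ^ n) * (of_nat s * of_real t ^ (s - 1))) (at (of_real t))"
    by (rule DERIV_chain2[where g = "\<lambda>z. z ^ s"]) (use g in \<open>auto intro!: derivative_eq_intros simp: q_def\<close>)
  have "((\<lambda>z. z powr w * g (z ^ s)) has_field_derivative
      w * of_real t powr (w - 1) * g q + (\<Sum>n. diffs e n * q ^ n) * (of_nat s * of_real t ^ (s - 1)) * of_real t powr w) (at (of_real t))"
    using t by (auto intro!: derivative_eq_intros gs simp: q_def)
  also have "w * of_real t powr (w - 1) * g q + (\<Sum>n. diffs e n * q ^ n) * (of_nat s * of_real t ^ (s - 1)) * of_real t powr w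
     = of_real t powr (w - 1) * (w * g q + of_nat s * (q * (\<Sum>n. diffs e n * q ^ n)))"
  proof -
    have "of_nat s * of_real t ^ (s - 1) * of_real t powr w = of_nat s * (of_real t powr (w - 1) * q)"
      using t by (cases s) (auto simp: q_def powr_diff)
    thus ?thesis by (auto simp: algebra_simps)
  qed
  also have "w * g q + of_nat s * (q * (\<Sum>n. diffs e n * q ^ n)) = (\<Sum>n. (w + of_nat (s * n)) * e n * q ^ n)"
  proof -
    have "(\<lambda>n. w * (e n * q ^ n) + of_nat s * (of_nat n * e n * q ^ n)) sums (w * g q + of_nat s * (q * (\<Sum>n. diffs e n * q ^ n)))"
      unfolding g_def by (intro sums_add sums_mult summable_sums sum S1)
    thus ?thesis by (subst sums_unique) (auto simp: algebra_simps)
  qed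
  finally show ?thesis
    using has_vector_derivative_real_field[of "\<lambda>z. z powr w * g (z ^ s)" _ t UNIV]
    unfolding power_series_powr_def by (simp add: g_def q_def power_mult)
qed

lemma power_series_powr_tendsto_0:
  assumes sum: "\<And>q. summable (\<lambda>n. e n * q ^ n)" and w: "Re w > 0" and s: "s > 0"
  shows "(power_series_powr w s e \<longlongrightarrow> 0) (at_right 0)"
proof -
  have "isCont (\<lambda>q. \<Sum>n. e n * q ^ n) 0"
    by (rule DERIV_isCont[OF termdiffs_strong_converges_everywhere]) (rule sum)
  moreover have "((\<lambda>t. complex_of_real t ^ s) \<longlongrightarrow> 0) (at_right 0)"
    using s by (auto intro!: tendsto_eq_intros)
  ultimately have "((\<lambda>t. \<Sum>n. e n * (complex_of_real t ^ s) ^ n) \<longlongrightarrow> (\<Sum>n. e n * 0 ^ n)) (at_right 0)"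
    by (rule isCont_tendsto_compose)
  moreover have "((\<lambda>t. complex_of_real t powr w) \<longlongrightarrow> 0) (at_right 0)"
  proof (rule tendsto_norm_zero_cancel)
    have "((\<lambda>t. t powr Re w) \<longlongrightarrow> 0) (at_right 0)" using w by real_asymp
    moreover have "\<forall>\<^sub>F t in at_right 0. t powr Re w = norm (complex_of_real t powr w)"
      using eventually_at_right_less[of 0] by eventually_elim (simp add: norm_of_real_powr)
    ultimately show "((\<lambda>t. norm (complex_of_real t powr w)) \<longlongrightarrow> 0) (at_right 0)"
      by (rule Lim_transform_eventually)
  qed
  ultimately have "((\<lambda>t. complex_of_real t powr w * (\<Sum>n. e n * (complex_of_real t ^ s) ^ n)) \<longlongrightarrow> 0 * (\<Sum>n. e n * 0 ^ n)) (at_right 0)"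
    by (intro tendsto_mult)
  thus ?thesis unfolding power_series_powr_def by (simp add: power_mult)
qed

lemma continuous_on_power_series_powr:
  assumes sum: "\<And>q. summable (\<lambda>n. e n * q ^ n)"
  shows "continuous_on {0<..} (power_series_powr w s e)"
proof (intro continuous_at_imp_continuous_on ballI)
  fix t :: real assume "t \<in> {0<..}"
  thus "isCont (power_series_powr w s e) t"
    using power_series_powr_has_vector_derivative[of e t w s, OF sum] by (auto dest: has_vector_derivative_continuous)
qed

section \<open>Incomplete Gamma integrals\<close>

definition gamma_prim_coeff :: "real \<Rightarrow> complex \<Rightarrow> nat \<Rightarrow> complex" where
  "gamma_prim_coeff a z k = (- of_real a) ^ k / (fact k * (z + of_nat k))"

text \<open>This is a^(-z) times the lower incomplete Gamma function at (z, a t), continued to all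
  non-integral z by its series.\<close>

definition gamma_prim :: "real \<Rightarrow> complex \<Rightarrow> real \<Rightarrow> complex" where
  "gamma_prim a z = power_series_powr z 1 (gamma_prim_coeff a z)"

lemma nonint_add_nat_nonzero: "z \<notin> \<int> \<Longrightarrow> z + of_nat k \<noteq> (0 :: complex)"
  by (metis Ints_minus Ints_of_nat add_eq_0_iff2)

lemma nonint_add_int: "z + of_int n \<in> \<int> \<longleftrightarrow> (z :: complex) \<in> \<int>"
  by (metis Ints_add Ints_diff Ints_of_int add_diff_cancel_right')

lemma summable_gamma_prim_coeff:
  assumes "z \<notin> \<int>"
  shows "summable (\<lambda>k. norm (gamma_prim_coeff a z k * q ^ k))" "summable (\<lambda>k. gamma_prim_coeff a z k * q ^ k)"
proof -
  obtain d where d: "d > 0" "\<And>n. norm (z - of_int n) \<ge> d" using norm_diff_of_int_ge_pos assms by blast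
  have "summable (\<lambda>k. (1 / d) * ((\<bar>a\<bar> * norm q) ^ k /\<^sub>R fact k))"
    by (intro summable_mult summable_exp_generic)
  thus "summable (\<lambda>k. norm (gamma_prim_coeff a z k * q ^ k))"
  proof (rule summable_comparison_test'[where N = 0])
    fix k :: nat
    have "norm (z + of_nat k) \<ge> d" using d(2)[of "- int k"] by simp
    hence "norm (gamma_prim_coeff a z k * q ^ k) \<le> (\<bar>a\<bar> ^ k * norm q ^ k) / (fact k * d)"
      using d(1) unfolding gamma_prim_coeff_def by (simp add: norm_mult norm_divide norm_power frac_le)
    also have "\<dots> = (1 / d) * ((\<bar>a\<bar> * norm q) ^ k /\<^sub>R fact k)" by (simp add: power_mult_distrib field_simps)
    finally show "norm (norm (gamma_prim_coeff a z k * q ^ k)) \<le> (1 / d) * ((\<bar>a\<bar> * norm q) ^ k /\<^sub>R fact k)" by simp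
  qed
  thus "summable (\<lambda>k. gamma_prim_coeff a z k * q ^ k)" by (rule summable_norm_cancel)
qed

lemma exp_series_sums: "(\<lambda>k. (- of_real a) ^ k / fact k * of_real t ^ k) sums complex_of_real (exp (- a * t))"
proof -
  have "(\<lambda>k. (of_real (- a * t)) ^ k /\<^sub>R fact k) sums exp (complex_of_real (- a * t))" by (rule exp_converges)
  moreover have "(of_real (- a * t)) ^ k /\<^sub>R fact k = (- of_real a) ^ k / fact k * complex_of_real t ^ k" for k
    by (simp add: scaleR_conv_of_real power_mult_distrib field_simps flip: power_minus power_mult_distrib)
  ultimately show ?thesis by (simp add: exp_of_real[symmetric])
qed

lemma gamma_prim_has_vector_derivative:
  assumes "z \<notin> \<int>" "t > 0"
  shows "(gamma_prim a z has_vector_derivative of_real t powr (z - 1) * of_real (exp (- a * t))) (at t)"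
proof -
  have "(z + of_nat (1 * k)) * gamma_prim_coeff a z k = (- of_real a) ^ k / fact k" for k
    using nonint_add_nat_nonzero[OF assms(1), of k] by (simp add: gamma_prim_coeff_def)
  hence "power_series_powr (z - 1) 1 (\<lambda>n. (z + of_nat (1 * n)) * gamma_prim_coeff a z n) t = of_real t powr (z - 1) * of_real (exp (- a * t))"
    unfolding power_series_powr_def using sums_unique[OF exp_series_sums[of a t]] by simp
  thus ?thesis using power_series_powr_has_vector_derivative[OF summable_gamma_prim_coeff(2)[OF assms(1)] assms(2), of z 1 a]
    by (simp add: gamma_prim_def)
qed

text \<open>Integration by parts, carried out on coefficients because the integral from 0 diverges
  once Re z <= 0.\<close>

lemma gamma_prim_rec:
  assumes "z \<notin> \<int>" "t > 0"
  shows "z * gamma_prim a z t = of_real t powr z * of_real (exp (- a * t)) + of_real a * gamma_prim a (z + 1) t"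
proof -
  have z1: "z + 1 \<notin> \<int>" using nonint_add_int[of z 1] assms by simp
  define T where "T = complex_of_real t"
  have "(\<lambda>k. z * (gamma_prim_coeff a z k * T ^ k)) sums (z * (\<Sum>k. gamma_prim_coeff a z k * T ^ k))"
    by (intro sums_mult summable_sums summable_gamma_prim_coeff assms)
  moreover have "(\<lambda>k. (- of_real a) ^ k / fact k * T ^ k - of_nat k * gamma_prim_coeff a z k * T ^ k) sums
      (of_real (exp (- a * t)) + of_real a * T * (\<Sum>k. gamma_prim_coeff a (z+1) k * T ^ k))"
  proof -
    have "(\<lambda>k. - of_real a * T * (gamma_prim_coeff a (z+1) k * T ^ k)) sums (- of_real a * T * (\<Sum>k. gamma_prim_coeff a (z+1) k * T ^ k))"
      by (intro sums_mult summable_sums summable_gamma_prim_coeff z1)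
    also have "(\<lambda>k. - of_real a * T * (gamma_prim_coeff a (z+1) k * T ^ k)) = (\<lambda>k. of_nat (Suc k) * gamma_prim_coeff a z (Suc k) * T ^ Suc k)"
    proof
      fix k
      have e: "z + 1 + of_nat k = z + of_nat (Suc k)" by simp
      show "- of_real a * T * (gamma_prim_coeff a (z+1) k * T ^ k) = of_nat (Suc k) * gamma_prim_coeff a z (Suc k) * T ^ Suc k"
        unfolding gamma_prim_coeff_def e by (simp del: of_nat_Suc)
    qed
    finally have "(\<lambda>k. of_nat k * gamma_prim_coeff a z k * T ^ k) sums (- of_real a * T * (\<Sum>k. gamma_prim_coeff a (z+1) k * T ^ k))"
      by (subst (asm) sums_Suc_iff) simp
    from sums_diff[OF exp_series_sums[of a t, folded T_def] this] show ?thesis by simp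
  qed
  moreover have "z * (gamma_prim_coeff a z k * T ^ k) = (- of_real a) ^ k / fact k * T ^ k - of_nat k * gamma_prim_coeff a z k * T ^ k" for k
  proof -
    have "(- of_real a) ^ k / fact k = (z + of_nat k) * gamma_prim_coeff a z k"
      using nonint_add_nat_nonzero[OF assms(1), of k] by (simp add: gamma_prim_coeff_def)
    thus ?thesis by (simp only:) (simp add: algebra_simps)
  qed
  ultimately have "z * (\<Sum>k. gamma_prim_coeff a z k * T ^ k) = of_real (exp (- a * t)) + of_real a * T * (\<Sum>k. gamma_prim_coeff a (z+1) k * T ^ k)"
    by (simp add: sums_iff)
  hence "T powr z * (z * (\<Sum>k. gamma_prim_coeff a z k * T ^ k)) = T powr z * (of_real (exp (- a * t)) + of_real a * T * (\<Sum>k. gamma_prim_coeff a (z+1) k * T ^ k))"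
    by simp
  thus ?thesis using assms(2) unfolding gamma_prim_def power_series_powr_def T_def by (simp add: powr_add algebra_simps)
qed

text \<open>Take p-th powers in s / p <= exp (s / p). The exponent p is free, so exponential decay
  can be traded for any power.\<close>

lemma exp_neg_le_powr:
  fixes s p :: real
  assumes "s > 0" "p > 0"
  shows "exp (- s) \<le> p powr p * s powr (- p)"
proof -
  have "s / p \<le> exp (s / p)" using exp_ge_add_one_self[of "s / p"] by linarith
  hence "s \<le> p * exp (s / p)" using assms by (simp add: field_simps)
  hence "s powr p \<le> (p * exp (s / p)) powr p" using assms by (intro powr_mono2) auto
  also have "\<dots> = p powr p * exp s" using assms by (simp add: powr_mult exp_powr_real)
  finally show ?thesis using assms by (simp add: powr_minus exp_minus field_simps)
qed

lemma gamma_prim_integrable_Ioi: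
  assumes a: "a > 0"
  shows "set_integrable lborel {1<..} (\<lambda>u. of_real u powr (z - 1) * complex_of_real (exp (- a * u)))"
proof -
  define p where "p = complex_of_real (max 0 (Re z) + 1)"
  have "set_integrable lborel {1<..} (\<lambda>t. of_real t powr (p - 1) * complex_of_real (exp (- a * t)))"
    by (rule set_integrable_subset[OF Gamma_integral_lborel(1)[of p a]]) (auto simp: p_def a)
  thus ?thesis
    by (rule set_integrable_dominated) (auto simp: norm_mult norm_of_real_powr p_def intro!: mult_right_mono powr_mono)
qed

lemma powr_tendsto_0_exp: "a > 0 \<Longrightarrow> ((\<lambda>t. complex_of_real t powr z * of_real (exp (- a * t))) \<longlongrightarrow> 0) at_top"
proof (rule tendsto_norm_zero_cancel)
  assume a: "a > 0"
  have "((\<lambda>t. t powr Re z * exp (- a * t)) \<longlongrightarrow> 0) at_top" using a by real_asymp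
  moreover have "\<forall>\<^sub>F t in at_top. t powr Re z * exp (- a * t) = norm (complex_of_real t powr z * of_real (exp (- a * t)))"
    using eventually_gt_at_top[of 0] by eventually_elim (simp add: norm_mult norm_of_real_powr)
  ultimately show "((\<lambda>t. norm (complex_of_real t powr z * of_real (exp (- a * t)))) \<longlongrightarrow> 0) at_top"
    by (rule Lim_transform_eventually)
qed

lemma continuous_on_Gamma_kernel: "continuous_on {0<..} (\<lambda>t. complex_of_real t powr z * of_real (exp (- a * t)))"
  by (intro continuous_intros) auto

text \<open>For Re z > 0 the limit is the Gamma integral. The recursion expresses the primitive at z
  through the one at z + 1 and a term decaying at infinity, and the Gamma function obeys the same
  recursion, so the claim descends one unit strip at a time.\<close>

lemma gamma_prim_tendsto_at_top:
  assumes "z \<notin> \<int>" and a: "a > 0"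
  shows "(gamma_prim a z \<longlongrightarrow> of_real a powr (- z) * Gamma z) at_top"
proof -
  have "(gamma_prim a z \<longlongrightarrow> of_real a powr (- z) * Gamma z) at_top" if "z \<notin> \<int>" "Re z > - real n" for n z
    using that
  proof (induction n arbitrary: z)
    case 0
    have "(gamma_prim a z \<longlongrightarrow> 0) (at_right 0)"
      unfolding gamma_prim_def using 0 by (intro power_series_powr_tendsto_0 summable_gamma_prim_coeff) auto
    from primitive_tendsto_whole_integral[OF gamma_prim_has_vector_derivative[OF 0(1)] continuous_on_Gamma_kernel Gamma_integral_lborel(1)[OF _ a] this]
    show ?case using Gamma_integral_lborel(2)[OF _ a, of z] 0(2) by simp
  next
    case (Suc n)
    have z1: "z + 1 \<notin> \<int>" using nonint_add_int[of z 1] Suc.prems by simp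
    have z0: "z \<noteq> 0" using Suc.prems by auto
    have znp: "z \<notin> \<int>\<^sub>\<le>\<^sub>0" using Suc.prems nonpos_Ints_subset_Ints by auto
    have "((\<lambda>t. (of_real t powr z * of_real (exp (- a * t)) + of_real a * gamma_prim a (z + 1) t) / z) \<longlongrightarrow>
        (0 + of_real a * (of_real a powr (- (z + 1)) * Gamma (z + 1))) / z) at_top"
      using Suc.prems by (intro tendsto_intros powr_tendsto_0_exp Suc.IH z1 a z0) auto
    moreover have "(0 + of_real a * (of_real a powr (- (z + 1)) * Gamma (z + 1))) / z = of_real a powr (- z) * Gamma z"
    proof -
      have "of_real a * of_real a powr (- (z + 1)) = complex_of_real a powr (- z)"
        using powr_add[of "of_real a" 1 "-(z+1)"] a by simp
      thus ?thesis using Gamma_plus1[OF znp] z0 by (simp add: mult.assoc[symmetric])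
    qed
    moreover have "\<forall>\<^sub>F t in at_top. (of_real t powr z * of_real (exp (- a * t)) + of_real a * gamma_prim a (z + 1) t) / z = gamma_prim a z t"
      using eventually_gt_at_top[of 0]
    proof eventually_elim
      case (elim t)
      show ?case using gamma_prim_rec[OF Suc.prems(1) elim, of a] z0 by (simp add: field_simps)
    qed
    ultimately show ?case by (auto intro: Lim_transform_eventually)
  qed
  moreover obtain n :: nat where "- Re z < real n" using reals_Archimedean2 by blast
  ultimately show ?thesis using assms(1) by (metis minus_less_iff)
qed

lemma gamma_prim_integral_Ioi:
  assumes "z \<notin> \<int>" "a > 0"
  shows "(LINT u:{1<..}|lborel. of_real u powr (z - 1) * complex_of_real (exp (- a * u))) =
      of_real a powr (- z) * Gamma z - gamma_prim a z 1"
proof -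
  have "(gamma_prim a z \<longlongrightarrow> gamma_prim a z 1 + (LINT u:{1<..}|lborel. of_real u powr (z - 1) * complex_of_real (exp (- a * u)))) at_top"
    by (intro primitive_tendsto_at_top gamma_prim_has_vector_derivative continuous_on_Gamma_kernel gamma_prim_integrable_Ioi assms)
  from tendsto_unique[OF _ this gamma_prim_tendsto_at_top[OF assms]] show ?thesis by (simp add: algebra_simps)
qed

lemma gamma_prim_integrable_unit:
  assumes a: "a > 0"
  shows "set_integrable lborel {0<..<1} (\<lambda>u. of_real u powr (- z - 1) * complex_of_real (exp (- a / u)))"
proof -
  \<comment> \<open>Larger than Re z + 1, so that u powr (-Re z - 1) times (a / u) powr (-p) is a
    positive power of u, bounded on the unit interval.\<close>
  define p where "p = max 0 (Re z + 1) + 1"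
  have "set_integrable lborel {0<..<(1::real)} (\<lambda>_. complex_of_real (p powr p * a powr (- p)))"
    unfolding set_integrable_def by (intro integrable_scaleR_left integrable_real_indicator) auto
  thus ?thesis
  proof (rule set_integrable_dominated)
    have "u powr (- Re z - 1) * exp (- a / u) \<le> p powr p * a powr (- p)" if u: "0 < u" "u < 1" for u
    proof -
      have "exp (- (a / u)) \<le> p powr p * (a / u) powr (- p)" by (rule exp_neg_le_powr) (use a u in \<open>auto simp: p_def\<close>)
      hence "u powr (- Re z - 1) * exp (- (a / u)) \<le> u powr (- Re z - 1) * (p powr p * (a / u) powr (- p))"
        by (intro mult_left_mono) auto
      also have "\<dots> = p powr p * a powr (- p) * u powr (p - Re z - 1)"
        using a u by (simp add: powr_divide powr_minus powr_diff powr_add field_simps)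
      also have "\<dots> \<le> p powr p * a powr (- p) * 1"
        using u by (intro mult_left_mono powr_le1) (auto simp: p_def)
      finally show ?thesis by simp
    qed
    thus "norm (of_real u powr (- z - 1) * complex_of_real (exp (- a / u))) \<le> norm (complex_of_real (p powr p * a powr (- p)))"
      if "u \<in> {0<..<1}" for u
      using that by (simp add: norm_mult norm_of_real_powr)
  qed measurable
qed

text \<open>The substitution u to 1 / u leads to the integral over (1,oo). It is performed on the
  primitive, whose limit at 0 thereby becomes the limit of \<open>gamma_prim\<close> at
  infinity.\<close>

lemma gamma_prim_integral_unit:
  assumes z: "z \<notin> \<int>" and a: "a > 0"
  shows "(LINT u:{0<..<1}|lborel. of_real u powr (- z - 1) * complex_of_real (exp (- a / u))) =
      of_real a powr (- z) * Gamma z - gamma_prim a z 1"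
proof -
  have "(LINT u:{0<..<1}|lborel. of_real u powr (- z - 1) * complex_of_real (exp (- a / u))) =
      - gamma_prim a z (inverse 1) - - (of_real a powr (- z) * Gamma z)"
  proof (rule set_integral_unit_FTC[where F = "\<lambda>u. - gamma_prim a z (inverse u)"])
    fix t :: real assume t: "t > 0"
    have "((\<lambda>u. gamma_prim a z (inverse u)) has_vector_derivative (- (inverse t ^ 2)) *\<^sub>R
        (of_real (inverse t) powr (z - 1) * of_real (exp (- a * inverse t)))) (at t)"
      using DERIV_inverse[of t] vector_diff_chain_at[of inverse "- (inverse t ^ 2)" t "gamma_prim a z" "of_real (inverse t) powr (z - 1) * of_real (exp (- a * inverse t))"]
        gamma_prim_has_vector_derivative[OF z, of "inverse t" a] t
      by (auto simp: o_def power2_eq_square has_real_derivative_iff_has_vector_derivative[symmetric])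
    from has_vector_derivative_minus[OF this]
    have "((\<lambda>u. - gamma_prim a z (inverse u)) has_vector_derivative of_real (inverse t) ^ 2 *
        (of_real (inverse t) powr (z - 1) * of_real (exp (- a * inverse t)))) (at t)"
      by (simp add: scaleR_conv_of_real)
    moreover have "of_real (inverse t) ^ 2 * of_real (inverse t) powr (z - 1) = complex_of_real t powr (- z - 1)"
    proof -
      have "complex_of_real (inverse t) = of_real t powr (- 1)" using t by (simp add: powr_minus)
      hence "of_real (inverse t) powr (z - 1) = complex_of_real t powr (1 - z)"
        using t by (simp add: powr_def Ln_of_real exp_minus[symmetric] ln_inverse algebra_simps)
      moreover have "complex_of_real (inverse t) ^ 2 = of_real t powr (- 2)"
        using t by (simp add: powr_minus power_inverse)
      moreover have e: "- z - 1 = - 2 + (1 - z)" by simp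
      ultimately show ?thesis unfolding e powr_add by simp
    qed
    ultimately show "((\<lambda>u. - gamma_prim a z (inverse u)) has_vector_derivative
        of_real t powr (- z - 1) * complex_of_real (exp (- a / t))) (at t)"
      by (simp add: mult.assoc[symmetric] divide_inverse)
  next
    show "continuous_on {0<..} (\<lambda>u. complex_of_real u powr (- z - 1) * complex_of_real (exp (- a / u)))"
      by (intro continuous_intros) auto
    show "set_integrable lborel {0<..<1} (\<lambda>u. complex_of_real u powr (- z - 1) * complex_of_real (exp (- a / u)))"
      by (rule gamma_prim_integrable_unit[OF a])
    show "((\<lambda>u. - gamma_prim a z (inverse u)) \<longlongrightarrow> - (of_real a powr (- z) * Gamma z)) (at_right 0)"
      by (intro tendsto_minus filterlim_compose[OF gamma_prim_tendsto_at_top[OF z a] filterlim_inverse_at_top_right])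
  qed
  thus ?thesis by simp
qed

section \<open>An integral representation of the modified Bessel function \<open>K\<close>\<close>

text \<open>With y = x^2 / 4, K_\<nu>(x) is (x / 2)^\<nu> / 2 times the integral of this kernel over
  u > 0. The integrand is entire in \<nu>, so integral orders are not special.\<close>

definition bessel_K_kernel :: "complex \<Rightarrow> real \<Rightarrow> real \<Rightarrow> complex" where
  "bessel_K_kernel \<nu> y u = of_real u powr (- \<nu> - 1) * of_real (exp (- u - y / u))"

definition bessel_K_integral :: "complex \<Rightarrow> real \<Rightarrow> complex" where
  "bessel_K_integral \<nu> y = (LINT u:{0<..}|lborel. bessel_K_kernel \<nu> y u)"

lemma bessel_K_kernel_measurable [measurable]: "bessel_K_kernel \<nu> y \<in> borel_measurable lborel"
  unfolding bessel_K_kernel_def by measurable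

text \<open>Trading exp (-y / u) for a p-th power leaves a Gamma integrand. The exponent p stays
  free: it decides which power of y bounds the integral.\<close>

lemma norm_bessel_K_kernel_le:
  assumes "u > 0" "y > 0" "p > 0"
  shows "norm (bessel_K_kernel \<nu> y u) \<le> p powr p * y powr (- p) * (u powr (p - Re \<nu> - 1) * exp (- u))"
proof -
  have "exp (- (y / u)) \<le> p powr p * (y / u) powr (- p)" by (rule exp_neg_le_powr) (use assms in auto)
  hence "u powr (- Re \<nu> - 1) * exp (- u) * exp (- (y / u)) \<le> u powr (- Re \<nu> - 1) * exp (- u) * (p powr p * (y / u) powr (- p))"
    by (intro mult_left_mono) auto
  also have "\<dots> = p powr p * y powr (- p) * (u powr (p - Re \<nu> - 1) * exp (- u))"
    using assms by (simp add: powr_divide powr_minus powr_diff powr_add field_simps)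
  finally have le: "u powr (- Re \<nu> - 1) * exp (- u) * exp (- (y / u)) \<le> p powr p * y powr (- p) * (u powr (p - Re \<nu> - 1) * exp (- u))" .
  have "exp (- u - y / u) = exp (- u) * exp (- (y / u))" by (simp add: exp_add[symmetric])
  thus ?thesis using le assms by (simp add: bessel_K_kernel_def norm_mult norm_of_real_powr mult.assoc)
qed

lemma real_Gamma_integral_lborel:
  fixes q :: real
  assumes q: "q > 0"
  shows "set_integrable lborel {0<..} (\<lambda>u. u powr (q - 1) * exp (- u))"
    "(LINT u:{0<..}|lborel. u powr (q - 1) * exp (- u)) = Gamma q"
proof -
  have e: "of_real u powr (of_real q - 1) * of_real (exp (- 1 * u)) = complex_of_real (u powr (q - 1) * exp (- u))" if "u > 0" for u
    using that powr_of_real[of u "q - 1"] by simp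
  have i: "set_integrable lborel {0<..} (\<lambda>u. of_real u powr (of_real q - 1) * of_real (exp (- 1 * u)) :: complex)"
    by (rule Gamma_integral_lborel(1)) (use q in auto)
  note r = set_integral_real_of_complex[OF i _ e]
  show "set_integrable lborel {0<..} (\<lambda>u. u powr (q - 1) * exp (- u))" by (rule r) auto
  have "complex_of_real (LINT u:{0<..}|lborel. u powr (q - 1) * exp (- u)) =
      (LINT u:{0<..}|lborel. of_real u powr (of_real q - 1) * of_real (exp (- 1 * u)))"
    by (rule r) auto
  also have "\<dots> = Gamma (of_real q)"
    by (subst Gamma_integral_lborel(2)) (use q in auto)
  finally show "(LINT u:{0<..}|lborel. u powr (q - 1) * exp (- u)) = Gamma q"
    by (simp only: Gamma_complex_of_real of_real_eq_iff)
qed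

lemma
  assumes "y > 0" "p > 0" "p > Re \<nu>"
  shows bessel_K_kernel_integrable_aux: "set_integrable lborel {0<..} (bessel_K_kernel \<nu> y)"
    and norm_bessel_K_integral_le: "norm (bessel_K_integral \<nu> y) \<le> p powr p * y powr (- p) * Gamma (p - Re \<nu>)"
proof -
  let ?g = "\<lambda>u. p powr p * y powr (- p) * (u powr (p - Re \<nu> - 1) * exp (- u))"
  have g: "set_integrable lborel {0<..} ?g"
    by (intro set_integrable_mult_right real_Gamma_integral_lborel) (use assms in auto)
  show i: "set_integrable lborel {0<..} (bessel_K_kernel \<nu> y)"
  proof (rule set_integrable_dominated[OF g])
    show "norm (bessel_K_kernel \<nu> y x) \<le> norm (?g x)" if "x \<in> {0<..}" for x
      using norm_bessel_K_kernel_le[of x y p \<nu>] that assms by (simp add: abs_mult)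
  qed measurable
  have "norm (bessel_K_integral \<nu> y) \<le> (LINT u:{0<..}|lborel. norm (bessel_K_kernel \<nu> y u))"
    unfolding bessel_K_integral_def by (rule set_integral_norm_bound) (rule i)
  also have "\<dots> \<le> (LINT u:{0<..}|lborel. ?g u)"
    by (rule set_integral_mono[OF set_integrable_norm[OF i] g]) (use assms in \<open>auto intro!: norm_bessel_K_kernel_le\<close>)
  also have "\<dots> = p powr p * y powr (- p) * Gamma (p - Re \<nu>)"
    using real_Gamma_integral_lborel(2)[of "p - Re \<nu>"] assms by simp
  finally show "norm (bessel_K_integral \<nu> y) \<le> p powr p * y powr (- p) * Gamma (p - Re \<nu>)" .
qed

lemma bessel_K_kernel_integrable: "y > 0 \<Longrightarrow> set_integrable lborel {0<..} (bessel_K_kernel \<nu> y)"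
  by (rule bessel_K_kernel_integrable_aux[of _ "max 0 (Re \<nu>) + 1"]) auto

lemma set_integral_power_series_sums:
  fixes g :: "real \<Rightarrow> complex" and h :: "real \<Rightarrow> real"
  assumes A: "A \<in> sets borel" and g: "set_integrable lborel A g"
    and h [measurable]: "h \<in> borel_measurable borel" and h1: "\<And>u. u \<in> A \<Longrightarrow> \<bar>h u\<bar> \<le> 1"
    and c: "summable (\<lambda>k. norm (c k))"
  shows "(\<lambda>k. c k * (LINT u:A|lborel. g u * of_real (h u) ^ k)) sums
      (LINT u:A|lborel. g u * (\<Sum>k. c k * of_real (h u) ^ k))"
proof -
  let ?G = "\<lambda>u. indicat_real A u *\<^sub>R g u"
  define f where "f k u = c k * (?G u * of_real (h u) ^ k)" for k u
  have G: "integrable lborel ?G" using g by (simp add: set_integrable_def)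
  have Gm [measurable]: "?G \<in> borel_measurable borel" using borel_measurable_integrable[OF G] by simp
  have f_le: "norm (f k u) \<le> norm (c k) * norm (?G u)" for k u
    using h1[of u] by (auto simp: f_def norm_mult norm_power indicator_def intro!: mult_left_mono mult_left_le power_le_one)
  have fi: "integrable lborel (f k)" for k
  proof (rule Bochner_Integration.integrable_bound)
    show "integrable lborel (\<lambda>u. norm (c k) * norm (?G u))" by (intro integrable_mult_right integrable_norm G)
    show "f k \<in> borel_measurable lborel" unfolding f_def by measurable
    show "AE u in lborel. norm (f k u) \<le> norm (norm (c k) * norm (?G u))" using f_le by (intro AE_I2) simp
  qed
  have "(\<lambda>k. integral\<^sup>L lborel (f k)) sums (LINT u|lborel. (\<Sum>k. f k u))"
  proof (rule sums_integral[OF fi])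
    show "AE u in lborel. summable (\<lambda>k. norm (f k u))"
      by (intro AE_I2 summable_comparison_test'[OF summable_mult2[OF c]]) (use f_le in auto)
    show "summable (\<lambda>k. LINT u|lborel. norm (f k u))"
    proof (rule summable_comparison_test'[OF summable_mult2[OF c, of "LINT u|lborel. norm (?G u)"], of 0])
      fix k :: nat
      have "(LINT u|lborel. norm (f k u)) \<le> (LINT u|lborel. norm (c k) * norm (?G u))"
        by (intro integral_mono integrable_norm fi integrable_mult_right G f_le)
      thus "norm (LINT u|lborel. norm (f k u)) \<le> norm (c k) * (LINT u|lborel. norm (?G u))"
        by (simp add: integral_nonneg_AE)
    qed
  qed
  moreover have "integral\<^sup>L lborel (f k) = c k * (LINT u:A|lborel. g u * of_real (h u) ^ k)" for k
    unfolding f_def set_lebesgue_integral_def by (simp add: scaleR_conv_of_real mult.assoc)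
  moreover have "(\<Sum>k. f k u) = indicat_real A u *\<^sub>R (g u * (\<Sum>k. c k * of_real (h u) ^ k))" for u
  proof (cases "u \<in> A")
    case True
    have "summable (\<lambda>k. c k * of_real (h u) ^ k)"
    proof (rule summable_norm_cancel, rule summable_comparison_test'[OF c, of 0])
      fix k :: nat
      show "norm (norm (c k * of_real (h u) ^ k)) \<le> norm (c k)"
        using h1[OF True] by (simp add: norm_mult norm_power mult_left_le power_le_one)
    qed
    from suminf_mult[OF this, of "g u"] show ?thesis using True by (simp add: f_def mult_ac)
  qed (simp add: f_def)
  ultimately show ?thesis unfolding set_lebesgue_integral_def by simp
qed

text \<open>A product majorant makes the family absolutely summable over pairs, where the order of
  summation is irrelevant. Rows, columns and both outer sums converge absolutely, so
  \<open>suminf\<close> and \<open>infsum\<close> agree throughout.\<close>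

lemma suminf_swap_product_bound:
  fixes f :: "nat \<Rightarrow> nat \<Rightarrow> complex"
  assumes p: "summable p" and q: "summable q" and p0: "\<And>k. p k \<ge> 0" and q0: "\<And>k. q k \<ge> 0"
    and f: "\<And>k j. norm (f k j) \<le> p k * q j"
  shows "summable (\<lambda>k. \<Sum>j. f k j)" "summable (\<lambda>j. \<Sum>k. f k j)" "(\<Sum>k. \<Sum>j. f k j) = (\<Sum>j. \<Sum>k. f k j)"
proof -
  have row: "summable (\<lambda>j. norm (f k j))" for k
    by (rule summable_comparison_test'[OF summable_mult[OF q, of "p k"], of 0]) (use f in auto)
  have col: "summable (\<lambda>k. norm (f k j))" for j
    by (rule summable_comparison_test'[OF summable_mult2[OF p, of "q j"], of 0]) (use f in auto)
  have rows: "summable (\<lambda>k. norm (\<Sum>j. f k j))"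
  proof (rule summable_comparison_test'[OF summable_mult2[OF p, of "suminf q"], of 0])
    fix k
    have "norm (\<Sum>j. f k j) \<le> (\<Sum>j. norm (f k j))" by (rule summable_norm[OF row])
    also have "\<dots> \<le> (\<Sum>j. p k * q j)" by (intro suminf_le f row summable_mult q)
    finally show "norm (norm (\<Sum>j. f k j)) \<le> p k * suminf q" using q by (simp add: suminf_mult)
  qed
  have cols: "summable (\<lambda>j. norm (\<Sum>k. f k j))"
  proof (rule summable_comparison_test'[OF summable_mult[OF q, of "suminf p"], of 0])
    fix j
    have "norm (\<Sum>k. f k j) \<le> (\<Sum>k. norm (f k j))" by (rule summable_norm[OF col])
    also have "\<dots> \<le> (\<Sum>k. p k * q j)" by (intro suminf_le f col summable_mult2 p)
    finally show "norm (norm (\<Sum>k. f k j)) \<le> suminf p * q j" using p by (simp add: suminf_mult2)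
  qed
  have infsum_UNIV: "infsum g UNIV = suminf g" if "summable (\<lambda>n. norm (g n))" for g :: "nat \<Rightarrow> complex"
    using norm_summable_imp_has_sum[OF that summable_sums[OF summable_norm_cancel[OF that]]] by (rule infsumI)
  have pq: "(\<lambda>(k, j). p k * q j) summable_on UNIV \<times> UNIV"
  proof -
    have "(\<lambda>x. norm ((\<lambda>(k, j). p k * q j) x)) summable_on UNIV \<times> UNIV"
      unfolding Infinite_Sum.abs_summable_on_Sigma_iff
    proof (intro conjI ballI)
      fix k
      show "(\<lambda>j. norm ((\<lambda>(k, j). p k * q j) (k, j))) summable_on UNIV"
        by (rule norm_summable_imp_summable_on) (use q p0 q0 in \<open>auto simp: abs_mult intro!: summable_mult\<close>)
    next
      have "infsum (\<lambda>j. norm ((\<lambda>(k, j). p k * q j) (k, j))) UNIV = p k * infsum q UNIV" for k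
        using p0 q0 by (simp add: infsum_cmult_right')
      moreover have "infsum q UNIV \<ge> 0" by (rule infsum_nonneg) (use q0 in auto)
      ultimately show "(\<lambda>k. norm (infsum (\<lambda>j. norm ((\<lambda>(k, j). p k * q j) (k, j))) UNIV)) summable_on UNIV"
        by (intro norm_summable_imp_summable_on) (use p p0 in \<open>auto simp: abs_mult intro!: summable_mult2\<close>)
    qed
    thus ?thesis by (rule abs_summable_summable)
  qed
  have "(\<lambda>(k, j). f k j) summable_on UNIV \<times> UNIV"
    by (rule abs_summable_summable, rule Infinite_Sum.abs_summable_on_comparison_test'[OF pq]) (use f in auto)
  from infsum_swap_banach[OF this] show "(\<Sum>k. \<Sum>j. f k j) = (\<Sum>j. \<Sum>k. f k j)"
    by (simp add: infsum_UNIV row col rows cols)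
  show "summable (\<lambda>k. \<Sum>j. f k j)" "summable (\<lambda>j. \<Sum>k. f k j)"
    using rows cols by (auto dest: summable_norm_cancel)
qed

text \<open>Reflection turns Gamma values far to the left into reciprocal Gamma values far to the
  right, which decay factorially. The sign comes from sin (pi (z - j)).\<close>

lemma Gamma_diff_nat_nonint:
  fixes z :: complex
  assumes "z \<notin> \<int>"
  shows "Gamma (z - of_nat j) = (- 1) ^ j * of_real pi / sin (of_real pi * z) * rGamma (1 - z + of_nat j)"
proof -
  have nz: "1 - (z - of_nat j) \<notin> \<int>\<^sub>\<le>\<^sub>0"
  proof
    assume "1 - (z - of_nat j) \<in> \<int>\<^sub>\<le>\<^sub>0"
    hence "1 + of_nat j - (1 - (z - of_nat j)) \<in> \<int>"
      by (intro Ints_diff) (auto dest: nonpos_Ints_Int)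
    with assms show False by simp
  qed
  have "sin (of_real pi * (z - of_nat j)) = (- 1) ^ j * sin (of_real pi * z)"
  proof -
    have "complex_of_real pi * of_nat j = of_real (pi * real j)" by simp
    hence "sin (complex_of_real pi * of_nat j) = of_real (sin (pi * real j))"
      "cos (complex_of_real pi * of_nat j) = of_real (cos (pi * real j))"
      by (simp_all only: sin_of_real cos_of_real)
    thus ?thesis by (simp add: right_diff_distrib sin_diff)
  qed
  moreover have "Gamma (z - of_nat j) * Gamma (1 - (z - of_nat j)) = of_real pi / sin (of_real pi * (z - of_nat j))"
    by (rule Gamma_reflection_complex)
  ultimately have 1: "Gamma (z - of_nat j) * Gamma (1 - (z - of_nat j)) = (- 1) ^ j * of_real pi / sin (of_real pi * z)"
    by (simp add: field_simps minus_one_power_iff split: if_splits)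
  have "Gamma (1 - (z - of_nat j)) \<noteq> 0" using nz by (simp add: Gamma_eq_zero_iff)
  hence "Gamma (z - of_nat j) = ((- 1) ^ j * of_real pi / sin (of_real pi * z)) / Gamma (1 - (z - of_nat j))"
    by (subst 1[symmetric]) simp
  moreover have "1 - (z - of_nat j) = 1 - z + of_nat j" by simp
  ultimately show ?thesis by (simp only: rGamma_inverse_Gamma divide_inverse)
qed

lemma summable_exp_real: "summable (\<lambda>k. (x :: real) ^ k / fact k)"
  using summable_exp_generic[of x] by (simp add: divide_inverse mult.commute)

lemma Gamma_series_sums:
  assumes z: "z \<notin> \<int>" and y: "y > 0"
  shows "(\<lambda>k. (- of_real y) ^ k / fact k * Gamma (z - of_nat k)) sums
     (of_real pi / sin (of_real pi * z) * rGamma_series2 (- z) 0 (of_real y))"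
proof -
  have "(\<lambda>k. rGamma (- z + of_nat k + 1) * rGamma (0 + of_nat k + 1) * of_real y ^ k) sums rGamma_series2 (- z) 0 (of_real y)"
    unfolding rGamma_series2_def by (rule summable_sums[OF summable_norm_cancel[OF summable_norm_rGamma_series2]])
  from sums_mult[OF this, of "of_real pi / sin (of_real pi * z)"]
  show ?thesis
  proof (rule back_subst[of "\<lambda>f. f sums _"])
    show "(\<lambda>k. of_real pi / sin (of_real pi * z) * (rGamma (- z + of_nat k + 1) * rGamma (0 + of_nat k + 1) * of_real y ^ k)) =
      (\<lambda>k. (- of_real y) ^ k / fact k * Gamma (z - of_nat k))"
    proof
      fix k :: nat
      have r: "rGamma (0 + of_nat k + 1 :: complex) = 1 / fact k"
        using Gamma_fact[of k, where ?'a = complex] by (simp add: rGamma_inverse_Gamma add.commute divide_inverse)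
      have e: "1 - z + of_nat k = - z + of_nat k + 1" by simp
      have p: "complex_of_real y ^ k = (- of_real y) ^ k * (- 1) ^ k"
        by (simp flip: power_mult_distrib)
      show "of_real pi / sin (of_real pi * z) * (rGamma (- z + of_nat k + 1) * rGamma (0 + of_nat k + 1) * of_real y ^ k) =
        (- of_real y) ^ k / fact k * Gamma (z - of_nat k)"
        unfolding Gamma_diff_nat_nonint[OF z] r e p by (simp only: times_divide_eq_left times_divide_eq_right mult_ac divide_divide_eq_left mult_1)
    qed
  qed
qed

lemma gamma_prim_at_1: "gamma_prim a z 1 = (\<Sum>k. gamma_prim_coeff a z k)"
  by (simp add: gamma_prim_def power_series_powr_def)

lemma minus_of_nat_nonint: "z \<notin> \<int> \<Longrightarrow> z - of_nat k \<notin> (\<int> :: complex set)" "z \<notin> \<int> \<Longrightarrow> - z \<notin> (\<int> :: complex set)"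
  using nonint_add_int[of z "- int k"] by auto

text \<open>Expanded by the series of \<open>gamma_prim\<close>, both sides have the terms (-y)^k
  (-1)^j / (k! j!) over the opposite denominators -\<nu> - k + j and \<nu> - j + k, summed in the
  two possible orders. These denominators stay away from 0 because \<nu> is not an integer, which
  justifies the interchange.\<close>

lemma gamma_prim_double_series_cancel:
  assumes \<nu>: "\<nu> \<notin> \<int>" and y: "y > 0"
  shows "summable (\<lambda>k. (- of_real y) ^ k / fact k * gamma_prim 1 (- \<nu> - of_nat k) 1)" (is ?S1)
    and "summable (\<lambda>j. (- of_real 1) ^ j / fact j * gamma_prim y (\<nu> - of_nat j) 1)" (is ?S2)
    and "(\<Sum>k. (- of_real y) ^ k / fact k * gamma_prim 1 (- \<nu> - of_nat k) 1) = - (\<Sum>j. (- of_real 1) ^ j / fact j * gamma_prim y (\<nu> - of_nat j) 1)" (is ?E)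
proof -
  obtain d where d: "d > 0" "\<And>n. norm (\<nu> - of_int n) \<ge> d" using norm_diff_of_int_ge_pos \<nu> by blast
  define f where "f k j = (- of_real y) ^ k / fact k * gamma_prim_coeff 1 (- \<nu> - of_nat k) j" for k j
  have f_alt: "f k j = - ((- of_real 1) ^ j / fact j * gamma_prim_coeff y (\<nu> - of_nat j) k)" for k j
  proof -
    have e: "\<nu> - of_nat j + of_nat k = - (- \<nu> - of_nat k + of_nat j)" by simp
    show ?thesis unfolding f_def gamma_prim_coeff_def e by (simp only: mult_minus_right divide_minus_right) (simp add: field_simps)
  qed
  have le: "norm (f k j) \<le> y ^ k / fact k * (1 / d * (1 / fact j))" for k j
  proof -
    have "norm (- \<nu> - of_nat k + of_nat j) = norm (\<nu> - of_int (int j - int k))"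
      by (subst norm_minus_cancel[symmetric]) (simp add: algebra_simps)
    hence "norm (- \<nu> - of_nat k + of_nat j) \<ge> d" using d(2)[of "int j - int k"] by simp
    hence "y ^ k / (fact k * (fact j * norm (- \<nu> - of_nat k + of_nat j))) \<le> y ^ k / (fact k * (fact j * d))"
      using d(1) y by (intro divide_left_mono mult_left_mono mult_pos_pos) auto
    thus ?thesis unfolding f_def gamma_prim_coeff_def using y by (simp add: norm_mult norm_divide norm_power mult_ac)
  qed
  note sw = suminf_swap_product_bound[of "\<lambda>k. y ^ k / fact k" "\<lambda>j. 1 / d * (1 / fact j)" f]
  have p: "summable (\<lambda>k. y ^ k / fact k)" by (rule summable_exp_real)
  have q: "summable (\<lambda>j. 1 / d * (1 / fact j))" using summable_mult[OF summable_exp_real[of 1], of "1 / d"] by simp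
  have s1: "(\<Sum>j. f k j) = (- of_real y) ^ k / fact k * gamma_prim 1 (- \<nu> - of_nat k) 1" for k
    unfolding f_def gamma_prim_at_1
    by (rule suminf_mult) (use summable_gamma_prim_coeff(2)[of "- \<nu> - of_nat k" 1 1] minus_of_nat_nonint \<nu> in auto)
  have s2: "(\<Sum>k. f k j) = - ((- of_real 1) ^ j / fact j * gamma_prim y (\<nu> - of_nat j) 1)" for j
  proof -
    have sm: "summable (gamma_prim_coeff y (\<nu> - of_nat j))"
      using summable_gamma_prim_coeff(2)[of "\<nu> - of_nat j" y 1] minus_of_nat_nonint \<nu> by auto
    show ?thesis unfolding f_alt gamma_prim_at_1 unfolding suminf_minus[OF summable_mult[OF sm]] suminf_mult[OF sm] ..
  qed
  have "summable (\<lambda>k. \<Sum>j. f k j)" "summable (\<lambda>j. \<Sum>k. f k j)" "(\<Sum>k. \<Sum>j. f k j) = (\<Sum>j. \<Sum>k. f k j)"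
    by (rule sw[OF p q]; use le y d in simp)+
  thus ?S1 ?S2 ?E unfolding s1 s2 summable_minus_iff
    by (simp_all add: suminf_minus)
qed

text \<open>
  The integral is split at \<open>1\<close> and on each half the factor of the kernel that is bounded there is
  expanded. The incomplete parts of the resulting Gamma integrals form two double series that cancel.
\<close>

lemma bessel_K_integral_nonint:
  assumes \<nu>: "\<nu> \<notin> \<int>" and y: "y > 0"
  shows "bessel_K_integral \<nu> y = of_real pi / sin (of_real pi * \<nu>) *
    (of_real y powr (- \<nu>) * rGamma_series2 (- \<nu>) 0 (of_real y) - rGamma_series2 \<nu> 0 (of_real y))"
proof -
  note split = set_integral_split_at_1[OF bessel_K_kernel_integrable[OF y, of \<nu>]]
  have sm: "summable (\<lambda>k. norm ((- of_real y) ^ k / fact k :: complex))" for y :: real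
    using summable_exp_real[of "\<bar>y\<bar>"] by (simp add: norm_divide norm_power)
  have nk: "- \<nu> - of_nat k \<notin> \<int>" "\<nu> - of_nat k \<notin> \<int>" for k using \<nu> minus_of_nat_nonint by auto

  have "(\<lambda>k. (- of_real y) ^ k / fact k * (LINT u:{1<..}|lborel. of_real u powr (- \<nu> - 1) * of_real (exp (- 1 * u)) * of_real (inverse u) ^ k)) sums
      (LINT u:{1<..}|lborel. of_real u powr (- \<nu> - 1) * of_real (exp (- 1 * u)) * (\<Sum>k. (- of_real y) ^ k / fact k * of_real (inverse u) ^ k))"
    by (rule set_integral_power_series_sums) (use gamma_prim_integrable_Ioi[of 1 "- \<nu>"] sm in \<open>auto simp: inverse_le_1_iff\<close>)
  moreover have "(LINT u:{1<..}|lborel. of_real u powr (- \<nu> - 1) * of_real (exp (- 1 * u)) * of_real (inverse u) ^ k) =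
       Gamma (- \<nu> - of_nat k) - gamma_prim 1 (- \<nu> - of_nat k) 1" for k
  proof -
    have "of_real u powr (- \<nu> - 1) * of_real (exp (- 1 * u)) * of_real (inverse u) ^ k =
        complex_of_real u powr ((- \<nu> - of_nat k) - 1) * of_real (exp (- 1 * u))" if "u \<in> {1<..}" for u
      using that by (simp add: powr_diff powr_add power_inverse powr_nat' field_simps)
    hence "(LINT u:{1<..}|lborel. of_real u powr (- \<nu> - 1) * of_real (exp (- 1 * u)) * of_real (inverse u) ^ k) =
       (LINT u:{1<..}|lborel. complex_of_real u powr ((- \<nu> - of_nat k) - 1) * of_real (exp (- 1 * u)))"
      by (intro set_lebesgue_integral_cong) auto
    thus ?thesis using gamma_prim_integral_Ioi[OF nk(1), of 1 k] by simp
  qed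
  moreover have "(LINT u:{1<..}|lborel. of_real u powr (- \<nu> - 1) * of_real (exp (- 1 * u)) * (\<Sum>k. (- of_real y) ^ k / fact k * of_real (inverse u) ^ k))
      = (LINT u:{1<..}|lborel. bessel_K_kernel \<nu> y u)"
  proof (rule set_lebesgue_integral_cong)
    show "\<forall>u. u \<in> {1<..} \<longrightarrow> of_real u powr (- \<nu> - 1) * of_real (exp (- 1 * u)) * (\<Sum>k. (- of_real y) ^ k / fact k * of_real (inverse u) ^ k) =
        bessel_K_kernel \<nu> y u"
    proof (intro allI impI)
      fix u :: real
      have "- u - y / u = - 1 * u + - y * inverse u" by (simp add: divide_inverse)
      hence "exp (- u - y / u) = exp (- 1 * u) * exp (- y * inverse u)" by (simp only: exp_add)
      thus "of_real u powr (- \<nu> - 1) * of_real (exp (- 1 * u)) * (\<Sum>k. (- of_real y) ^ k / fact k * of_real (inverse u) ^ k) =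
        bessel_K_kernel \<nu> y u"
        unfolding bessel_K_kernel_def sums_unique[OF exp_series_sums, symmetric] by simp
    qed
  qed simp
  ultimately have I1: "(\<lambda>k. (- of_real y) ^ k / fact k * (Gamma (- \<nu> - of_nat k) - gamma_prim 1 (- \<nu> - of_nat k) 1)) sums
      (LINT u:{1<..}|lborel. bessel_K_kernel \<nu> y u)" by simp

  have "(\<lambda>k. (- of_real 1) ^ k / fact k * (LINT u:{0<..<1}|lborel. of_real u powr (- \<nu> - 1) * of_real (exp (- y / u)) * of_real u ^ k)) sums
      (LINT u:{0<..<1}|lborel. of_real u powr (- \<nu> - 1) * of_real (exp (- y / u)) * (\<Sum>k. (- of_real 1) ^ k / fact k * of_real u ^ k))"
    by (rule set_integral_power_series_sums) (use gamma_prim_integrable_unit[OF y] sm[of 1] in auto)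
  moreover have "(LINT u:{0<..<1}|lborel. of_real u powr (- \<nu> - 1) * of_real (exp (- y / u)) * of_real u ^ k) =
       of_real y powr (- (\<nu> - of_nat k)) * Gamma (\<nu> - of_nat k) - gamma_prim y (\<nu> - of_nat k) 1" for k
  proof -
    have "of_real u powr (- \<nu> - 1) * of_real (exp (- y / u)) * of_real u ^ k =
        complex_of_real u powr (- (\<nu> - of_nat k) - 1) * of_real (exp (- y / u))" if "u \<in> {0<..<1}" for u
    proof -
      have e: "- (\<nu> - of_nat k) - 1 = of_nat k + (- \<nu> - 1)" by simp
      show ?thesis using that unfolding e powr_add by (simp add: powr_nat')
    qed
    hence "(LINT u:{0<..<1}|lborel. of_real u powr (- \<nu> - 1) * of_real (exp (- y / u)) * of_real u ^ k) =
       (LINT u:{0<..<1}|lborel. complex_of_real u powr (- (\<nu> - of_nat k) - 1) * of_real (exp (- y / u)))"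
      by (intro set_lebesgue_integral_cong) auto
    thus ?thesis using gamma_prim_integral_unit[OF nk(2) y, of k] by simp
  qed
  moreover have "(LINT u:{0<..<1}|lborel. of_real u powr (- \<nu> - 1) * of_real (exp (- y / u)) * (\<Sum>k. (- of_real 1) ^ k / fact k * of_real u ^ k))
      = (LINT u:{0<..<1}|lborel. bessel_K_kernel \<nu> y u)"
  proof (rule set_lebesgue_integral_cong)
    show "\<forall>u. u \<in> {0<..<1} \<longrightarrow> of_real u powr (- \<nu> - 1) * of_real (exp (- y / u)) * (\<Sum>k. (- of_real 1) ^ k / fact k * of_real u ^ k) =
        bessel_K_kernel \<nu> y u"
    proof (intro allI impI)
      fix u :: real
      have "- u - y / u = - 1 * u + - y / u" by simp
      hence "exp (- u - y / u) = exp (- 1 * u) * exp (- y / u)" by (simp only: exp_add)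
      thus "of_real u powr (- \<nu> - 1) * of_real (exp (- y / u)) * (\<Sum>k. (- of_real 1) ^ k / fact k * of_real u ^ k) =
        bessel_K_kernel \<nu> y u"
        unfolding bessel_K_kernel_def sums_unique[OF exp_series_sums, symmetric] by simp
    qed
  qed simp
  ultimately have I0: "(\<lambda>k. (- of_real 1) ^ k / fact k * (of_real y powr (- (\<nu> - of_nat k)) * Gamma (\<nu> - of_nat k) - gamma_prim y (\<nu> - of_nat k) 1)) sums
      (LINT u:{0<..<1}|lborel. bessel_K_kernel \<nu> y u)" by simp

  \<comment> \<open>The complete Gamma values give the two Bessel series: the half (1,oo)
    contributes order \<nu>, with the minus sign of sin (-pi \<nu>), and the half (0,1) contributes
    order -\<nu>.\<close>
  have G1: "(\<lambda>k. (- of_real y) ^ k / fact k * Gamma (- \<nu> - of_nat k)) sums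
     (of_real pi / sin (of_real pi * (- \<nu>)) * rGamma_series2 (- (- \<nu>)) 0 (of_real y))"
    by (rule Gamma_series_sums) (use minus_of_nat_nonint(2) \<nu> y in auto)
  have "(\<lambda>k. (- of_real 1) ^ k / fact k * (of_real y powr (- (\<nu> - of_nat k)) * Gamma (\<nu> - of_nat k))) =
      (\<lambda>k. of_real y powr (- \<nu>) * ((- of_real y) ^ k / fact k * Gamma (\<nu> - of_nat k)))"
  proof
    fix k :: nat
    have e: "- (\<nu> - of_nat k) = of_nat k + (- \<nu>)" by simp
    have "(- complex_of_real y) ^ k = (- of_real 1) ^ k * of_real y ^ k" by (simp flip: power_mult_distrib)
    thus "(- of_real 1) ^ k / fact k * (of_real y powr (- (\<nu> - of_nat k)) * Gamma (\<nu> - of_nat k)) =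
       of_real y powr (- \<nu>) * ((- of_real y) ^ k / fact k * Gamma (\<nu> - of_nat k))"
      using y unfolding e powr_add by (simp add: powr_nat')
  qed
  hence G0: "(\<lambda>k. (- of_real 1) ^ k / fact k * (of_real y powr (- (\<nu> - of_nat k)) * Gamma (\<nu> - of_nat k))) sums
     (of_real y powr (- \<nu>) * (of_real pi / sin (of_real pi * \<nu>) * rGamma_series2 (- \<nu>) 0 (of_real y)))"
    using sums_mult[OF Gamma_series_sums[OF \<nu> y], of "of_real y powr (- \<nu>)"] by simp
  note c = gamma_prim_double_series_cancel[OF \<nu> y]
  have i1: "(LINT u:{1<..}|lborel. bessel_K_kernel \<nu> y u) =
     of_real pi / sin (of_real pi * (- \<nu>)) * rGamma_series2 (- (- \<nu>)) 0 (of_real y) -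
     (\<Sum>k. (- of_real y) ^ k / fact k * gamma_prim 1 (- \<nu> - of_nat k) 1)"
    using sums_unique2[OF I1] sums_diff[OF G1 summable_sums[OF c(1)]] by (simp add: right_diff_distrib)
  have i0: "(LINT u:{0<..<1}|lborel. bessel_K_kernel \<nu> y u) =
     of_real y powr (- \<nu>) * (of_real pi / sin (of_real pi * \<nu>) * rGamma_series2 (- \<nu>) 0 (of_real y)) -
     (\<Sum>k. (- of_real 1) ^ k / fact k * gamma_prim y (\<nu> - of_nat k) 1)"
    using sums_unique2[OF I0] sums_diff[OF G0 summable_sums[OF c(2)]] by (simp add: right_diff_distrib)
  have cancel: "(a - s2) + (b - s1) = a + b" if "s1 = - s2" for a b s1 s2 :: complex using that by simp
  show ?thesis
    unfolding bessel_K_integral_def split(3) i0 i1 cancel[OF c(3)] by (simp add: algebra_simps)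
qed

lemma bessel_I_of_real:
  assumes "x > 0"
  shows "bessel_I \<nu> (of_real x) = of_real (x / 2) powr \<nu> * rGamma_series2 \<nu> 0 (of_real (x\<^sup>2 / 4))"
proof -
  have "rGamma (\<nu> + of_nat k + 1) / fact k * (complex_of_real x / 2) ^ (2 * k) =
     rGamma (\<nu> + of_nat k + 1) * rGamma (0 + of_nat k + 1) * of_real (x\<^sup>2 / 4) ^ k" for k
  proof -
    have "rGamma (0 + of_nat k + 1 :: complex) = 1 / fact k"
      using Gamma_fact[of k, where ?'a = complex] by (simp add: rGamma_inverse_Gamma add.commute divide_inverse)
    moreover have "(complex_of_real x / 2) ^ (2 * k) = of_real (x\<^sup>2 / 4) ^ k"
      by (simp add: power_mult power_divide)
    ultimately show ?thesis by simp
  qed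
  thus ?thesis by (simp add: bessel_I_def rGamma_series2_def)
qed

lemma bessel_K_nonint:
  assumes "\<nu> \<notin> \<int>" and x: "x > 0"
  shows "bessel_K \<nu> (of_real x) = of_real (x / 2) powr \<nu> / 2 * bessel_K_integral \<nu> (x\<^sup>2 / 4)"
proof -
  have y: "x\<^sup>2 / 4 > 0" using x by simp
  have "of_real (x\<^sup>2 / 4) powr (- \<nu>) = complex_of_real (x / 2) powr (- \<nu>) * of_real (x / 2) powr (- \<nu>)"
    using x by (subst powr_times_real[symmetric]) (auto simp: power2_eq_square)
  hence e: "of_real (x / 2) powr \<nu> * of_real (x\<^sup>2 / 4) powr (- \<nu>) = complex_of_real (x / 2) powr (- \<nu>)"
    using x by (simp add: powr_minus)
  have "of_real (x / 2) powr \<nu> / 2 * bessel_K_integral \<nu> (x\<^sup>2 / 4) =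
     of_real pi / sin (of_real pi * \<nu>) / 2 *
      ((of_real (x / 2) powr \<nu> * of_real (x\<^sup>2 / 4) powr (- \<nu>)) * rGamma_series2 (- \<nu>) 0 (of_real (x\<^sup>2 / 4)) -
       of_real (x / 2) powr \<nu> * rGamma_series2 \<nu> 0 (of_real (x\<^sup>2 / 4)))"
    unfolding bessel_K_integral_nonint[OF assms(1) y] by (simp add: algebra_simps)
  also have "\<dots> = of_real pi / sin (of_real pi * \<nu>) / 2 * (bessel_I (- \<nu>) (of_real x) - bessel_I \<nu> (of_real x))"
    unfolding e by (simp only: bessel_I_of_real[OF x])
  finally show ?thesis using assms(1) by (simp add: bessel_K_def mult.commute)
qed

section \<open>Continuity and decay in the order, Mellin transform\<close>

lemma eventually_nonint: "\<forall>\<^sub>F w in at (z :: complex). w \<notin> \<int>"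
proof (cases "z \<in> \<int>")
  case False
  have "open (- \<int> :: complex set)" by (intro open_Compl) (rule closed_Ints)
  from eventually_at_in_open'[OF this, of z] False show ?thesis by simp
next
  case True
  have "w \<notin> \<int>" if "w \<noteq> z" "dist w z < 1" for w
  proof
    assume "w \<in> \<int>"
    hence "w - z \<in> \<int>" using True by (rule Ints_diff)
    then obtain k where k: "w - z = of_int k" by (auto elim: Ints_cases)
    hence "\<bar>of_int k\<bar> < (1 :: real)" using that(2) by (metis dist_norm norm_of_int)
    hence "k = 0" by linarith
    with k that(1) show False by simp
  qed
  thus ?thesis by (auto simp: eventually_at intro!: exI[of _ 1])
qed

lemma tendsto_of_real_powr:
  "x > 0 \<Longrightarrow> (f \<longlongrightarrow> z) F \<Longrightarrow> ((\<lambda>n. complex_of_real x powr f n) \<longlongrightarrow> of_real x powr z) F"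
  unfolding powr_def by (auto intro!: tendsto_intros)

text \<open>A convergent sequence of orders has real parts in some [-R, R]. There the power of u is
  at most the sum of its values at the two ends, so the kernels of orders R and -R together
  dominate.\<close>

lemma bessel_K_integral_LIMSEQ:
  assumes y: "y > 0" and X: "X \<longlonglongrightarrow> \<nu>"
  shows "(\<lambda>n. bessel_K_integral (X n) y) \<longlonglongrightarrow> bessel_K_integral \<nu> y"
proof -
  have "Bseq X" using X by (rule convergent_imp_Bseq[OF convergentI])
  then obtain R where R: "\<And>n. norm (X n) \<le> R" by (auto elim!: BseqE)
  define w where "w u = norm (bessel_K_kernel (of_real R) y u) + norm (bessel_K_kernel (- of_real R) y u)" for u
  show ?thesis unfolding bessel_K_integral_def
  proof (rule set_integral_dominated_LIMSEQ[where w = w])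
    show "set_integrable lborel {0<..} w"
      unfolding w_def by (intro set_integral_add(1) set_integrable_norm bessel_K_kernel_integrable y)
    show "(\<lambda>n. bessel_K_kernel (X n) y u) \<longlonglongrightarrow> bessel_K_kernel \<nu> y u" if "u \<in> {0<..}" for u
      using that unfolding bessel_K_kernel_def by (intro tendsto_intros tendsto_of_real_powr X) auto
    fix n :: nat and u :: real
    assume u: "u \<in> {0<..}"
    have R': "\<bar>Re (X n)\<bar> \<le> R" using R[of n] abs_Re_le_cmod[of "X n"] by linarith
    have "u powr (- Re (X n) - 1) \<le> u powr (- R - 1) + u powr (R - 1)"
    proof (cases "u \<ge> 1")
      case True
      hence "u powr (- Re (X n) - 1) \<le> u powr (R - 1)" using R' by (intro powr_mono) auto
      thus ?thesis by (simp add: add_increasing)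
    next
      case False
      hence "u powr (- Re (X n) - 1) \<le> u powr (- R - 1)" using R' u by (intro powr_mono') auto
      thus ?thesis by (simp add: add_increasing2)
    qed
    hence "u powr (- Re (X n) - 1) * exp (- u - y / u) \<le> (u powr (- R - 1) + u powr (R - 1)) * exp (- u - y / u)"
      by (intro mult_right_mono) auto
    thus "norm (bessel_K_kernel (X n) y u) \<le> w u"
      using u by (simp add: w_def bessel_K_kernel_def norm_mult norm_of_real_powr distrib_right)
  qed (use bessel_K_kernel_measurable in auto)
qed

text \<open>The same function as \<open>bessel_K\<close> on positive reals, but without a case
  distinction: integral orders need no limit, and continuity and bounds in \<nu> come from the
  integral.\<close>

definition K_bessel :: "complex \<Rightarrow> real \<Rightarrow> complex" where
  "K_bessel \<nu> x = of_real (x / 2) powr \<nu> / 2 * bessel_K_integral \<nu> (x\<^sup>2 / 4)"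

lemma K_bessel_LIMSEQ:
  assumes x: "x > 0" and X: "X \<longlonglongrightarrow> \<nu>"
  shows "(\<lambda>n. K_bessel (X n) x) \<longlonglongrightarrow> K_bessel \<nu> x"
  unfolding K_bessel_def using x
  by (intro tendsto_intros tendsto_of_real_powr bessel_K_integral_LIMSEQ X) auto

lemma tendsto_K_bessel: "x > 0 \<Longrightarrow> ((\<lambda>\<nu>. K_bessel \<nu> x) \<longlongrightarrow> K_bessel \<nu>0 x) (at \<nu>0)"
  unfolding tendsto_at_iff_sequentially comp_def using K_bessel_LIMSEQ by blast

text \<open>Continuity of \<open>K_bessel\<close> in the order identifies the limit by which
  \<open>bessel_K\<close> is defined at integers.\<close>

lemma bessel_K_of_real:
  assumes x: "x > 0"
  shows "bessel_K \<nu> (of_real x) = K_bessel \<nu> x"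
proof (cases "\<nu> \<in> \<int>")
  case False
  thus ?thesis using x by (simp add: bessel_K_nonint K_bessel_def)
next
  case True
  have "\<forall>\<^sub>F w in at \<nu>. K_bessel w x = of_real pi / 2 * (bessel_I (- w) (of_real x) - bessel_I w (of_real x)) / sin (w * of_real pi)"
    using eventually_nonint[of \<nu>]
  proof eventually_elim
    case (elim w)
    show ?case using bessel_K_nonint[OF elim x] elim by (simp add: K_bessel_def bessel_K_def)
  qed
  from Lim_transform_eventually[OF tendsto_K_bessel[OF x, of \<nu>] this]
  have "Lim (at \<nu>) (\<lambda>w. of_real pi / 2 * (bessel_I (- w) (of_real x) - bessel_I w (of_real x)) / sin (w * of_real pi)) = K_bessel \<nu> x"
    by (intro tendsto_Lim) auto
  thus ?thesis using True by (simp add: bessel_K_def)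
qed

lemma K_bessel_nonint:
  assumes "\<nu> \<notin> \<int>" "x > 0"
  shows "K_bessel \<nu> x = of_real pi / (2 * sin (of_real pi * \<nu>)) * (bessel_I (- \<nu>) (of_real x) - bessel_I \<nu> (of_real x))"
  using bessel_K_of_real[of x \<nu>] assms by (simp add: bessel_K_def mult.commute)

lemma K_bessel_uminus_nonint:
  assumes \<nu>: "\<nu> \<notin> \<int>" and x: "x > 0"
  shows "K_bessel (- \<nu>) x = K_bessel \<nu> x"
proof -
  have "of_real pi / (2 * sin (of_real pi * - \<nu>)) = - (of_real pi / (2 * sin (of_real pi * \<nu>)))" by simp
  thus ?thesis
    unfolding K_bessel_nonint[OF minus_of_nat_nonint(2)[OF \<nu>] x] K_bessel_nonint[OF \<nu> x] minus_minus
    by (simp only: minus_mult_commute minus_diff_eq)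
qed

text \<open>For non-integral order the change of sign reverses both the difference of the two
  functions I and the sine; integral orders follow by continuity.\<close>

lemma K_bessel_uminus:
  assumes "x > 0"
  shows "K_bessel (- \<nu>) x = K_bessel \<nu> x"
proof (rule tendsto_unique)
  have "filterlim (\<lambda>w. - w) (at (- \<nu>)) (at \<nu>)"
    by (auto simp: filterlim_at eventually_at_filter intro!: tendsto_intros)
  from filterlim_compose[OF tendsto_K_bessel[OF assms] this]
  show "((\<lambda>w. K_bessel (- w) x) \<longlongrightarrow> K_bessel (- \<nu>) x) (at \<nu>)" .
  have "\<forall>\<^sub>F w in at \<nu>. K_bessel w x = K_bessel (- w) x"
    using eventually_nonint by eventually_elim (use assms K_bessel_uminus_nonint in auto)
  from Lim_transform_eventually[OF tendsto_K_bessel[OF assms] this]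
  show "((\<lambda>w. K_bessel (- w) x) \<longlongrightarrow> K_bessel \<nu> x) (at \<nu>)" .
qed simp

text \<open>The choice p = (q + Re \<nu>) / 2 makes the total power of x equal to -q and leaves p -
  Re \<nu> = (q - Re \<nu>) / 2 > 0. The remaining constant is a continuous function of Re \<nu> on
  a compact interval. With q slightly above r the bound controls K at 0, with large q its decay at
  infinity.\<close>

lemma K_bessel_uniform_bound:
  assumes r: "0 \<le> r" "r < q"
  shows "\<exists>C\<ge>0. \<forall>\<nu> x. \<bar>Re \<nu>\<bar> \<le> r \<longrightarrow> x > 0 \<longrightarrow> norm (K_bessel \<nu> x) \<le> C * x powr (- q)"
proof -
  define h where "h \<sigma> = ((q + \<sigma>) / 2) powr ((q + \<sigma>) / 2) * Gamma ((q - \<sigma>) / 2)" for \<sigma> :: real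
  have "continuous_on {-r..r} h" unfolding h_def
    by (intro continuous_intros continuous_on_compose2[OF continuous_on_Gamma[of "{0<..}"]])
      (use r in \<open>auto dest: nonpos_Ints_nonpos\<close>)
  hence "compact (h ` {-r..r})" by (intro compact_continuous_image) auto
  then obtain B where B: "\<And>\<sigma>. \<sigma> \<in> {-r..r} \<Longrightarrow> \<bar>h \<sigma>\<bar> \<le> B"
    by (force dest!: compact_imp_bounded simp: bounded_iff)
  have B0: "B \<ge> 0" using B[of 0] r by auto
  have "norm (K_bessel \<nu> x) \<le> (B / 2 * 2 powr q) * x powr (- q)" if \<nu>: "\<bar>Re \<nu>\<bar> \<le> r" and x: "x > 0" for \<nu> x
  proof -
    define p where "p = (q + Re \<nu>) / 2"
    have p: "p > 0" "p > Re \<nu>" using \<nu> r by (auto simp: p_def)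
    have "norm (K_bessel \<nu> x) = (x / 2) powr Re \<nu> / 2 * norm (bessel_K_integral \<nu> (x\<^sup>2 / 4))"
      using x norm_of_real_powr[of "x / 2" \<nu>] by (simp add: K_bessel_def norm_mult norm_divide)
    also have "\<dots> \<le> (x / 2) powr Re \<nu> / 2 * (p powr p * (x\<^sup>2 / 4) powr (- p) * Gamma (p - Re \<nu>))"
      by (intro mult_left_mono norm_bessel_K_integral_le p) (use x in auto)
    also have "p - Re \<nu> = (q - Re \<nu>) / 2" by (simp add: p_def field_simps)
    also have "(x / 2) powr Re \<nu> / 2 * (p powr p * (x\<^sup>2 / 4) powr (- p) * Gamma ((q - Re \<nu>) / 2)) =
        h (Re \<nu>) / 2 * ((x / 2) powr Re \<nu> * (x\<^sup>2 / 4) powr (- p))"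
      by (simp add: h_def p_def)
    also have "(x\<^sup>2 / 4) powr (- p) = (x / 2) powr (- 2 * p)"
    proof -
      have "x\<^sup>2 / 4 = (x / 2) powr 2" using x by (simp add: power2_eq_square)
      thus ?thesis by (simp only: powr_powr) simp
    qed
    also have "(x / 2) powr Re \<nu> * (x / 2) powr (- 2 * p) = (x / 2) powr (- q)"
    proof -
      have "Re \<nu> + - 2 * p = - q" by (simp add: p_def field_simps)
      thus ?thesis by (simp only: powr_add[symmetric])
    qed
    also have "h (Re \<nu>) / 2 * (x / 2) powr (- q) \<le> B / 2 * (x / 2) powr (- q)"
      by (rule mult_right_mono) (use B[of "Re \<nu>"] \<nu> in \<open>auto simp: abs_le_iff\<close>)
    also have "(x / 2) powr (- q) = 2 powr q * x powr (- q)"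
      using x by (simp add: powr_divide powr_minus field_simps)
    finally show ?thesis by (simp add: mult.assoc)
  qed
  thus ?thesis using B0 by (intro exI[of _ "B / 2 * 2 powr q"]) auto
qed

lemma bessel_K_integral_measurable [measurable]: "bessel_K_integral \<nu> \<in> borel_measurable borel"
  unfolding bessel_K_integral_def set_lebesgue_integral_def bessel_K_kernel_def by measurable

lemma K_bessel_measurable [measurable]: "K_bessel \<nu> \<in> borel_measurable borel"
  unfolding K_bessel_def by measurable

section \<open>The Mellin transform of K by way of Gaussian integrals\<close>

lemma Gauss_type_integral:
  assumes w: "Re w > 0" and c: "c > 0"
  shows "set_integrable lborel {0<..} (\<lambda>x. of_real x powr (w - 1) * complex_of_real (exp (- c * x\<^sup>2)))"
    and "(LINT x:{0<..}|lborel. of_real x powr (w - 1) * complex_of_real (exp (- c * x\<^sup>2))) = of_real c powr (- w / 2) * Gamma (w / 2) / 2"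
proof -
  let ?h = "\<lambda>x. of_real x powr (w - 1) * complex_of_real (exp (- c * x\<^sup>2))"
  have g: "set_integrable lborel {0<..} (\<lambda>x. of_real (exp c) * (of_real x powr (w - 1) * complex_of_real (exp (- c * x))))"
    by (intro set_integrable_mult_right Gamma_integral_lborel w c)
  show i: "set_integrable lborel {0<..} ?h"
  proof (rule set_integrable_dominated[OF g])
    fix x :: real
    \<comment> \<open>Completing the square yields exp (-c x^2) <= exp c exp (-c x), so a Gamma
      integrand dominates.\<close>
    have "x\<^sup>2 - x + 1 = (x - 1/2)\<^sup>2 + 3/4" by (simp add: power2_eq_square algebra_simps)
    hence "x\<^sup>2 - x + 1 \<ge> 0" by simp
    hence "c * (x\<^sup>2 - x + 1) \<ge> 0" using c by simp
    hence "- c * x\<^sup>2 \<le> c + - c * x" by (simp add: algebra_simps)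
    hence "exp (- c * x\<^sup>2) \<le> exp c * exp (- c * x)" by (simp only: exp_add[symmetric] exp_le_cancel_iff)
    thus "norm (?h x) \<le> norm (of_real (exp c) * (of_real x powr (w - 1) * complex_of_real (exp (- c * x))))"
      using mult_left_mono[of "exp (- c * x\<^sup>2)" "exp c * exp (- c * x)" "norm (of_real x powr (w - 1))"]
      by (simp add: norm_mult mult_ac)
  qed measurable
  \<comment> \<open>Under s = x^2 the integral of \<open>?h\<close> becomes half the integral of
    this Gamma integrand.\<close>
  let ?f = "\<lambda>s. of_real s powr (w / 2 - 1) * complex_of_real (exp (- c * s))"
  have e: "(2 * x) *\<^sub>R ?f (x\<^sup>2) = 2 * ?h x" if "x > 0" for x :: real
  proof -
    have "of_real (x\<^sup>2) powr (w / 2 - 1) = complex_of_real x powr (w / 2 - 1) * of_real x powr (w / 2 - 1)"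
      using that by (subst powr_times_real[symmetric]) (auto simp: power2_eq_square)
    also have "\<dots> = of_real x powr (w - 2)" by (simp add: powr_add[symmetric])
    finally have "of_real x * of_real (x\<^sup>2) powr (w / 2 - 1) = complex_of_real x powr (w - 1)"
      using that powr_add[of "of_real x" 1 "w - 2"] by simp
    thus ?thesis by (simp add: scaleR_conv_of_real)
  qed
  have ei: "einterval 0 \<infinity> = {0<..}" by (auto simp: einterval_def)
  have "(LBINT x=0..\<infinity>. ?f x) = (LBINT x=0..\<infinity>. (2 * x) *\<^sub>R ?f (x\<^sup>2))"
  proof (rule interval_integral_substitution_integrable)
    fix x :: real assume x: "0 < ereal x"
    show "((\<lambda>x. x\<^sup>2) has_real_derivative 2 * x) (at x)" by (auto intro!: derivative_eq_intros)
    show "isCont ?f (x\<^sup>2)" using x continuous_on_Gamma_kernel[of "w / 2 - 1" c]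
      by (auto simp: continuous_on_eq_continuous_at)
  next
    show "((ereal \<circ> (\<lambda>x. x\<^sup>2) \<circ> real_of_ereal) \<longlongrightarrow> 0) (at_right 0)"
      unfolding zero_ereal_def ereal_tendsto_simps by (auto intro!: tendsto_eq_intros)
    show "((ereal \<circ> (\<lambda>x. x\<^sup>2) \<circ> real_of_ereal) \<longlongrightarrow> \<infinity>) (at_left \<infinity>)"
      unfolding ereal_tendsto_simps using filterlim_pow_at_top[of 2 "\<lambda>x. x" "at_top :: real filter"]
      by (simp add: comp_def tendsto_PInfty_eq_at_top filterlim_ident)
    have "set_integrable lborel {0<..} (\<lambda>x. 2 * ?h x)" by (intro set_integrable_mult_right i)
    also have "?this \<longleftrightarrow> set_integrable lborel {0<..} (\<lambda>x. (2 * x) *\<^sub>R ?f (x\<^sup>2))"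
      by (rule set_integrable_cong[OF refl refl e[symmetric]]) simp
    finally show "set_integrable lborel (einterval 0 \<infinity>) (\<lambda>x. (2 * x) *\<^sub>R ?f (x\<^sup>2))" by (simp only: ei)
    show "set_integrable lborel (einterval 0 \<infinity>) ?f" unfolding ei
      by (rule Gamma_integral_lborel) (use w c in auto)
  qed (auto intro!: continuous_intros)
  hence "(LINT x:{0<..}|lborel. ?f x) = (LINT x:{0<..}|lborel. (2 * x) *\<^sub>R ?f (x\<^sup>2))"
    by (simp only: interval_lebesgue_integral_def ei) simp
  also have "\<dots> = (LINT x:{0<..}|lborel. 2 * ?h x)"
    by (rule set_lebesgue_integral_cong; (intro allI impI e)?; simp)
  also have "\<dots> = 2 * (LINT x:{0<..}|lborel. ?h x)" by simp
  also have "(LINT x:{0<..}|lborel. ?f x) = of_real c powr (- (w / 2)) * Gamma (w / 2)"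
    by (rule Gamma_integral_lborel) (use w c in auto)
  finally show "(LINT x:{0<..}|lborel. ?h x) = of_real c powr (- w / 2) * Gamma (w / 2) / 2" by simp
qed

lemma of_real_powr_exp: "a > 0 \<Longrightarrow> complex_of_real a powr v = exp (v * of_real (ln a))"
  by (simp add: powr_def Ln_of_real)

lemma real_Gauss_type_integral:
  fixes a :: real
  assumes a: "a > 0" and c: "c > 0"
  shows "set_integrable lborel {0<..} (\<lambda>x. x powr (a - 1) * exp (- c * x\<^sup>2))"
    and "(LINT x:{0<..}|lborel. x powr (a - 1) * exp (- c * x\<^sup>2)) = c powr (- a / 2) * Gamma (a / 2) / 2"
proof -
  have e: "of_real x powr (of_real a - 1) * of_real (exp (- c * x\<^sup>2)) = complex_of_real (x powr (a - 1) * exp (- c * x\<^sup>2))" if "x > 0" for x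
    using that powr_of_real[of x "a - 1"] by simp
  have i: "set_integrable lborel {0<..} (\<lambda>x. of_real x powr (of_real a - 1) * of_real (exp (- c * x\<^sup>2)) :: complex)"
    by (rule Gauss_type_integral(1)) (use a c in auto)
  note r = set_integral_real_of_complex[OF i _ e]
  show "set_integrable lborel {0<..} (\<lambda>x. x powr (a - 1) * exp (- c * x\<^sup>2))" by (rule r) auto
  have "complex_of_real (LINT x:{0<..}|lborel. x powr (a - 1) * exp (- c * x\<^sup>2)) =
      (LINT x:{0<..}|lborel. of_real x powr (of_real a - 1) * of_real (exp (- c * x\<^sup>2)))"
    by (rule r) auto
  also have "\<dots> = of_real c powr (- of_real a / 2) * Gamma (of_real a / 2) / 2"
    by (subst Gauss_type_integral(2)) (use a c in auto)
  also have "\<dots> = of_real (c powr (- a / 2) * Gamma (a / 2) / 2)"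
    using c powr_of_real[of c "- a / 2"] Gamma_complex_of_real[of "a / 2"] by simp
  finally show "(LINT x:{0<..}|lborel. x powr (a - 1) * exp (- c * x\<^sup>2)) = c powr (- a / 2) * Gamma (a / 2) / 2"
    by (simp only: of_real_eq_iff)
qed

text \<open>The Mellin transform of t to K_\<nu>(b t) in closed form. It is used for every argument
  z off the poles, also where the integral diverges.\<close>

definition K_mellin :: "complex \<Rightarrow> real \<Rightarrow> complex \<Rightarrow> complex" where
  "K_mellin \<nu> b z = of_real b powr (- z) * 2 powr (z - 2) * Gamma ((z - \<nu>) / 2) * Gamma ((z + \<nu>) / 2)"

text \<open>Insert the kernel and exchange the integrals. For fixed u the integral over x is of
  Gaussian type and converges since Re (z + \<nu>) > 0; the remaining integral over u is a Gamma
  integral and converges since Re (z - \<nu>) > 0.\<close>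

lemma K_bessel_Mellin:
  assumes z: "Re z > \<bar>Re \<nu>\<bar>"
  shows "set_integrable lborel {0<..} (\<lambda>x. of_real x powr (z - 1) * K_bessel \<nu> x)"
    and "(LINT x:{0<..}|lborel. of_real x powr (z - 1) * K_bessel \<nu> x) = K_mellin \<nu> 1 z"
proof -
  \<comment> \<open>The exponent z + \<nu> - 1 already contains the power x^\<nu> in front of the
    integral for K. The constant left over from (x / 2)^\<nu> / 2 is 2 powr (-\<nu> - 1).\<close>
  define F where "F u x = indicat_real {0<..} u *\<^sub>R indicat_real {0<..} x *\<^sub>R
     (of_real x powr (z + \<nu> - 1) * of_real u powr (- \<nu> - 1) * complex_of_real (exp (- u) * exp (- (1 / (4 * u)) * x\<^sup>2)))" for u x :: real
  have Fm [measurable]: "case_prod F \<in> borel_measurable (lborel \<Otimes>\<^sub>M lborel)"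
    unfolding F_def by measurable
  have pos: "Re (z + \<nu>) > 0" "Re (z - \<nu>) > 0" using z by auto
  have Fu: "F u x = indicat_real {0<..} u *\<^sub>R (of_real u powr (- \<nu> - 1) * of_real (exp (- u))) *
      (indicat_real {0<..} x *\<^sub>R (of_real x powr (z + \<nu> - 1) * complex_of_real (exp (- (1 / (4 * u)) * x\<^sup>2))))" for u x
    by (simp add: F_def indicator_def)
  have c4: "complex_of_real (1 / (4 * u)) powr (- w) = 4 powr w * of_real u powr w" if "u > 0" for u w
  proof -
    have "complex_of_real (1 / (4 * u)) powr (- w) = of_real (4 * u) powr w"
      using that unfolding of_real_powr_exp[of "1 / (4 * u)", OF divide_pos_pos[OF zero_less_one mult_pos_pos[OF zero_less_numeral that]]]
        of_real_powr_exp[of "4 * u", OF mult_pos_pos[OF zero_less_numeral that]]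
      by (simp add: ln_div)
    also have "\<dots> = 4 powr w * of_real u powr w"
      using that powr_times_real[of 4 "of_real u" w] by simp
    finally show ?thesis .
  qed
  have intx: "integrable lborel (F u)" for u
  proof (cases "u > 0")
    case True
    show ?thesis unfolding Fu
      using Gauss_type_integral(1)[OF pos(1), of "1 / (4 * u)"] True unfolding set_integrable_def
      by (intro integrable_mult_right) auto
  next
    case False
    hence "F u = (\<lambda>_. 0)" by (auto simp: F_def)
    thus ?thesis by simp
  qed
  have norm_int: "(LINT x|lborel. norm (F u x)) = indicat_real {0<..} u *\<^sub>R (4 powr (Re (z + \<nu>) / 2) * Gamma (Re (z + \<nu>) / 2) / 2 *
      (u powr (Re (z - \<nu>) / 2 - 1) * exp (- u)))" for u
  proof (cases "u > 0")
    case True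
    have "norm (F u x) = u powr (- Re \<nu> - 1) * exp (- u) * (indicat_real {0<..} x *\<^sub>R (x powr (Re (z + \<nu>) - 1) * exp (- (1 / (4 * u)) * x\<^sup>2)))" for x
      using True by (auto simp: F_def norm_mult norm_of_real_powr indicator_def)
    hence "(LINT x|lborel. norm (F u x)) = u powr (- Re \<nu> - 1) * exp (- u) * (LINT x:{0<..}|lborel. x powr (Re (z + \<nu>) - 1) * exp (- (1 / (4 * u)) * x\<^sup>2))"
      unfolding set_lebesgue_integral_def by simp
    also have "\<dots> = u powr (- Re \<nu> - 1) * exp (- u) * ((1 / (4 * u)) powr (- Re (z + \<nu>) / 2) * Gamma (Re (z + \<nu>) / 2) / 2)"
      by (subst real_Gauss_type_integral(2)) (use pos True in auto)
    also have "(1 / (4 * u)) powr (- Re (z + \<nu>) / 2) = 4 powr (Re (z + \<nu>) / 2) * u powr (Re (z + \<nu>) / 2)"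
    proof -
      have "(1 / (4 * u)) powr (- a) = 4 powr a * u powr a" for a
        using True by (simp add: powr_divide powr_mult powr_minus field_simps)
      from this[of "Re (z + \<nu>) / 2"] show ?thesis by (simp only: minus_divide_left)
    qed
    also have "u powr (- Re \<nu> - 1) * exp (- u) * (4 powr (Re (z + \<nu>) / 2) * u powr (Re (z + \<nu>) / 2) * Gamma (Re (z + \<nu>) / 2) / 2) =
       4 powr (Re (z + \<nu>) / 2) * Gamma (Re (z + \<nu>) / 2) / 2 * ((u powr (- Re \<nu> - 1) * u powr (Re (z + \<nu>) / 2)) * exp (- u))" by simp
    also have "u powr (- Re \<nu> - 1) * u powr (Re (z + \<nu>) / 2) = u powr (Re (z - \<nu>) / 2 - 1)"
      by (simp add: powr_add[symmetric] field_simps)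
    finally show ?thesis using True by simp
  qed (simp add: F_def)
  have Fint: "integrable (lborel \<Otimes>\<^sub>M lborel) (case_prod F)"
  proof (rule lborel_pair.Fubini_integrable[OF Fm])
    have "integrable lborel (\<lambda>u. 4 powr (Re (z + \<nu>) / 2) * Gamma (Re (z + \<nu>) / 2) / 2 *
       (indicat_real {0<..} u *\<^sub>R (u powr (Re (z - \<nu>) / 2 - 1) * exp (- u))))"
      using real_Gamma_integral_lborel(1)[of "Re (z - \<nu>) / 2"] pos(2) unfolding set_integrable_def
      by (intro integrable_mult_right) auto
    thus "integrable lborel (\<lambda>u. LINT x|lborel. norm (case_prod F (u, x)))"
      unfolding case_prod_conv norm_int by (simp add: mult_ac)
    show "AE u in lborel. integrable lborel (\<lambda>x. case_prod F (u, x))" using intx by simp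
  qed
  have k: "2 powr (- \<nu> - 1) * (LINT u|lborel. F u x) = indicat_real {0<..} x *\<^sub>R (of_real x powr (z - 1) * K_bessel \<nu> x)" for x
  proof (cases "x > 0")
    case True
    have Fx: "F u x = of_real x powr (z + \<nu> - 1) * (indicat_real {0<..} u *\<^sub>R bessel_K_kernel \<nu> (x\<^sup>2 / 4) u)" for u
    proof -
      have "exp (- u - x\<^sup>2 / 4 / u) = exp (- u) * exp (- (1 / (4 * u)) * x\<^sup>2)"
        by (simp add: exp_add[symmetric])
      thus ?thesis using True by (auto simp: F_def bessel_K_kernel_def indicator_def)
    qed
    have "(LINT u|lborel. F u x) = of_real x powr (z + \<nu> - 1) * bessel_K_integral \<nu> (x\<^sup>2 / 4)"
      by (simp only: Fx bessel_K_integral_def set_lebesgue_integral_def integral_mult_right_zero)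
    moreover have "2 powr (- \<nu> - 1) * of_real x powr (z + \<nu> - 1) = of_real x powr (z - 1) * (of_real (x / 2) powr \<nu> / 2)"
    proof -
      have "complex_of_real (x / 2) powr \<nu> = of_real x powr \<nu> * 2 powr (- \<nu>)"
      proof -
        have "complex_of_real (x / 2) powr \<nu> = exp (\<nu> * of_real (ln x)) * exp (- \<nu> * of_real (ln 2))"
          using of_real_powr_exp[of "x / 2" \<nu>] True by (simp add: ln_div exp_add[symmetric] algebra_simps)
        thus ?thesis using of_real_powr_exp[of x \<nu>] of_real_powr_exp[of 2 "- \<nu>"] True by simp
      qed
      moreover have "z + \<nu> - 1 = (z - 1) + \<nu>" "- \<nu> - 1 = - \<nu> + - 1" by simp_all
      ultimately show ?thesis by (simp only: powr_add) (simp add: powr_minus)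
    qed
    ultimately show ?thesis using True by (simp add: K_bessel_def mult.assoc[symmetric])
  qed (simp add: F_def)
  have "integrable lborel (\<lambda>x. LINT u|lborel. F u x)"
    by (rule lborel_pair.integrable_snd[OF Fint])
  hence "integrable lborel (\<lambda>x. 2 powr (- \<nu> - 1) * (LINT u|lborel. F u x))" by (rule integrable_mult_right)
  thus "set_integrable lborel {0<..} (\<lambda>x. of_real x powr (z - 1) * K_bessel \<nu> x)"
    unfolding k set_integrable_def .
  have "(LINT x:{0<..}|lborel. of_real x powr (z - 1) * K_bessel \<nu> x) = (LINT x|lborel. 2 powr (- \<nu> - 1) * (LINT u|lborel. F u x))"
    unfolding k set_lebesgue_integral_def ..
  also have "\<dots> = 2 powr (- \<nu> - 1) * (LINT x|lborel. (LINT u|lborel. F u x))" by simp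
  also have "(LINT x|lborel. (LINT u|lborel. F u x)) = (LINT u|lborel. (LINT x|lborel. F u x))"
    by (rule lborel_pair.Fubini_integral[OF Fint])
  also have "\<dots> = (LINT u:{0<..}|lborel. (4 powr ((z + \<nu>) / 2) * Gamma ((z + \<nu>) / 2) / 2) * (of_real u powr ((z - \<nu>) / 2 - 1) * of_real (exp (- 1 * u))))"
    unfolding set_lebesgue_integral_def
  proof (rule Bochner_Integration.integral_cong[OF refl])
    fix u :: real
    show "(LINT x|lborel. F u x) = indicat_real {0<..} u *\<^sub>R ((4 powr ((z + \<nu>) / 2) * Gamma ((z + \<nu>) / 2) / 2) * (of_real u powr ((z - \<nu>) / 2 - 1) * complex_of_real (exp (- 1 * u))))"
    proof (cases "u > 0")
      case True
      have "(LINT x|lborel. F u x) = (of_real u powr (- \<nu> - 1) * of_real (exp (- u))) *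
         (LINT x:{0<..}|lborel. of_real x powr (z + \<nu> - 1) * complex_of_real (exp (- (1 / (4 * u)) * x\<^sup>2)))"
        unfolding Fu set_lebesgue_integral_def integral_mult_right_zero using True by simp
      also have "\<dots> = (of_real u powr (- \<nu> - 1) * of_real (exp (- u))) * (of_real (1 / (4 * u)) powr (- ((z + \<nu>) / 2)) * Gamma ((z + \<nu>) / 2) / 2)"
        unfolding minus_divide_left[of "z + \<nu>" 2] by (subst Gauss_type_integral(2)) (use pos True in auto)
      also have "\<dots> = (4 powr ((z + \<nu>) / 2) * Gamma ((z + \<nu>) / 2) / 2) * ((of_real u powr (- \<nu> - 1) * of_real u powr ((z + \<nu>) / 2)) * of_real (exp (- u)))"
        unfolding c4[OF True] by simp
      also have "of_real u powr (- \<nu> - 1) * of_real u powr ((z + \<nu>) / 2) = complex_of_real u powr ((z - \<nu>) / 2 - 1)"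
      proof -
        have "(z - \<nu>) / 2 - 1 = (- \<nu> - 1) + (z + \<nu>) / 2" by (simp add: field_simps)
        thus ?thesis by (simp only: powr_add)
      qed
      finally show ?thesis using True by simp
    qed (simp add: F_def)
  qed
  also have "\<dots> = (4 powr ((z + \<nu>) / 2) * Gamma ((z + \<nu>) / 2) / 2) * Gamma ((z - \<nu>) / 2)"
    using Gamma_integral_lborel(2)[of "(z - \<nu>) / 2" 1] pos(2) by simp
  also have "2 powr (- \<nu> - 1) * \<dots> = K_mellin \<nu> 1 z"
  proof -
    have "(4 :: complex) powr ((z + \<nu>) / 2) = 2 powr (z + \<nu>)"
    proof -
      have "(4 :: complex) powr ((z + \<nu>) / 2) = 2 powr ((z + \<nu>) / 2) * 2 powr ((z + \<nu>) / 2)"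
        using powr_times_real[of 2 2 "(z + \<nu>) / 2"] by simp
      thus ?thesis by (simp only: powr_add[symmetric]) simp
    qed
    moreover have "z - 2 = (- \<nu> - 1) + (z + \<nu>) + (- 1)" by simp
    hence "2 powr (z - 2) = 2 powr (- \<nu> - 1) * 2 powr (z + \<nu>) * (2 powr (- 1) :: complex)" by (simp only: powr_add)
    ultimately show ?thesis by (simp add: K_mellin_def powr_minus)
  qed
  finally show "(LINT x:{0<..}|lborel. of_real x powr (z - 1) * K_bessel \<nu> x) = K_mellin \<nu> 1 z" .
qed

lemma K_bessel_Mellin_scaled:
  assumes z: "Re z > \<bar>Re \<nu>\<bar>" and b: "b > 0"
  shows "set_integrable lborel {0<..} (\<lambda>t. of_real t powr (z - 1) * K_bessel \<nu> (b * t))"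
    and "(LINT t:{0<..}|lborel. of_real t powr (z - 1) * K_bessel \<nu> (b * t)) = K_mellin \<nu> b z"
proof -
  let ?f = "\<lambda>x. of_real x powr (z - 1) * K_bessel \<nu> x"
  let ?g = "\<lambda>t. of_real t powr (z - 1) * K_bessel \<nu> (b * t)"
  have e: "?f (b * t) = of_real b powr (z - 1) * ?g t" if "t > 0" for t
    using that b by (simp add: powr_times_real)
  have nz: "complex_of_real b powr (z - 1) \<noteq> 0" using b by simp
  have "set_integrable lborel {0<..} (\<lambda>t. ?f (b * t))"
    using K_bessel_Mellin(1)[OF z] set_integrable_scale_pos[OF b, of ?f] by blast
  also have "?this \<longleftrightarrow> set_integrable lborel {0<..} (\<lambda>t. of_real b powr (z - 1) * ?g t)"
    by (rule set_integrable_cong[OF refl refl e]) simp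
  finally show "set_integrable lborel {0<..} ?g" using nz by (simp only: set_integrable_mult_right_iff nz if_False)
  have "K_mellin \<nu> 1 z = of_real b * (LINT t:{0<..}|lborel. ?f (b * t))"
    using set_integral_scale_pos[OF b, of ?f] K_bessel_Mellin(2)[OF z] by simp
  also have "(LINT t:{0<..}|lborel. ?f (b * t)) = (LINT t:{0<..}|lborel. of_real b powr (z - 1) * ?g t)"
    by (rule set_lebesgue_integral_cong; (intro allI impI e)?; simp)
  also have "\<dots> = of_real b powr (z - 1) * (LINT t:{0<..}|lborel. ?g t)" by (rule set_integral_mult_right)
  also have "of_real b * \<dots> = of_real b powr z * (LINT t:{0<..}|lborel. ?g t)"
    using b powr_add[of "of_real b" 1 "z - 1"] by (simp del: set_integral_mult_right)
  finally show "(LINT t:{0<..}|lborel. ?g t) = K_mellin \<nu> b z"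
    using b by (simp add: K_mellin_def powr_minus field_simps)
qed

section \<open>A primitive of \<open>t\<^bsup>z-1\<^esup> K\<^bsub>\<nu>\<^esub>(b t)\<close> and its value at infinity\<close>

text \<open>The factor (b / 2)^\<rho> is absorbed, so that I_\<rho>(b t) is t^\<rho> times a power
  series in t^2 with exactly these coefficients.\<close>

definition I_coeff :: "complex \<Rightarrow> real \<Rightarrow> nat \<Rightarrow> complex" where
  "I_coeff \<rho> b n = of_real (b / 2) powr \<rho> * (rGamma (\<rho> + of_nat n + 1) * rGamma (0 + of_nat n + 1) * of_real (b\<^sup>2 / 4) ^ n)"

definition I_prim :: "complex \<Rightarrow> real \<Rightarrow> complex \<Rightarrow> real \<Rightarrow> complex" where
  "I_prim \<rho> b z = power_series_powr (\<rho> + z) 2 (\<lambda>n. I_coeff \<rho> b n / (\<rho> + z + of_nat (2 * n)))"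

text \<open>The Euler derivative t d/dt of I_\<rho>(b t), formed termwise. It enters as a boundary
  term of an integration by parts.\<close>

definition I_euler :: "complex \<Rightarrow> real \<Rightarrow> real \<Rightarrow> complex" where
  "I_euler \<rho> b = power_series_powr \<rho> 2 (\<lambda>n. (\<rho> + of_nat (2 * n)) * I_coeff \<rho> b n)"

text \<open>Since 1 + n <= 2^n, the linear factor is absorbed by doubling the argument of an
  everywhere convergent series. The slack pays for termwise differentiation and for the growth in
  \<open>odd_pfd_bound\<close>.\<close>

lemma summable_norm_I_coeff_poly: "summable (\<lambda>n. norm (I_coeff \<rho> b n * q ^ n) * (1 + real n))"
proof -
  have 1: "summable (\<lambda>n. norm (of_real (b / 2) powr \<rho>) * norm (rGamma (\<rho> + of_nat n + 1) * rGamma (0 + of_nat n + 1) * (2 * q * of_real (b\<^sup>2 / 4)) ^ n))"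
    by (intro summable_mult summable_norm_rGamma_series2)
  show ?thesis
  proof (rule summable_comparison_test'[OF 1, of 0])
    fix n :: nat
    have "1 + real n \<le> 2 ^ n" using Bernoulli_inequality[of 1 n] by simp
    hence "norm (I_coeff \<rho> b n * q ^ n) * (1 + real n) \<le> norm (I_coeff \<rho> b n * q ^ n) * 2 ^ n"
      by (intro mult_left_mono) auto
    also have "\<dots> = norm (of_real (b / 2) powr \<rho>) * norm (rGamma (\<rho> + of_nat n + 1) * rGamma (0 + of_nat n + 1) * (2 * q * of_real (b\<^sup>2 / 4)) ^ n)"
      unfolding I_coeff_def norm_mult norm_power power_mult_distrib by simp
    finally show "norm (norm (I_coeff \<rho> b n * q ^ n) * (1 + real n)) \<le>
      norm (of_real (b / 2) powr \<rho>) * norm (rGamma (\<rho> + of_nat n + 1) * rGamma (0 + of_nat n + 1) * (2 * q * of_real (b\<^sup>2 / 4)) ^ n)" by simp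
  qed
qed

lemma summable_I_coeff: "summable (\<lambda>n. I_coeff \<rho> b n * q ^ n)"
proof (rule summable_norm_cancel, rule summable_comparison_test'[OF summable_norm_I_coeff_poly[of \<rho> b q], of 0])
  fix n :: nat
  show "norm (norm (I_coeff \<rho> b n * q ^ n)) \<le> norm (I_coeff \<rho> b n * q ^ n) * (1 + real n)"
    by (simp add: mult_le_cancel_left1)
qed

lemma summable_I_prim:
  assumes "\<rho> + z \<notin> \<int>"
  shows "summable (\<lambda>n. I_coeff \<rho> b n / (\<rho> + z + of_nat (2 * n)) * q ^ n)"
proof -
  obtain d where d: "d > 0" "\<And>n. norm (\<rho> + z - of_int n) \<ge> d" using norm_diff_of_int_ge_pos assms by blast
  show ?thesis
  proof (rule summable_norm_cancel, rule summable_comparison_test'[OF summable_mult[OF summable_norm_I_coeff_poly[of \<rho> b q], of "1 / d"], of 0])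
    fix n :: nat
    have "norm (\<rho> + z + of_nat (2 * n)) \<ge> d" using d(2)[of "- int (2 * n)"] by simp
    hence "norm (I_coeff \<rho> b n / (\<rho> + z + of_nat (2 * n)) * q ^ n) \<le> norm (I_coeff \<rho> b n * q ^ n) / d"
      using d(1) unfolding norm_mult norm_divide times_divide_eq_left by (intro divide_left_mono mult_pos_pos) auto
    also have "\<dots> \<le> norm (I_coeff \<rho> b n * q ^ n) * (1 + real n) / d"
      using d(1) by (intro divide_right_mono) (auto simp: mult_le_cancel_left1)
    finally show "norm (norm (I_coeff \<rho> b n / (\<rho> + z + of_nat (2 * n)) * q ^ n)) \<le> 1 / d * (norm (I_coeff \<rho> b n * q ^ n) * (1 + real n))"
      by simp
  qed
qed

lemma bessel_I_scaled:
  assumes "b > 0" "t > 0"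
  shows "bessel_I \<rho> (of_real (b * t)) = power_series_powr \<rho> 2 (I_coeff \<rho> b) t"
proof -
  have 1: "rGamma_series2 \<rho> 0 (of_real ((b * t)\<^sup>2 / 4)) * of_real (b / 2) powr \<rho> = (\<Sum>n. I_coeff \<rho> b n * of_real t ^ (2 * n))"
  proof -
    have "(\<lambda>n. rGamma (\<rho> + of_nat n + 1) * rGamma (0 + of_nat n + 1) * of_real ((b * t)\<^sup>2 / 4) ^ n) sums rGamma_series2 \<rho> 0 (of_real ((b * t)\<^sup>2 / 4))"
      unfolding rGamma_series2_def by (rule summable_sums[OF summable_norm_cancel[OF summable_norm_rGamma_series2]])
    from sums_mult2[OF this, of "of_real (b / 2) powr \<rho>"]
    moreover have "complex_of_real ((b * t)\<^sup>2 / 4) ^ n = of_real (b\<^sup>2 / 4) ^ n * of_real t ^ (2 * n)" for n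
      by (simp add: power_mult power_mult_distrib power_divide)
    ultimately have "(\<lambda>n. I_coeff \<rho> b n * of_real t ^ (2 * n)) sums (rGamma_series2 \<rho> 0 (of_real ((b * t)\<^sup>2 / 4)) * of_real (b / 2) powr \<rho>)"
      by (simp only: I_coeff_def mult_ac)
    thus ?thesis by (rule sums_unique)
  qed
  have 2: "complex_of_real (b * t / 2) powr \<rho> = of_real t powr \<rho> * of_real (b / 2) powr \<rho>"
    using assms powr_times_real[of "of_real t" "of_real (b / 2)" \<rho>] by (simp add: mult.commute)
  show ?thesis
    unfolding bessel_I_of_real[OF mult_pos_pos[OF assms]] power_series_powr_def 1[symmetric] 2 by (simp only: mult_ac)
qed

lemma I_prim_has_vector_derivative:
  assumes "\<rho> + z \<notin> \<int>" "b > 0" "t > 0"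
  shows "(I_prim \<rho> b z has_vector_derivative of_real t powr (z - 1) * bessel_I \<rho> (of_real (b * t))) (at t)"
proof -
  have "(\<rho> + z + of_nat (2 * n)) * (I_coeff \<rho> b n / (\<rho> + z + of_nat (2 * n))) = I_coeff \<rho> b n" for n
    using nonint_add_nat_nonzero[OF assms(1), of "2 * n"] by simp
  hence "power_series_powr (\<rho> + z - 1) 2 (\<lambda>n. (\<rho> + z + of_nat (2 * n)) * (I_coeff \<rho> b n / (\<rho> + z + of_nat (2 * n)))) t =
      power_series_powr (\<rho> + z - 1) 2 (I_coeff \<rho> b) t" by simp
  also have "\<dots> = of_real t powr (z - 1) * bessel_I \<rho> (of_real (b * t))"
  proof -
    have "\<rho> + z - 1 = (z - 1) + \<rho>" by simp
    thus ?thesis unfolding bessel_I_scaled[OF assms(2,3)] power_series_powr_def by (simp only: powr_add mult.assoc)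
  qed
  finally show ?thesis
    using power_series_powr_has_vector_derivative[OF summable_I_prim[OF assms(1), of b] assms(3), of "\<rho> + z" 2]
    unfolding I_prim_def by simp
qed

text \<open>The modified Bessel equation, read off on coefficients.\<close>

lemma I_coeff_rec: "(of_nat (Suc n) * (of_nat (Suc n) + \<rho>)) * I_coeff \<rho> b (Suc n) = of_real (b\<^sup>2 / 4) * I_coeff \<rho> b n"
proof -
  have "(\<rho> + of_nat (Suc n)) * rGamma (\<rho> + of_nat (Suc n) + 1) = rGamma (\<rho> + of_nat n + 1)"
    using rGamma_plus1[of "\<rho> + of_nat (Suc n)"] by (simp add: add_ac)
  moreover have "of_nat (Suc n) * rGamma (0 + of_nat (Suc n) + 1) = (rGamma (0 + of_nat n + 1) :: complex)"
    using rGamma_plus1[of "of_nat (Suc n) :: complex"] by (simp add: add_ac)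
  moreover have "(of_nat (Suc n) * (of_nat (Suc n) + \<rho>)) * I_coeff \<rho> b (Suc n) =
      of_real (b\<^sup>2 / 4) * (of_real (b / 2) powr \<rho> * (((\<rho> + of_nat (Suc n)) * rGamma (\<rho> + of_nat (Suc n) + 1)) *
       (of_nat (Suc n) * rGamma (0 + of_nat (Suc n) + 1)) * of_real (b\<^sup>2 / 4) ^ n))"
    unfolding I_coeff_def power_Suc by (simp only: mult_ac add_ac)
  ultimately show ?thesis by (simp only: I_coeff_def)
qed

text \<open>With D = t d/dt the modified Bessel equation reads (D^2 - \<rho>^2) I = b^2 t^2 I.
  Multiplying by t^(z-1) and integrating by parts twice gives this relation. It is verified on
  coefficients, so it also holds where the integrals from 0 diverge.\<close>

lemma I_prim_rec:
  assumes g: "\<rho> + z \<notin> \<int>" and b: "b > 0" and t: "t > 0"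
  shows "(z\<^sup>2 - \<rho>\<^sup>2) * I_prim \<rho> b z t = z * of_real t powr z * bessel_I \<rho> (of_real (b * t))
     - of_real t powr z * I_euler \<rho> b t + of_real (b\<^sup>2) * I_prim \<rho> b (z + 2) t"
proof -
  define T where "T = complex_of_real t ^ 2"
  define D where "D = I_coeff \<rho> b"
  have Tn: "complex_of_real t ^ (2 * n) = T ^ n" for n by (simp add: T_def power_mult)
  have g2: "\<rho> + (z + 2) \<notin> \<int>" using nonint_add_int[of "\<rho> + z" 2] g by (simp add: add_ac)
  have nz: "\<rho> + z + of_nat (2 * n) \<noteq> 0" for n using g by (rule nonint_add_nat_nonzero)
  define P where "P = (\<Sum>n. D n / (\<rho> + z + of_nat (2 * n)) * T ^ n)"
  define Q where "Q = (\<Sum>n. D n / (\<rho> + (z + 2) + of_nat (2 * n)) * T ^ n)"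
  define F where "F = (\<Sum>n. D n * T ^ n)"
  define E where "E = (\<Sum>n. (\<rho> + of_nat (2 * n)) * D n * T ^ n)"
  have sF: "(\<lambda>n. D n * T ^ n) sums F" unfolding F_def D_def by (intro summable_sums summable_I_coeff)
  have sP: "(\<lambda>n. D n / (\<rho> + z + of_nat (2 * n)) * T ^ n) sums P" unfolding P_def D_def by (intro summable_sums summable_I_prim g)
  have sQ: "(\<lambda>n. D n / (\<rho> + (z + 2) + of_nat (2 * n)) * T ^ n) sums Q" unfolding Q_def D_def by (intro summable_sums summable_I_prim g2)
  have sE: "(\<lambda>n. (\<rho> + of_nat (2 * n)) * D n * T ^ n) sums E"
    unfolding E_def
  proof (rule summable_sums, rule summable_norm_cancel,
      rule summable_comparison_test'[OF summable_mult[OF summable_norm_I_coeff_poly[of \<rho> b T], of "norm \<rho> + 2"], of 0])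
    fix n :: nat
    have "norm (\<rho> + of_nat (2 * n)) \<le> norm \<rho> + norm (of_nat (2 * n) :: complex)" by (rule norm_triangle_ineq)
    also have "\<dots> \<le> (norm \<rho> + 2) * (1 + real n)" by (simp add: algebra_simps)
    finally have "norm (\<rho> + of_nat (2 * n)) * norm (D n * T ^ n) \<le> ((norm \<rho> + 2) * (1 + real n)) * norm (D n * T ^ n)"
      by (intro mult_right_mono) auto
    thus "norm (norm ((\<rho> + of_nat (2 * n)) * D n * T ^ n)) \<le> (norm \<rho> + 2) * (norm (I_coeff \<rho> b n * T ^ n) * (1 + real n))"
      by (simp add: D_def norm_mult mult_ac)
  qed
  have shift: "(\<lambda>n. 4 * of_nat n * (of_nat n + \<rho>) * D n / (\<rho> + z + of_nat (2 * n)) * T ^ n) sums (of_real (b\<^sup>2) * T * Q)"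
  proof -
    have "(\<lambda>n. of_real (b\<^sup>2) * T * (D n / (\<rho> + (z + 2) + of_nat (2 * n)) * T ^ n)) sums (of_real (b\<^sup>2) * T * Q)"
      by (intro sums_mult sQ)
    also have "(\<lambda>n. of_real (b\<^sup>2) * T * (D n / (\<rho> + (z + 2) + of_nat (2 * n)) * T ^ n)) =
        (\<lambda>n. 4 * of_nat (Suc n) * (of_nat (Suc n) + \<rho>) * D (Suc n) / (\<rho> + z + of_nat (2 * Suc n)) * T ^ Suc n)"
    proof
      fix n :: nat
      have "4 * of_nat (Suc n) * (of_nat (Suc n) + \<rho>) * D (Suc n) = of_real (b\<^sup>2) * D n"
      proof -
        have "4 * of_nat (Suc n) * (of_nat (Suc n) + \<rho>) * D (Suc n) =
            4 * ((of_nat (Suc n) * (of_nat (Suc n) + \<rho>)) * I_coeff \<rho> b (Suc n))"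
          by (simp only: D_def mult.assoc)
        thus ?thesis unfolding I_coeff_rec by (simp add: D_def)
      qed
      moreover have "\<rho> + z + of_nat (2 * Suc n) = \<rho> + (z + 2) + of_nat (2 * n)" by simp
      ultimately show "of_real (b\<^sup>2) * T * (D n / (\<rho> + (z + 2) + of_nat (2 * n)) * T ^ n) =
        4 * of_nat (Suc n) * (of_nat (Suc n) + \<rho>) * D (Suc n) / (\<rho> + z + of_nat (2 * Suc n)) * T ^ Suc n"
        by (simp only: power_Suc times_divide_eq_left times_divide_eq_right mult_ac)
    qed
    finally show ?thesis by (subst (asm) sums_Suc_iff) simp
  qed
  have "(\<lambda>n. z * (D n * T ^ n) - (\<rho> + of_nat (2 * n)) * D n * T ^ n + 4 * of_nat n * (of_nat n + \<rho>) * D n / (\<rho> + z + of_nat (2 * n)) * T ^ n)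
     sums (z * F - E + of_real (b\<^sup>2) * T * Q)"
    by (intro sums_add sums_diff sums_mult sF sE shift)
  moreover have "z * (D n * T ^ n) - (\<rho> + of_nat (2 * n)) * D n * T ^ n + 4 * of_nat n * (of_nat n + \<rho>) * D n / (\<rho> + z + of_nat (2 * n)) * T ^ n
     = (z\<^sup>2 - \<rho>\<^sup>2) * (D n / (\<rho> + z + of_nat (2 * n)) * T ^ n)" for n
  proof -
    have "(z - (\<rho> + of_nat (2 * n))) * (\<rho> + z + of_nat (2 * n)) + 4 * of_nat n * (of_nat n + \<rho>) = z\<^sup>2 - \<rho>\<^sup>2"
      by (simp add: power2_eq_square algebra_simps)
    hence "(z - (\<rho> + of_nat (2 * n))) + 4 * of_nat n * (of_nat n + \<rho>) / (\<rho> + z + of_nat (2 * n)) = (z\<^sup>2 - \<rho>\<^sup>2) / (\<rho> + z + of_nat (2 * n))"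
      using nz[of n] by (simp add: eq_divide_eq distrib_right)
    from arg_cong[OF this, of "\<lambda>x. x * (D n * T ^ n)"]
    show ?thesis by (simp only: distrib_right left_diff_distrib times_divide_eq_left mult.assoc times_divide_eq_right)
  qed
  ultimately have "(\<lambda>n. (z\<^sup>2 - \<rho>\<^sup>2) * (D n / (\<rho> + z + of_nat (2 * n)) * T ^ n)) sums (z * F - E + of_real (b\<^sup>2) * T * Q)" by simp
  from sums_unique2[OF this sums_mult[OF sP]] have main: "(z\<^sup>2 - \<rho>\<^sup>2) * P = z * F - E + of_real (b\<^sup>2) * T * Q" by simp
  have e1: "I_prim \<rho> b z t = of_real t powr (\<rho> + z) * P"
    and e2: "I_prim \<rho> b (z + 2) t = of_real t powr (\<rho> + z) * (T * Q)"
    and e3: "bessel_I \<rho> (of_real (b * t)) = of_real t powr \<rho> * F"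
    and e4: "I_euler \<rho> b t = of_real t powr \<rho> * E"
  proof -
    have "\<rho> + (z + 2) = (\<rho> + z) + 2" by simp
    hence "of_real t powr (\<rho> + (z + 2)) = of_real t powr (\<rho> + z) * T"
      using t by (simp only: powr_add) (simp add: T_def)
    thus "I_prim \<rho> b (z + 2) t = of_real t powr (\<rho> + z) * (T * Q)"
      unfolding I_prim_def power_series_powr_def Q_def D_def Tn by simp
  qed (simp_all only: I_prim_def power_series_powr_def P_def D_def Tn bessel_I_scaled[OF b t] F_def I_euler_def E_def)
  have "(z\<^sup>2 - \<rho>\<^sup>2) * I_prim \<rho> b z t = of_real t powr (\<rho> + z) * ((z\<^sup>2 - \<rho>\<^sup>2) * P)" unfolding e1 by simp
  also have "\<dots> = of_real t powr (\<rho> + z) * (z * F - E + of_real (b\<^sup>2) * T * Q)" unfolding main ..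
  finally show ?thesis unfolding e2 e3 e4 powr_add by (simp add: algebra_simps)
qed

definition K_factor :: "complex \<Rightarrow> complex" where
  "K_factor \<nu> = of_real pi / (2 * sin (of_real pi * \<nu>))"

lemma K_bessel_nonint':
  "\<nu> \<notin> \<int> \<Longrightarrow> x > 0 \<Longrightarrow> K_bessel \<nu> x = K_factor \<nu> * (bessel_I (- \<nu>) (of_real x) - bessel_I \<nu> (of_real x))"
  unfolding K_factor_def by (rule K_bessel_nonint)

definition K_prim :: "complex \<Rightarrow> real \<Rightarrow> complex \<Rightarrow> real \<Rightarrow> complex" where
  "K_prim \<nu> b z t = K_factor \<nu> * (I_prim (- \<nu>) b z t - I_prim \<nu> b z t)"

definition K_euler :: "complex \<Rightarrow> real \<Rightarrow> real \<Rightarrow> complex" where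
  "K_euler \<nu> b t = K_factor \<nu> * (I_euler (- \<nu>) b t - I_euler \<nu> b t)"

section \<open>Primitives involving K at non-integral order and their limits at infinity\<close>

locale generic_order =
  fixes \<nu> :: complex and b :: real
  assumes nonint: "\<nu> \<notin> \<int>" and b: "b > 0"
begin

text \<open>Keeps all denominators z + 2n + \<nu> and z + 2n - \<nu> away from 0. All integers are
  excluded so that the condition is stable under integral shifts and covers all arguments -m + (2k +
  1) and -m - (2k + 1) at once.\<close>

definition generic :: "complex \<Rightarrow> bool" where
  "generic z \<longleftrightarrow> \<nu> + z \<notin> \<int> \<and> - \<nu> + z \<notin> \<int>"

lemma generic_add_int: "generic (z + of_int n) \<longleftrightarrow> generic z"
  by (simp only: generic_def nonint_add_int add.assoc[symmetric])

lemma K_prim_has_vector_derivative: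
  assumes "generic z" "t > 0"
  shows "(K_prim \<nu> b z has_vector_derivative of_real t powr (z - 1) * K_bessel \<nu> (b * t)) (at t)"
proof -
  have "((\<lambda>t. K_factor \<nu> * (I_prim (- \<nu>) b z t - I_prim \<nu> b z t)) has_vector_derivative
     K_factor \<nu> * (of_real t powr (z - 1) * bessel_I (- \<nu>) (of_real (b * t)) - of_real t powr (z - 1) * bessel_I \<nu> (of_real (b * t)))) (at t)"
    by (rule has_vector_derivative_mult_right[OF has_vector_derivative_diff[OF I_prim_has_vector_derivative I_prim_has_vector_derivative]])
       (use assms b in \<open>auto simp: generic_def\<close>)
  also have "K_factor \<nu> * (of_real t powr (z - 1) * bessel_I (- \<nu>) (of_real (b * t)) - of_real t powr (z - 1) * bessel_I \<nu> (of_real (b * t)))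
    = of_real t powr (z - 1) * K_bessel \<nu> (b * t)"
    unfolding K_bessel_nonint'[OF nonint mult_pos_pos[OF b assms(2)]] by (simp add: algebra_simps)
  finally show ?thesis by (simp add: K_prim_def[abs_def])
qed

lemma K_prim_rec:
  assumes "generic z" and t: "t > 0"
  shows "(z\<^sup>2 - \<nu>\<^sup>2) * K_prim \<nu> b z t = z * of_real t powr z * K_bessel \<nu> (b * t)
     - of_real t powr z * K_euler \<nu> b t + of_real (b\<^sup>2) * K_prim \<nu> b (z + 2) t"
proof -
  have "(z\<^sup>2 - \<nu>\<^sup>2) * K_prim \<nu> b z t = K_factor \<nu> * ((z\<^sup>2 - (- \<nu>)\<^sup>2) * I_prim (- \<nu>) b z t - (z\<^sup>2 - \<nu>\<^sup>2) * I_prim \<nu> b z t)"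
    by (simp add: K_prim_def algebra_simps)
  also have "\<dots> = K_factor \<nu> *
     ((z * of_real t powr z * bessel_I (- \<nu>) (of_real (b * t)) - of_real t powr z * I_euler (- \<nu>) b t + of_real (b\<^sup>2) * I_prim (- \<nu>) b (z + 2) t) -
      (z * of_real t powr z * bessel_I \<nu> (of_real (b * t)) - of_real t powr z * I_euler \<nu> b t + of_real (b\<^sup>2) * I_prim \<nu> b (z + 2) t))"
    using assms b by (subst (1 2) I_prim_rec) (auto simp: generic_def)
  also have "\<dots> = z * of_real t powr z * K_bessel \<nu> (b * t)
     - of_real t powr z * K_euler \<nu> b t + of_real (b\<^sup>2) * K_prim \<nu> b (z + 2) t"
    unfolding K_bessel_nonint'[OF nonint mult_pos_pos[OF b t]] K_euler_def K_prim_def by (simp add: algebra_simps)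
  finally show ?thesis .
qed

text \<open>One application of the functional equation to each Gamma factor. The result is the
  recursion of \<open>K_prim\<close> without its boundary terms, which are thus forced to vanish at
  infinity.\<close>

lemma K_mellin_rec:
  assumes "generic z"
  shows "(z\<^sup>2 - \<nu>\<^sup>2) * K_mellin \<nu> b z = of_real (b\<^sup>2) * K_mellin \<nu> b (z + 2)"
proof -
  have half: "w / 2 \<notin> \<int>\<^sub>\<le>\<^sub>0" if "w \<notin> \<int>" for w :: complex
  proof
    assume "w / 2 \<in> \<int>\<^sub>\<le>\<^sub>0"
    hence "2 * (w / 2) \<in> \<int>" by (intro Ints_mult) (auto dest: nonpos_Ints_Int)
    with that show False by simp
  qed
  have g: "(z - \<nu>) / 2 \<notin> \<int>\<^sub>\<le>\<^sub>0" "(z + \<nu>) / 2 \<notin> \<int>\<^sub>\<le>\<^sub>0"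
    using assms half[of "z - \<nu>"] half[of "z + \<nu>"] by (auto simp: generic_def add.commute)
  have e: "(z + 2 - \<nu>) / 2 = (z - \<nu>) / 2 + 1" "(z + 2 + \<nu>) / 2 = (z + \<nu>) / 2 + 1" by (simp_all add: field_simps)
  have p: "of_real (b\<^sup>2) * of_real b powr (- (z + 2)) = complex_of_real b powr (- z)"
    using b powr_add[of "of_real b" 2 "- (z + 2)"] by simp
  have q: "(2 :: complex) powr (z + 2 - 2) = 4 * 2 powr (z - 2)"
    using powr_add[of 2 2 "z - 2 :: complex"] by simp
  have "of_real (b\<^sup>2) * K_mellin \<nu> b (z + 2) = (of_real (b\<^sup>2) * of_real b powr (- (z + 2))) * 2 powr (z + 2 - 2) *
      Gamma ((z + 2 - \<nu>) / 2) * Gamma ((z + 2 + \<nu>) / 2)" by (simp only: K_mellin_def mult.assoc)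
  also have "\<dots> = (4 * ((z - \<nu>) / 2) * ((z + \<nu>) / 2)) * K_mellin \<nu> b z"
    unfolding p q unfolding e Gamma_plus1[OF g(1)] Gamma_plus1[OF g(2)] by (simp add: K_mellin_def mult_ac)
  also have "4 * ((z - \<nu>) / 2) * ((z + \<nu>) / 2) = z\<^sup>2 - \<nu>\<^sup>2" by (simp add: power2_eq_square field_simps)
  finally show ?thesis ..
qed

text \<open>The exponent in \<open>K_bessel_uniform_bound\<close> may be any number above |Re
  \<nu>|, in particular one exceeding Re z.\<close>

lemma powr_K_bessel_tendsto_0: "((\<lambda>t. of_real t powr z * K_bessel \<nu> (b * t)) \<longlongrightarrow> 0) at_top"
proof -
  define q where "q = max (Re z) \<bar>Re \<nu>\<bar> + 1"
  obtain C where C: "C \<ge> 0" "\<And>x. x > 0 \<Longrightarrow> norm (K_bessel \<nu> x) \<le> C * x powr (- q)"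
  proof -
    have "\<bar>Re \<nu>\<bar> < q" by (simp add: q_def)
    from K_bessel_uniform_bound[OF abs_ge_zero this] show ?thesis using that by blast
  qed
  have "((\<lambda>t. C * b powr (- q) * t powr (Re z - q)) \<longlongrightarrow> C * b powr (- q) * 0) at_top"
    by (intro tendsto_intros tendsto_neg_powr filterlim_ident) (auto simp: q_def)
  hence lim: "((\<lambda>t. C * b powr (- q) * t powr (Re z - q)) \<longlongrightarrow> 0) at_top" by simp
  show ?thesis
  proof (rule Lim_null_comparison[OF _ lim])
    show "\<forall>\<^sub>F t in at_top. norm (of_real t powr z * K_bessel \<nu> (b * t)) \<le> C * b powr (- q) * t powr (Re z - q)"
      using eventually_gt_at_top[of 0]
    proof eventually_elim
      case (elim t)
      have "norm (of_real t powr z * K_bessel \<nu> (b * t)) \<le> t powr Re z * (C * (b * t) powr (- q))"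
        unfolding norm_mult norm_of_real_powr[OF elim] using elim b by (intro mult_left_mono C) auto
      also have "\<dots> = C * b powr (- q) * t powr (Re z - q)"
        using elim b by (simp add: powr_mult powr_diff powr_minus field_simps)
      finally show ?case .
    qed
  qed
qed

lemma continuous_on_K_integrand:
  assumes "generic z"
  shows "continuous_on {0<..} (\<lambda>t. of_real t powr (z - 1) * K_bessel \<nu> (b * t))"
proof -
  have "continuous_on {0<..} (\<lambda>t. of_real t powr (z - 1) * (K_factor \<nu> *
     (power_series_powr (- \<nu>) 2 (I_coeff (- \<nu>) b) t - power_series_powr \<nu> 2 (I_coeff \<nu> b) t)))"
    by (intro continuous_intros continuous_on_power_series_powr summable_I_coeff) auto
  also have "?this \<longleftrightarrow> ?thesis"
    by (intro continuous_on_cong refl) (use b in \<open>simp add: K_bessel_nonint'[OF nonint] bessel_I_scaled[symmetric]\<close>)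
  finally show ?thesis .
qed

lemma I_prim_tendsto_0:
  assumes "\<rho> + z \<notin> \<int>" "Re (\<rho> + z) > 0"
  shows "(I_prim \<rho> b z \<longlongrightarrow> 0) (at_right 0)"
  unfolding I_prim_def by (rule power_series_powr_tendsto_0[OF summable_I_prim[OF assms(1)] assms(2)]) simp

lemma K_prim_tendsto_0:
  assumes "generic z" "Re z > \<bar>Re \<nu>\<bar>"
  shows "(K_prim \<nu> b z \<longlongrightarrow> 0) (at_right 0)"
proof -
  have "((\<lambda>t. K_factor \<nu> * (I_prim (- \<nu>) b z t - I_prim \<nu> b z t)) \<longlongrightarrow>
     K_factor \<nu> * (0 - 0)) (at_right 0)"
    by (intro tendsto_intros I_prim_tendsto_0) (use assms in \<open>auto simp: generic_def\<close>)
  thus ?thesis by (simp add: K_prim_def[abs_def])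
qed

lemma K_prim_tendsto_mellin_aux:
  assumes "generic z" "Re z > \<bar>Re \<nu>\<bar>"
  shows "(K_prim \<nu> b z \<longlongrightarrow> K_mellin \<nu> b z) at_top"
  using primitive_tendsto_whole_integral[OF K_prim_has_vector_derivative[OF assms(1)] continuous_on_K_integrand[OF assms(1)]
      K_bessel_Mellin_scaled(1)[OF assms(2) b] K_prim_tendsto_0[OF assms]] K_bessel_Mellin_scaled(2)[OF assms(2) b]
  by simp

text \<open>
  For large \<open>Re z\<close> all other terms of the recursion have known limits, so no bound on the derivative
  of \<open>K\<close> is needed. The same recursion then carries the limit of the primitive down to all generic \<open>z\<close>.
\<close>

lemma powr_K_euler_tendsto_0:
  assumes "generic z"
  shows "((\<lambda>t. of_real t powr z * K_euler \<nu> b t) \<longlongrightarrow> 0) at_top"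
proof -
  obtain m :: nat where m: "\<bar>Re \<nu>\<bar> - Re z < real m" using reals_Archimedean2 by blast
  \<comment> \<open>Shifted into the half-plane where the limits of the primitives at w and w + 2
    are already known.\<close>
  define w where "w = z + of_int (int m)"
  have w: "generic w" "generic (w + 2)" "Re w > \<bar>Re \<nu>\<bar>"
    using assms m generic_add_int[of z "int m"] generic_add_int[of w 2] by (auto simp: w_def)
  have "((\<lambda>t. w * (of_real t powr w * K_bessel \<nu> (b * t)) + of_real (b\<^sup>2) * K_prim \<nu> b (w + 2) t - (w\<^sup>2 - \<nu>\<^sup>2) * K_prim \<nu> b w t)
     \<longlongrightarrow> w * 0 + of_real (b\<^sup>2) * K_mellin \<nu> b (w + 2) - (w\<^sup>2 - \<nu>\<^sup>2) * K_mellin \<nu> b w) at_top"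
    by (intro tendsto_intros powr_K_bessel_tendsto_0 K_prim_tendsto_mellin_aux w) (use w in auto)
  hence "((\<lambda>t. w * (of_real t powr w * K_bessel \<nu> (b * t)) + of_real (b\<^sup>2) * K_prim \<nu> b (w + 2) t - (w\<^sup>2 - \<nu>\<^sup>2) * K_prim \<nu> b w t) \<longlongrightarrow> 0) at_top"
    by (simp add: K_mellin_rec[OF w(1)])
  moreover have "\<forall>\<^sub>F t in at_top. w * (of_real t powr w * K_bessel \<nu> (b * t)) + of_real (b\<^sup>2) * K_prim \<nu> b (w + 2) t - (w\<^sup>2 - \<nu>\<^sup>2) * K_prim \<nu> b w t
     = of_real t powr w * K_euler \<nu> b t"
    using eventually_gt_at_top[of 0]
  proof eventually_elim
    case (elim t)
    show ?case unfolding K_prim_rec[OF w(1) elim] by (simp add: mult.assoc)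
  qed
  ultimately have lim: "((\<lambda>t. of_real t powr w * K_euler \<nu> b t) \<longlongrightarrow> 0) at_top" by (rule Lim_transform_eventually)
  \<comment> \<open>For t >= 1, going back from w to z only decreases the modulus.\<close>
  show ?thesis
  proof (rule Lim_null_comparison[OF _ tendsto_norm_zero[OF lim]])
    show "\<forall>\<^sub>F t in at_top. norm (of_real t powr z * K_euler \<nu> b t) \<le> norm (of_real t powr w * K_euler \<nu> b t)"
      using eventually_ge_at_top[of 1]
    proof eventually_elim
      case (elim t)
      have "t powr Re z \<le> t powr Re w" using elim by (intro powr_mono) (auto simp: w_def)
      thus ?case using elim by (simp add: norm_mult norm_of_real_powr mult_right_mono)
    qed
  qed
qed

lemma K_prim_tendsto_mellin:
  assumes "generic z"
  shows "(K_prim \<nu> b z \<longlongrightarrow> K_mellin \<nu> b z) at_top"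
proof -
  have "(K_prim \<nu> b z \<longlongrightarrow> K_mellin \<nu> b z) at_top" if "generic z" "Re z > \<bar>Re \<nu>\<bar> - 2 * real n" for n z
    using that
  proof (induction n arbitrary: z)
    case 0
    thus ?case by (intro K_prim_tendsto_mellin_aux) auto
  next
    case (Suc n)
    have g2: "generic (z + 2)" using generic_add_int[of z 2] Suc.prems by simp
    have nz: "z\<^sup>2 - \<nu>\<^sup>2 \<noteq> 0"
    proof -
      have "z\<^sup>2 - \<nu>\<^sup>2 = (- \<nu> + z) * (\<nu> + z)" by (simp add: power2_eq_square algebra_simps)
      moreover have "- \<nu> + z \<noteq> 0" "\<nu> + z \<noteq> 0" using Suc.prems unfolding generic_def by (metis Ints_0)+
      ultimately show ?thesis by simp
    qed
    have "((\<lambda>t. (z * (of_real t powr z * K_bessel \<nu> (b * t)) - of_real t powr z * K_euler \<nu> b t + of_real (b\<^sup>2) * K_prim \<nu> b (z + 2) t) / (z\<^sup>2 - \<nu>\<^sup>2))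
      \<longlongrightarrow> (z * 0 - 0 + of_real (b\<^sup>2) * K_mellin \<nu> b (z + 2)) / (z\<^sup>2 - \<nu>\<^sup>2)) at_top"
      by (intro tendsto_intros powr_K_bessel_tendsto_0 powr_K_euler_tendsto_0 Suc g2 nz) (use Suc.prems in auto)
    moreover have "(z * 0 - 0 + of_real (b\<^sup>2) * K_mellin \<nu> b (z + 2)) / (z\<^sup>2 - \<nu>\<^sup>2) = K_mellin \<nu> b z"
      using K_mellin_rec[OF Suc.prems(1)] nz by (simp add: field_simps)
    moreover have "\<forall>\<^sub>F t in at_top. (z * (of_real t powr z * K_bessel \<nu> (b * t)) - of_real t powr z * K_euler \<nu> b t + of_real (b\<^sup>2) * K_prim \<nu> b (z + 2) t) / (z\<^sup>2 - \<nu>\<^sup>2)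
       = K_prim \<nu> b z t"
      using eventually_gt_at_top[of 0]
    proof eventually_elim
      case (elim t)
      show ?case using K_prim_rec[OF Suc.prems(1) elim] nz by (simp add: divide_eq_eq mult_ac)
    qed
    ultimately show ?case by (auto intro: Lim_transform_eventually)
  qed
  moreover obtain n :: nat where "\<bar>Re \<nu>\<bar> - Re z < real n" using reals_Archimedean2 by blast
  hence "Re z > \<bar>Re \<nu>\<bar> - 2 * real n" by simp
  ultimately show ?thesis using assms by blast
qed

lemma K_integrable_unit:
  "Re z > \<bar>Re \<nu>\<bar> \<Longrightarrow> set_integrable lborel {0<..<1} (\<lambda>t. of_real t powr (z - 1) * K_bessel \<nu> (b * t))"
  by (rule set_integrable_subset[OF K_bessel_Mellin_scaled(1)[OF _ b]]) auto

lemma K_integral_unit: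
  assumes "generic z" "Re z > \<bar>Re \<nu>\<bar>"
  shows "(LINT t:{0<..<1}|lborel. of_real t powr (z - 1) * K_bessel \<nu> (b * t)) = K_prim \<nu> b z 1"
  using set_integral_unit_FTC[OF K_prim_has_vector_derivative[OF assms(1)] continuous_on_K_integrand[OF assms(1)]
    K_integrable_unit[OF assms(2)] K_prim_tendsto_0[OF assms]] by simp

lemma K_integrable_Ioi: "set_integrable lborel {1<..} (\<lambda>t. of_real t powr (z - 1) * K_bessel \<nu> (b * t))"
proof -
  define w where "w = complex_of_real (max (Re z) (\<bar>Re \<nu>\<bar> + 1))"
  have "set_integrable lborel {1<..} (\<lambda>t. of_real t powr (w - 1) * K_bessel \<nu> (b * t))"
    by (rule set_integrable_subset[OF K_bessel_Mellin_scaled(1)[OF _ b]]) (auto simp: w_def)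
  thus ?thesis
    by (rule set_integrable_dominated) (auto simp: norm_mult norm_of_real_powr w_def intro!: mult_right_mono powr_mono)
qed

text \<open>Re z is unrestricted: away from 0 the integrand is always integrable, and only the two
  values on the right are continuations.\<close>

lemma K_integral_Ioi:
  assumes "generic z"
  shows "(LINT t:{1<..}|lborel. of_real t powr (z - 1) * K_bessel \<nu> (b * t)) = K_mellin \<nu> b z - K_prim \<nu> b z 1"
  using tendsto_unique[OF _ primitive_tendsto_at_top[OF K_prim_has_vector_derivative[OF assms] continuous_on_K_integrand[OF assms] K_integrable_Ioi]
     K_prim_tendsto_mellin[OF assms]] by (simp add: algebra_simps)

end

section \<open>The integral of a difference quotient against \<open>K\<close>\<close>

text \<open>The exponents carry a minus sign so that \<open>m1\<close> and \<open>m2\<close> are the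
  Lommel indices. Division by 0 gives the value 0 at the removable singularity t = 1, where the
  bounds below therefore hold trivially.\<close>

definition diff_kernel :: "complex \<Rightarrow> complex \<Rightarrow> real \<Rightarrow> complex" where
  "diff_kernel m1 m2 t = (of_real t powr (- m1) - of_real t powr (- m2)) / of_real (1 - t\<^sup>2)"

lemma diff_kernel_measurable [measurable]: "diff_kernel m1 m2 \<in> borel_measurable borel"
  unfolding diff_kernel_def by measurable

lemma powr_between_le:
  fixes t :: real
  assumes "t > 0" "min p q \<le> x" "x \<le> max p q"
  shows "t powr x \<le> t powr p + t powr q"
proof (cases "t \<ge> 1")
  case True
  hence "t powr x \<le> t powr max p q" using assms by (intro powr_mono) auto
  also have "\<dots> \<le> t powr p + t powr q" by (auto simp: max_def)
  finally show ?thesis .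
next
  case False
  hence "t powr x \<le> t powr min p q" using assms by (intro powr_mono') auto
  also have "\<dots> \<le> t powr p + t powr q" by (auto simp: min_def)
  finally show ?thesis .
qed

text \<open>The mean value inequality for w to t^w on the vertical strip between Re a and Re b. The
  strip is convex, and on it the modulus of t^w is at most the sum of its values on the two
  edges.\<close>

lemma norm_powr_diff_le:
  assumes t: "t > 0"
  shows "norm (complex_of_real t powr a - of_real t powr b) \<le> \<bar>ln t\<bar> * (t powr Re a + t powr Re b) * norm (a - b)"
proof -
  define S where "S = {z. Re z \<ge> min (Re a) (Re b)} \<inter> {z. Re z \<le> max (Re a) (Re b)}"
  have cv: "convex S" unfolding S_def by (intro convex_Int convex_halfspace_Re_ge convex_halfspace_Re_le)
  have "norm (exp (a * of_real (ln t)) - exp (b * of_real (ln t))) \<le> (\<bar>ln t\<bar> * (t powr Re a + t powr Re b)) * norm (a - b)"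
  proof (rule field_differentiable_bound[OF cv, where f' = "\<lambda>z. exp (z * of_real (ln t)) * of_real (ln t)"])
    fix z assume z: "z \<in> S"
    show "((\<lambda>z. exp (z * of_real (ln t))) has_field_derivative exp (z * of_real (ln t)) * of_real (ln t)) (at z within S)"
      by (auto intro!: derivative_eq_intros)
    have "norm (exp (z * of_real (ln t))) = t powr Re z" using t by (simp add: powr_def)
    also have "\<dots> \<le> t powr Re a + t powr Re b" using z by (intro powr_between_le t) (auto simp: S_def)
    finally have "\<bar>ln t\<bar> * norm (exp (z * of_real (ln t))) \<le> \<bar>ln t\<bar> * (t powr Re a + t powr Re b)"
      by (intro mult_left_mono) auto
    thus "norm (exp (z * of_real (ln t)) * of_real (ln t)) \<le> \<bar>ln t\<bar> * (t powr Re a + t powr Re b)"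
      by (simp add: norm_mult mult.commute)
  qed (auto simp: S_def)
  thus ?thesis by (simp add: of_real_powr_exp[OF t])
qed

text \<open>Both sides vanish to first order at t = 1, so the logarithm of
  \<open>norm_powr_diff_le\<close> cancels the zero of 1 - t^2. The power t powr (-\<delta>) pays
  for the logarithm at 0; it arises by applying ln u <= u - 1 to u = t powr (-\<delta>).\<close>

lemma abs_ln_le:
  fixes t \<delta> :: real
  assumes t: "t > 0" and \<delta>: "0 < \<delta>" "\<delta> \<le> 1"
  shows "\<bar>ln t\<bar> \<le> 1 / \<delta> * (t powr (- \<delta>) + 1) * \<bar>1 - t\<^sup>2\<bar>"
proof (cases "t \<ge> 1")
  case True
  have "ln t \<le> t - 1" using t by (rule ln_le_minus_one)
  also have "t - 1 \<le> (t - 1) * (t + 1)" using True mult_left_mono[of 1 "t + 1" "t - 1"] by simp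
  also have "\<dots> = t\<^sup>2 - 1" by (simp add: power2_eq_square algebra_simps)
  also have "1 * (t\<^sup>2 - 1) \<le> (1 / \<delta> * (t powr (- \<delta>) + 1)) * (t\<^sup>2 - 1)"
  proof (rule mult_right_mono)
    have "1 * 1 \<le> 1 / \<delta> * (t powr (- \<delta>) + 1)" using \<delta> by (intro mult_mono) auto
    thus "1 \<le> 1 / \<delta> * (t powr (- \<delta>) + 1)" by simp
    show "0 \<le> t\<^sup>2 - 1" using True by simp
  qed
  finally show ?thesis using True by simp
next
  case False
  have "- ln t = 1 / \<delta> * ln (t powr (- \<delta>))" using t \<delta> by (simp add: ln_powr)
  also have "\<dots> \<le> 1 / \<delta> * (t powr (- \<delta>) - 1)" using t \<delta> by (intro mult_left_mono ln_le_minus_one) auto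
  also have "t powr (- \<delta>) - 1 = t powr (- \<delta>) * (1 - t powr \<delta>)" using t by (simp add: powr_minus field_simps)
  also have "1 / \<delta> * (t powr (- \<delta>) * (1 - t powr \<delta>)) \<le> 1 / \<delta> * ((t powr (- \<delta>) + 1) * (1 - t\<^sup>2))"
  proof (intro mult_left_mono mult_mono)
    have "t powr 1 \<le> t powr \<delta>" using False t \<delta> by (intro powr_mono') auto
    moreover have "t\<^sup>2 \<le> t * 1" unfolding power2_eq_square using False t by (intro mult_left_mono) auto
    ultimately show "1 - t powr \<delta> \<le> 1 - t\<^sup>2" using t by simp
    show "0 \<le> 1 - t powr \<delta>" using False t \<delta> powr_le1[of \<delta> t] by simp
  qed (use \<delta> in auto)
  finally show ?thesis using False t power_le_one[of t 2] by simp
qed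

lemma norm_diff_kernel_le:
  assumes t: "t > 0" and \<delta>: "0 < \<delta>" "\<delta> \<le> 1"
  shows "norm (diff_kernel m1 m2 t) \<le> norm (m1 - m2) / \<delta> * (t powr (- Re m1) + t powr (- Re m2)) * (t powr (- \<delta>) + 1)"
proof (cases "t = 1")
  case True
  thus ?thesis using \<delta> by (simp add: diff_kernel_def)
next
  case False
  have "\<bar>1 - t\<^sup>2\<bar> > 0" using t False by (auto simp: power2_eq_1_iff)
  have "norm (complex_of_real t powr (- m1) - of_real t powr (- m2)) \<le> \<bar>ln t\<bar> * (t powr Re (- m1) + t powr Re (- m2)) * norm (- m1 - - m2)"
    by (rule norm_powr_diff_le[OF t])
  also have "\<dots> \<le> (1 / \<delta> * (t powr (- \<delta>) + 1) * \<bar>1 - t\<^sup>2\<bar>) * (t powr Re (- m1) + t powr Re (- m2)) * norm (- m1 - - m2)"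
    by (intro mult_right_mono abs_ln_le t \<delta>) auto
  also have "norm (- m1 - - m2) = norm (m1 - m2)" by (simp add: norm_minus_commute)
  finally have "norm (complex_of_real t powr (- m1) - of_real t powr (- m2)) \<le>
      (norm (m1 - m2) / \<delta> * (t powr (- Re m1) + t powr (- Re m2)) * (t powr (- \<delta>) + 1)) * \<bar>1 - t\<^sup>2\<bar>"
    by (simp add: mult_ac)
  moreover have "norm (complex_of_real (1 - t\<^sup>2)) = \<bar>1 - t\<^sup>2\<bar>" by (rule norm_of_real)
  ultimately show ?thesis using \<open>\<bar>1 - t\<^sup>2\<bar> > 0\<close> unfolding diff_kernel_def norm_divide by (simp only: pos_divide_le_eq)
qed

section \<open>Integrable majorants and continuity in the order and both indices\<close>

definition majorant :: "real \<Rightarrow> real \<Rightarrow> real" where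
  "majorant e t = (if t \<le> 1 then t powr (e - 1) else t powr (- 2))"

lemma majorant_nonneg: "majorant e t \<ge> 0"
  by (simp add: majorant_def)

lemma majorant_integrable:
  assumes e: "e > 0"
  shows "set_integrable lborel {0<..} (majorant e)"
proof -
  have "set_integrable lborel (einterval (ereal 0) (ereal 1)) (\<lambda>t. t powr (e - 1))"
  proof (rule interval_integral_FTC_nonneg(1)[where F = "\<lambda>t. t powr e / e" and A = 0 and B = "1 / e"])
    fix x :: real assume x: "ereal 0 < ereal x"
    thus "((\<lambda>t. t powr e / e) has_real_derivative x powr (e - 1)) (at x)"
      using e by (auto intro!: derivative_eq_intros)
    show "isCont (\<lambda>t. t powr (e - 1)) x" using x by (auto intro!: continuous_intros)
  next
    have "((\<lambda>t. t powr e / e) \<longlongrightarrow> 0) (at_right 0)" using e by real_asymp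
    thus "(((\<lambda>t. t powr e / e) \<circ> real_of_ereal) \<longlongrightarrow> 0) (at_right (ereal 0))" by (simp only: ereal_tendsto_simps)
    have "((\<lambda>t. t powr e / e) \<longlongrightarrow> 1 powr e / e) (at_left 1)" using e by (intro tendsto_intros) auto
    thus "(((\<lambda>t. t powr e / e) \<circ> real_of_ereal) \<longlongrightarrow> 1 / e) (at_left (ereal 1))" by (simp only: ereal_tendsto_simps powr_one_eq_one)
  qed auto
  also have "einterval (ereal 0) (ereal 1) = {0<..<1}" by (auto simp: einterval_def)
  finally have "set_integrable lborel {0<..<1} (\<lambda>t. t powr (e - 1))" .
  also have "?this \<longleftrightarrow> set_integrable lborel {0<..<1} (majorant e)"
    by (rule set_integrable_cong) (auto simp: majorant_def)
  finally have 1: "set_integrable lborel {0<..<1} (majorant e)" .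
  have "set_integrable lborel (einterval (ereal 1) \<infinity>) (\<lambda>t. t powr (- 2))"
  proof (rule interval_integral_FTC_nonneg(1)[where F = "\<lambda>t. - inverse t" and A = "- 1" and B = 0])
    fix x :: real assume x: "ereal 1 < ereal x"
    thus "((\<lambda>t. - inverse t) has_real_derivative x powr (- 2)) (at x)"
      by (auto intro!: derivative_eq_intros simp: powr_minus power2_eq_square field_simps)
    show "isCont (\<lambda>t. t powr (- 2)) x" using x by (auto intro!: continuous_intros)
  next
    have "((\<lambda>t :: real. - inverse t) \<longlongrightarrow> - inverse 1) (at_right 1)" by (intro tendsto_intros) auto
    thus "(((\<lambda>t. - inverse t) \<circ> real_of_ereal) \<longlongrightarrow> - 1) (at_right (ereal 1))" by (simp only: ereal_tendsto_simps inverse_1)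
    have "((\<lambda>t :: real. - inverse t) \<longlongrightarrow> 0) at_top" by real_asymp
    thus "(((\<lambda>t. - inverse t) \<circ> real_of_ereal) \<longlongrightarrow> 0) (at_left \<infinity>)" by (simp only: ereal_tendsto_simps)
  qed auto
  also have "einterval (ereal 1) \<infinity> = {1<..}" by (auto simp: einterval_def)
  finally have "set_integrable lborel {1<..} (\<lambda>t. t powr (- 2) :: real)" .
  also have "?this \<longleftrightarrow> set_integrable lborel {1<..} (majorant e)"
    by (rule set_integrable_cong) (auto simp: majorant_def)
  finally have 2: "set_integrable lborel {1<..} (majorant e)" .
  have 3: "set_integrable lborel {1} (majorant e)"
    unfolding set_integrable_def
    by (rule integrable_cong_AE[THEN iffD2, of _ _ "\<lambda>_. 0"])
       (use AE_lborel_singleton[of 1] in \<open>auto simp: majorant_def[abs_def]\<close>)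
  have "set_integrable lborel ({0<..<1} \<union> ({1} \<union> {1<..})) (majorant e)"
    by (intro set_integrable_Un 1 2 3) auto
  also have "{0<..<1} \<union> ({1} \<union> {1<..}) = {0::real<..}" by auto
  finally show ?thesis .
qed

text \<open>Two bounds on K are used: the power -(r + \<eta>) for t <= 1 and -(L + 2 + r) for t > 1,
  the latter beating t^L by more than t^2. Near 0 the margin 3 \<eta> is spent once on the logarithm
  and once on the bound for K; the third \<eta> makes the majorant integrable.\<close>

lemma diff_kernel_K_bound:
  assumes b: "b > 0" and r: "r \<ge> 0" and \<eta>: "0 < \<eta>" "\<eta> \<le> 1" and L: "L \<ge> 0"
  shows "\<exists>C\<ge>0. \<forall>\<nu> m1 m2 t. \<bar>Re \<nu>\<bar> \<le> r \<longrightarrow> norm m1 \<le> L \<longrightarrow> norm m2 \<le> L \<longrightarrow>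
     Re m1 \<le> 1 - r - 3 * \<eta> \<longrightarrow> Re m2 \<le> 1 - r - 3 * \<eta> \<longrightarrow> t > 0 \<longrightarrow>
     norm (diff_kernel m1 m2 t * K_bessel \<nu> (b * t)) \<le> C * majorant \<eta> t"
proof -
  obtain C1 where C1: "C1 \<ge> 0" "\<And>\<nu> x. \<bar>Re \<nu>\<bar> \<le> r \<Longrightarrow> x > 0 \<Longrightarrow> norm (K_bessel \<nu> x) \<le> C1 * x powr (- (r + \<eta>))"
    using K_bessel_uniform_bound[of r "r + \<eta>"] r \<eta> by fastforce
  obtain C2 where C2: "C2 \<ge> 0" "\<And>\<nu> x. \<bar>Re \<nu>\<bar> \<le> r \<Longrightarrow> x > 0 \<Longrightarrow> norm (K_bessel \<nu> x) \<le> C2 * x powr (- (L + 2 + r))"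
    using K_bessel_uniform_bound[of r "L + 2 + r"] r L by fastforce
  define B1 where "B1 = 2 * L / \<eta> * 4 * (C1 * b powr (- (r + \<eta>)))"
  define B2 where "B2 = 2 * L / \<eta> * 4 * (C2 * b powr (- (L + 2 + r)))"
  have B: "B1 \<ge> 0" "B2 \<ge> 0" using L \<eta> C1(1) C2(1) by (simp_all add: B1_def B2_def)
  have "norm (diff_kernel m1 m2 t * K_bessel \<nu> (b * t)) \<le> max B1 B2 * majorant \<eta> t"
    if \<nu>: "\<bar>Re \<nu>\<bar> \<le> r" and m: "norm m1 \<le> L" "norm m2 \<le> L" "Re m1 \<le> 1 - r - 3 * \<eta>" "Re m2 \<le> 1 - r - 3 * \<eta>" and t: "t > 0"
    for \<nu> m1 m2 t
  proof -
    have L2: "norm (m1 - m2) / \<eta> \<le> 2 * L / \<eta>"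
      using m(1,2) norm_triangle_ineq4[of m1 m2] \<eta> by (intro divide_right_mono) auto
    have dk: "norm (diff_kernel m1 m2 t) \<le> norm (m1 - m2) / \<eta> * (t powr (- Re m1) + t powr (- Re m2)) * (t powr (- \<eta>) + 1)"
      by (rule norm_diff_kernel_le[OF t \<eta>])
    show ?thesis
    proof (cases "t \<le> 1")
      case True
      have "t powr (- Re m1) \<le> t powr (r + 3 * \<eta> - 1)" "t powr (- Re m2) \<le> t powr (r + 3 * \<eta> - 1)"
        using True t m by (auto intro!: powr_mono')
      moreover have "1 \<le> t powr (- \<eta>)" using powr_mono'[of "- \<eta>" 0 t] True t \<eta> by simp
      ultimately have "norm (m1 - m2) / \<eta> * (t powr (- Re m1) + t powr (- Re m2)) * (t powr (- \<eta>) + 1) \<le>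
         2 * L / \<eta> * (2 * t powr (r + 3 * \<eta> - 1)) * (2 * t powr (- \<eta>))"
        using L2 L \<eta> by (intro mult_mono) auto
      with dk have dk': "norm (diff_kernel m1 m2 t) \<le> 2 * L / \<eta> * (2 * t powr (r + 3 * \<eta> - 1)) * (2 * t powr (- \<eta>))" by simp
      have "norm (diff_kernel m1 m2 t * K_bessel \<nu> (b * t)) \<le>
         (2 * L / \<eta> * (2 * t powr (r + 3 * \<eta> - 1)) * (2 * t powr (- \<eta>))) * (C1 * (b * t) powr (- (r + \<eta>)))"
        unfolding norm_mult using b t by (intro mult_mono dk' C1 \<nu>) (use L \<eta> in auto)
      also have "\<dots> = B1 * (t powr (r + 3 * \<eta> - 1) * t powr (- \<eta>) * t powr (- (r + \<eta>)))"
        using b t by (simp add: B1_def powr_mult mult_ac)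
      also have "t powr (r + 3 * \<eta> - 1) * t powr (- \<eta>) * t powr (- (r + \<eta>)) = majorant \<eta> t"
        using True by (simp add: majorant_def powr_add[symmetric])
      also have "B1 * majorant \<eta> t \<le> max B1 B2 * majorant \<eta> t" by (intro mult_right_mono majorant_nonneg) auto
      finally show ?thesis .
    next
      case False
      have "- Re m1 \<le> L" "- Re m2 \<le> L" using m(1,2) abs_Re_le_cmod[of m1] abs_Re_le_cmod[of m2] by linarith+
      hence "t powr (- Re m1) \<le> t powr L" "t powr (- Re m2) \<le> t powr L" using False by (auto intro!: powr_mono)
      moreover have "t powr (- \<eta>) \<le> 1" using powr_mono[of "- \<eta>" 0 t] False \<eta> by simp
      ultimately have "norm (m1 - m2) / \<eta> * (t powr (- Re m1) + t powr (- Re m2)) * (t powr (- \<eta>) + 1) \<le>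
         2 * L / \<eta> * (2 * t powr L) * 2"
        using L2 L \<eta> by (intro mult_mono) auto
      with dk have dk': "norm (diff_kernel m1 m2 t) \<le> 2 * L / \<eta> * (2 * t powr L) * 2" by simp
      have "norm (diff_kernel m1 m2 t * K_bessel \<nu> (b * t)) \<le> (2 * L / \<eta> * (2 * t powr L) * 2) * (C2 * (b * t) powr (- (L + 2 + r)))"
        unfolding norm_mult using b t by (intro mult_mono dk' C2 \<nu>) (use L \<eta> in auto)
      also have "\<dots> = B2 * (t powr L * t powr (- (L + 2 + r)))"
        using b t by (simp add: B2_def powr_mult mult_ac)
      also have "t powr L * t powr (- (L + 2 + r)) = t powr (- 2 - r)" by (simp add: powr_add[symmetric])
      also have "B2 * t powr (- 2 - r) \<le> max B1 B2 * majorant \<eta> t"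
        using False r B by (intro mult_mono) (auto simp: majorant_def intro!: powr_mono)
      finally show ?thesis .
    qed
  qed
  thus ?thesis using B by (intro exI[of _ "max B1 B2"]) auto
qed

definition diff_integral :: "complex \<Rightarrow> real \<Rightarrow> complex \<Rightarrow> complex \<Rightarrow> complex" where
  "diff_integral \<nu> b m1 m2 = (LINT t:{0<..}|lborel. diff_kernel m1 m2 t * K_bessel \<nu> (b * t))"

lemma
  assumes b: "b > 0" and m1: "Re m1 < 1 - \<bar>Re \<nu>\<bar>" and m2: "Re m2 < 1 - \<bar>Re \<nu>\<bar>"
  shows diff_integrable: "set_integrable lborel {0<..} (\<lambda>t. diff_kernel m1 m2 t * K_bessel \<nu> (b * t))"
    and diff_integral_LIMSEQ: "X \<longlonglongrightarrow> \<nu> \<Longrightarrow> M1 \<longlonglongrightarrow> m1 \<Longrightarrow> M2 \<longlonglongrightarrow> m2 \<Longrightarrow>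
       (\<lambda>n. diff_integral (X n) b (M1 n) (M2 n)) \<longlonglongrightarrow> diff_integral \<nu> b m1 m2"
proof -
  define \<epsilon> where "\<epsilon> = min 1 (min (1 - \<bar>Re \<nu>\<bar> - Re m1) (1 - \<bar>Re \<nu>\<bar> - Re m2))"
  \<comment> \<open>Of the five parts, one lets the order vary (r exceeds |Re \<nu>| by \<eta>),
    three are consumed by \<open>diff_kernel_K_bound\<close>, and one leaves strict room for the
    indices to vary.\<close>
  define \<eta> where "\<eta> = \<epsilon> / 5"
  define r where "r = \<bar>Re \<nu>\<bar> + \<eta>"
  define L where "L = max (norm m1) (norm m2) + 1"
  have \<epsilon>: "\<epsilon> > 0" "\<epsilon> \<le> 1" "Re m1 \<le> 1 - \<bar>Re \<nu>\<bar> - \<epsilon>" "Re m2 \<le> 1 - \<bar>Re \<nu>\<bar> - \<epsilon>" using m1 m2 by (auto simp: \<epsilon>_def)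
  have \<eta>: "\<eta> > 0" "\<eta> \<le> 1" "\<epsilon> = 5 * \<eta>" using \<epsilon> by (auto simp: \<eta>_def)
  have r: "r \<ge> 0" "\<bar>Re \<nu>\<bar> < r" using \<eta> by (auto simp: r_def)
  have L: "L \<ge> 0" "norm m1 < L" "norm m2 < L" using norm_ge_zero[of m1] unfolding L_def by linarith+
  have Lm: "Re m1 < 1 - r - 3 * \<eta>" "Re m2 < 1 - r - 3 * \<eta>" using \<epsilon> \<eta> by (auto simp: r_def)
  obtain C where C: "\<And>\<nu> m1 m2 t. \<bar>Re \<nu>\<bar> \<le> r \<Longrightarrow> norm m1 \<le> L \<Longrightarrow> norm m2 \<le> L \<Longrightarrow>
     Re m1 \<le> 1 - r - 3 * \<eta> \<Longrightarrow> Re m2 \<le> 1 - r - 3 * \<eta> \<Longrightarrow> t > 0 \<Longrightarrow>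
     norm (diff_kernel m1 m2 t * K_bessel \<nu> (b * t)) \<le> C * majorant \<eta> t" "C \<ge> 0"
    using diff_kernel_K_bound[OF b r(1) \<eta>(1,2) L(1)] by blast
  have maj: "set_integrable lborel {0<..} (\<lambda>t. C * majorant \<eta> t)"
    by (intro set_integrable_mult_right majorant_integrable \<eta>)
  show "set_integrable lborel {0<..} (\<lambda>t. diff_kernel m1 m2 t * K_bessel \<nu> (b * t))"
  proof (rule set_integrable_dominated[OF maj])
    show "norm (diff_kernel m1 m2 t * K_bessel \<nu> (b * t)) \<le> norm (C * majorant \<eta> t)" if "t \<in> {0<..}" for t
      using that r L Lm by (intro order_trans[OF C(1)]) auto
  qed measurable
  assume X: "X \<longlonglongrightarrow> \<nu>" and M1: "M1 \<longlonglongrightarrow> m1" and M2: "M2 \<longlonglongrightarrow> m2"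
  have "\<forall>\<^sub>F n in sequentially. \<bar>Re (X n)\<bar> < r \<and> norm (M1 n) < L \<and> norm (M2 n) < L \<and> Re (M1 n) < 1 - r - 3 * \<eta> \<and> Re (M2 n) < 1 - r - 3 * \<eta>"
    by (intro eventually_conj order_tendstoD(2)[OF tendsto_rabs[OF tendsto_Re[OF X]]] order_tendstoD(2)[OF tendsto_norm[OF M1]]
        order_tendstoD(2)[OF tendsto_norm[OF M2]] order_tendstoD(2)[OF tendsto_Re[OF M1]] order_tendstoD(2)[OF tendsto_Re[OF M2]] r L Lm)
  then obtain N where N: "\<And>n. n \<ge> N \<Longrightarrow> \<bar>Re (X n)\<bar> < r \<and> norm (M1 n) < L \<and> norm (M2 n) < L \<and> Re (M1 n) < 1 - r - 3 * \<eta> \<and> Re (M2 n) < 1 - r - 3 * \<eta>"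
    by (auto simp: eventually_sequentially)
  have "(\<lambda>n. diff_integral (X (n + N)) b (M1 (n + N)) (M2 (n + N))) \<longlonglongrightarrow> diff_integral \<nu> b m1 m2"
    unfolding diff_integral_def
  proof (rule set_integral_dominated_LIMSEQ[OF maj])
    fix t :: real assume t: "t \<in> {0<..}"
    show "(\<lambda>n. diff_kernel (M1 (n + N)) (M2 (n + N)) t * K_bessel (X (n + N)) (b * t))
       \<longlonglongrightarrow> diff_kernel m1 m2 t * K_bessel \<nu> (b * t)"
    proof (cases "t = 1")
      case False
      hence "complex_of_real (1 - t\<^sup>2) \<noteq> 0" using t by (auto simp: power2_eq_1_iff simp del: of_real_diff)
      thus ?thesis unfolding diff_kernel_def
        using t b by (intro tendsto_intros tendsto_of_real_powr K_bessel_LIMSEQ LIMSEQ_ignore_initial_segment X M1 M2) auto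
    qed (simp add: diff_kernel_def)
    show "norm (diff_kernel (M1 (n + N)) (M2 (n + N)) t * K_bessel (X (n + N)) (b * t)) \<le> C * majorant \<eta> t" for n
      using C(1)[of "X (n + N)" "M1 (n + N)" "M2 (n + N)" t] N[of "n + N"] t by auto
  qed measurable
  thus "(\<lambda>n. diff_integral (X n) b (M1 n) (M2 n)) \<longlonglongrightarrow> diff_integral \<nu> b m1 m2"
    by (rule LIMSEQ_offset)
qed

section \<open>Expansion of the kernel in a geometric series\<close>

text \<open>A finite geometric sum equals the full one times 1 - h^(2N). This factor lies between 0
  and 1, so the limit integrand is itself the majorant.\<close>

lemma set_integral_geometric_LIMSEQ:
  fixes f :: "real \<Rightarrow> complex"
  assumes f: "set_integrable lborel A f" and A: "A \<in> sets borel"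
    and m [measurable]: "f \<in> borel_measurable borel" "h \<in> borel_measurable borel"
    and h: "\<And>t. t \<in> A \<Longrightarrow> 0 \<le> h t \<and> h t < 1"
  shows "(\<lambda>N. LINT t:A|lborel. of_real (1 - h t ^ (2 * N)) * f t) \<longlonglongrightarrow> (LINT t:A|lborel. f t)"
proof (rule set_integral_dominated_LIMSEQ[OF set_integrable_norm[OF f] A])
  fix t assume t: "t \<in> A"
  have "(\<lambda>N. h t ^ (2 * N)) \<longlonglongrightarrow> 0"
    unfolding power_mult using h[OF t] by (intro LIMSEQ_power_zero) (simp add: abs_square_less_1)
  hence "(\<lambda>N. of_real (1 - h t ^ (2 * N)) * f t) \<longlonglongrightarrow> of_real (1 - 0) * f t" by (intro tendsto_intros)
  thus "(\<lambda>N. of_real (1 - h t ^ (2 * N)) * f t) \<longlonglongrightarrow> f t" by simp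
  fix N :: nat
  have "norm (complex_of_real (1 - h t ^ (2 * N))) \<le> 1"
    unfolding norm_of_real using h[OF t] power_le_one[of "h t" "2 * N"] zero_le_power[of "h t" "2 * N"] by auto
  from mult_right_mono[OF this norm_ge_zero[of "f t"]]
  show "norm (of_real (1 - h t ^ (2 * N)) * f t) \<le> norm (f t)" by (simp only: norm_mult mult_1)
qed measurable

lemma set_integral_sum_distrib:
  fixes f :: "'i \<Rightarrow> real \<Rightarrow> complex"
  assumes "\<And>k. k \<in> I \<Longrightarrow> set_integrable lborel A (f k)"
  shows "(LINT t:A|lborel. \<Sum>k\<in>I. f k t) = (\<Sum>k\<in>I. LINT t:A|lborel. f k t)"
  unfolding set_lebesgue_integral_def scaleR_sum_right
  by (rule Bochner_Integration.integral_sum) (use assms in \<open>simp add: set_integrable_def\<close>)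

context generic_order
begin

text \<open>The finite geometric sum of t^(2k) times t^(-m) consists of the powers t^(z-1) with z =
  -m + 2k + 1, each integrated by \<open>K_integral_unit\<close>. Only the difference of the two
  indices has an integrable limit at t = 1.\<close>

lemma unit_partial_sums:
  assumes g: "generic (- m1)" "generic (- m2)" and m: "Re m1 < 1 - \<bar>Re \<nu>\<bar>" "Re m2 < 1 - \<bar>Re \<nu>\<bar>"
  shows "(\<lambda>N. \<Sum>k<N. K_prim \<nu> b (- m1 + of_nat (2*k+1)) 1 - K_prim \<nu> b (- m2 + of_nat (2*k+1)) 1) \<longlonglongrightarrow>
      (LINT t:{0<..<1}|lborel. diff_kernel m1 m2 t * K_bessel \<nu> (b * t))"
proof -
  let ?f = "\<lambda>t. diff_kernel m1 m2 t * K_bessel \<nu> (b * t)"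
  have int: "set_integrable lborel {0<..<1} ?f"
    by (rule set_integrable_subset[OF diff_integrable[OF b m]]) auto
  have gk: "generic (- m1 + of_nat n)" "generic (- m2 + of_nat n)" for n
    using generic_add_int[of "- m1" "int n"] generic_add_int[of "- m2" "int n"] g by simp_all
  have rk: "Re (- m1 + of_nat (2*k+1)) > \<bar>Re \<nu>\<bar>" "Re (- m2 + of_nat (2*k+1)) > \<bar>Re \<nu>\<bar>" for k using m by simp_all
  have eq: "(\<Sum>k<N. K_prim \<nu> b (- m1 + of_nat (2*k+1)) 1 - K_prim \<nu> b (- m2 + of_nat (2*k+1)) 1) =
     (LINT t:{0<..<1}|lborel. of_real (1 - t ^ (2 * N)) * ?f t)" for N
  proof -
    have "(\<Sum>k<N. K_prim \<nu> b (- m1 + of_nat (2*k+1)) 1 - K_prim \<nu> b (- m2 + of_nat (2*k+1)) 1) =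
      (\<Sum>k<N. LINT t:{0<..<1}|lborel. of_real t powr ((- m1 + of_nat (2*k+1)) - 1) * K_bessel \<nu> (b * t) -
         of_real t powr ((- m2 + of_nat (2*k+1)) - 1) * K_bessel \<nu> (b * t))"
      by (intro sum.cong refl) (subst set_integral_diff(2), auto simp only: K_integral_unit[OF gk(1) rk(1)] K_integral_unit[OF gk(2) rk(2)] intro!: K_integrable_unit rk)
    also have "\<dots> = (LINT t:{0<..<1}|lborel. \<Sum>k<N. of_real t powr ((- m1 + of_nat (2*k+1)) - 1) * K_bessel \<nu> (b * t) -
         of_real t powr ((- m2 + of_nat (2*k+1)) - 1) * K_bessel \<nu> (b * t))"
      by (rule set_integral_sum_distrib[symmetric]) (intro set_integral_diff(1) K_integrable_unit rk)
    also have "\<dots> = (LINT t:{0<..<1}|lborel. of_real (1 - t ^ (2 * N)) * ?f t)"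
    proof (rule set_lebesgue_integral_cong)
      show "\<forall>t. t \<in> {0<..<1} \<longrightarrow> (\<Sum>k<N. of_real t powr ((- m1 + of_nat (2*k+1)) - 1) * K_bessel \<nu> (b * t) -
         of_real t powr ((- m2 + of_nat (2*k+1)) - 1) * K_bessel \<nu> (b * t)) = of_real (1 - t ^ (2 * N)) * ?f t"
      proof (intro allI impI)
        fix t :: real assume t: "t \<in> {0<..<1}"
        define T where "T = complex_of_real t"
        have T2: "T\<^sup>2 \<noteq> 1"
        proof
          assume "T\<^sup>2 = 1"
          hence "t\<^sup>2 = 1" unfolding T_def by (metis of_real_eq_1_iff of_real_power)
          thus False using t by (auto simp: power2_eq_1_iff)
        qed
        have p: "T powr ((- m + of_nat (2*k+1)) - 1) = T powr (- m) * (T\<^sup>2) ^ k" for m k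
        proof -
          have "(- m + of_nat (2*k+1)) - 1 = - m + of_nat (2 * k)" by simp
          thus ?thesis using t by (simp only: powr_add) (simp add: T_def powr_nat' power_mult flip: of_nat_mult)
        qed
        have "(\<Sum>k<N. T powr ((- m1 + of_nat (2*k+1)) - 1) * K_bessel \<nu> (b * t) - T powr ((- m2 + of_nat (2*k+1)) - 1) * K_bessel \<nu> (b * t)) =
           (\<Sum>k<N. (T\<^sup>2) ^ k) * ((T powr (- m1) - T powr (- m2)) * K_bessel \<nu> (b * t))"
          unfolding p sum_distrib_right by (intro sum.cong refl) (simp add: algebra_simps)
        also have "(\<Sum>k<N. (T\<^sup>2) ^ k) = (1 - T ^ (2 * N)) / (1 - T\<^sup>2)"
          using T2 by (simp add: sum_gp_strict power_mult)
        finally show "(\<Sum>k<N. of_real t powr ((- m1 + of_nat (2*k+1)) - 1) * K_bessel \<nu> (b * t) -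
           of_real t powr ((- m2 + of_nat (2*k+1)) - 1) * K_bessel \<nu> (b * t)) = of_real (1 - t ^ (2 * N)) * ?f t"
          by (simp add: T_def diff_kernel_def)
      qed
    qed simp
    finally show ?thesis .
  qed
  have "(\<lambda>N. LINT t:{0<..<1}|lborel. of_real (1 - t ^ (2 * N)) * ?f t) \<longlonglongrightarrow> (LINT t:{0<..<1}|lborel. ?f t)"
    by (rule set_integral_geometric_LIMSEQ[OF int]) auto
  thus ?thesis unfolding eq .
qed

text \<open>For t > 1 the factor 1 / (1 - t^2) is minus the geometric series in t^(-2) beginning
  with its first power; hence the overall sign and the arguments -m - (2k + 1). For large k these
  leave the half-plane where the Mellin integral converges.\<close>

lemma Ioi_partial_sums:
  assumes g: "generic (- m1)" "generic (- m2)" and m: "Re m1 < 1 - \<bar>Re \<nu>\<bar>" "Re m2 < 1 - \<bar>Re \<nu>\<bar>"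
  shows "(\<lambda>N. - (\<Sum>k<N. (K_mellin \<nu> b (- m1 - of_nat (2*k+1)) - K_prim \<nu> b (- m1 - of_nat (2*k+1)) 1)
                     - (K_mellin \<nu> b (- m2 - of_nat (2*k+1)) - K_prim \<nu> b (- m2 - of_nat (2*k+1)) 1))) \<longlonglongrightarrow>
      (LINT t:{1<..}|lborel. diff_kernel m1 m2 t * K_bessel \<nu> (b * t))"
proof -
  let ?f = "\<lambda>t. diff_kernel m1 m2 t * K_bessel \<nu> (b * t)"
  have int: "set_integrable lborel {1<..} ?f"
    by (rule set_integrable_subset[OF diff_integrable[OF b m]]) auto
  have gk: "generic (- m1 - of_nat n)" "generic (- m2 - of_nat n)" for n
    using generic_add_int[of "- m1" "- int n"] generic_add_int[of "- m2" "- int n"] g by simp_all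
  have eq: "- (\<Sum>k<N. (K_mellin \<nu> b (- m1 - of_nat (2*k+1)) - K_prim \<nu> b (- m1 - of_nat (2*k+1)) 1)
                     - (K_mellin \<nu> b (- m2 - of_nat (2*k+1)) - K_prim \<nu> b (- m2 - of_nat (2*k+1)) 1)) =
     (LINT t:{1<..}|lborel. of_real (1 - inverse t ^ (2 * N)) * ?f t)" for N
  proof -
    have "(\<Sum>k<N. (K_mellin \<nu> b (- m1 - of_nat (2*k+1)) - K_prim \<nu> b (- m1 - of_nat (2*k+1)) 1)
                     - (K_mellin \<nu> b (- m2 - of_nat (2*k+1)) - K_prim \<nu> b (- m2 - of_nat (2*k+1)) 1)) =
      (\<Sum>k<N. LINT t:{1<..}|lborel. of_real t powr ((- m1 - of_nat (2*k+1)) - 1) * K_bessel \<nu> (b * t) -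
         of_real t powr ((- m2 - of_nat (2*k+1)) - 1) * K_bessel \<nu> (b * t))"
      by (intro sum.cong refl) (subst set_integral_diff(2), auto simp only: K_integral_Ioi[OF gk(1)] K_integral_Ioi[OF gk(2)] intro!: K_integrable_Ioi)
    also have "\<dots> = (LINT t:{1<..}|lborel. \<Sum>k<N. of_real t powr ((- m1 - of_nat (2*k+1)) - 1) * K_bessel \<nu> (b * t) -
         of_real t powr ((- m2 - of_nat (2*k+1)) - 1) * K_bessel \<nu> (b * t))"
      by (rule set_integral_sum_distrib[symmetric]) (intro set_integral_diff(1) K_integrable_Ioi)
    also have "\<dots> = (LINT t:{1<..}|lborel. - (of_real (1 - inverse t ^ (2 * N)) * ?f t))"
    proof (rule set_lebesgue_integral_cong)
      show "\<forall>t. t \<in> {1<..} \<longrightarrow> (\<Sum>k<N. of_real t powr ((- m1 - of_nat (2*k+1)) - 1) * K_bessel \<nu> (b * t) -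
         of_real t powr ((- m2 - of_nat (2*k+1)) - 1) * K_bessel \<nu> (b * t)) = - (of_real (1 - inverse t ^ (2 * N)) * ?f t)"
      proof (intro allI impI)
        fix t :: real assume t: "t \<in> {1<..}"
        define T where "T = complex_of_real t"
        define S where "S = inverse (T\<^sup>2)"
        have T0: "T \<noteq> 0" using t by (simp add: T_def)
        have T2: "T\<^sup>2 \<noteq> 1"
        proof
          assume "T\<^sup>2 = 1"
          hence "t\<^sup>2 = 1" unfolding T_def by (metis of_real_eq_1_iff of_real_power)
          thus False using t by (auto simp: power2_eq_1_iff)
        qed
        have S1: "S \<noteq> 1" using T2 by (simp add: S_def inverse_eq_1_iff)
        have p: "T powr ((- m - of_nat (2*k+1)) - 1) = T powr (- m) * (S * S ^ k)" for m k
        proof -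
          have "(- m - of_nat (2*k+1)) - 1 = - m - of_nat (2 * Suc k)" by simp
          hence "T powr ((- m - of_nat (2*k+1)) - 1) = T powr (- m) / T ^ (2 * Suc k)"
            using T0 by (simp only: powr_diff) (simp add: powr_nat' flip: of_nat_mult of_nat_Suc)
          thus ?thesis by (simp add: S_def power_mult power2_eq_square field_simps)
        qed
        have "(\<Sum>k<N. T powr ((- m1 - of_nat (2*k+1)) - 1) * K_bessel \<nu> (b * t) - T powr ((- m2 - of_nat (2*k+1)) - 1) * K_bessel \<nu> (b * t)) =
           (\<Sum>k<N. S ^ k) * (S * (T powr (- m1) - T powr (- m2)) * K_bessel \<nu> (b * t))"
          unfolding p sum_distrib_right by (intro sum.cong refl) (simp add: algebra_simps)
        also have "(\<Sum>k<N. S ^ k) = (1 - S ^ N) / (1 - S)"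
          using S1 by (simp add: sum_gp_strict)
        also have "(1 - S ^ N) / (1 - S) * (S * (T powr (- m1) - T powr (- m2)) * K_bessel \<nu> (b * t)) =
            - ((1 - S ^ N) * ((T powr (- m1) - T powr (- m2)) / (1 - T\<^sup>2) * K_bessel \<nu> (b * t)))"
        proof -
          have "S / (1 - S) = - (1 / (1 - T\<^sup>2))"
            using T0 T2 by (simp add: S_def field_simps)
          hence "(1 - S ^ N) * (S / (1 - S)) * ((T powr (- m1) - T powr (- m2)) * K_bessel \<nu> (b * t)) =
             (1 - S ^ N) * - (1 / (1 - T\<^sup>2)) * ((T powr (- m1) - T powr (- m2)) * K_bessel \<nu> (b * t))" by simp
          thus ?thesis by (simp add: mult_ac)
        qed
        finally show "(\<Sum>k<N. of_real t powr ((- m1 - of_nat (2*k+1)) - 1) * K_bessel \<nu> (b * t) -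
           of_real t powr ((- m2 - of_nat (2*k+1)) - 1) * K_bessel \<nu> (b * t)) = - (of_real (1 - inverse t ^ (2 * N)) * ?f t)"
          by (simp add: T_def S_def diff_kernel_def power_mult power_inverse)
      qed
    qed simp
    finally show ?thesis by (simp add: set_lebesgue_integral_def)
  qed
  have "(\<lambda>N. LINT t:{1<..}|lborel. of_real (1 - inverse t ^ (2 * N)) * ?f t) \<longlonglongrightarrow> (LINT t:{1<..}|lborel. ?f t)"
    by (rule set_integral_geometric_LIMSEQ[OF int]) (auto simp: inverse_less_1_iff)
  thus ?thesis unfolding eq .
qed

text \<open>Exchanging the sums over k and over the Bessel coefficients leaves
  \<open>odd_pfd\<close> at z + 2n as the factor of the n-th coefficient, where z = \<rho> - m. Its
  limit does not depend on n because the tangent has period pi, so the coefficients resum to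
  I_\<rho>(b). Tannery's theorem applies by the linear bound of
  \<open>odd_pfd_bound\<close>.\<close>

lemma I_prim_partial_sums:
  assumes g: "\<rho> + - m \<notin> \<int>"
  shows "(\<lambda>N. \<Sum>k<N. I_prim \<rho> b (- m + of_nat (2*k+1)) 1 + I_prim \<rho> b (- m - of_nat (2*k+1)) 1) \<longlonglongrightarrow>
     - (of_real pi / 2) * tan (of_real pi * (\<rho> - m) / 2) * bessel_I \<rho> (of_real b)"
proof -
  define z where "z = \<rho> - m"
  have z: "z \<notin> \<int>" using g by (simp add: z_def)
  obtain C where C: "\<And>N n. norm (odd_pfd N (z + of_nat (2*n))) \<le> C * (1 + real n)"
    using odd_pfd_bound[OF z] by blast
  define D where "D = I_coeff \<rho> b"
  have shifted: "\<rho> + (- m + of_int j) \<notin> \<int>" for j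
    using nonint_add_int[of "\<rho> + - m" j] g by (simp only: add.assoc not_False_eq_True)
  have val: "(\<lambda>n. D n / (z + of_nat (2*n) + of_int j)) sums I_prim \<rho> b (- m + of_int j) 1" for j
  proof -
    have "(\<lambda>n. I_coeff \<rho> b n / (\<rho> + (- m + of_int j) + of_nat (2 * n)) * 1 ^ n) sums (\<Sum>n. I_coeff \<rho> b n / (\<rho> + (- m + of_int j) + of_nat (2 * n)) * 1 ^ n)"
      by (rule summable_sums[OF summable_I_prim[OF shifted]])
    thus ?thesis by (simp add: I_prim_def power_series_powr_def D_def z_def algebra_simps)
  qed
  have eq: "(\<Sum>k<N. I_prim \<rho> b (- m + of_nat (2*k+1)) 1 + I_prim \<rho> b (- m - of_nat (2*k+1)) 1) = (\<Sum>n. D n * odd_pfd N (z + of_nat (2*n)))" for N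
  proof -
    have "(\<lambda>n. \<Sum>k<N. D n / (z + of_nat (2*n) + of_int (int (2*k+1))) + D n / (z + of_nat (2*n) + of_int (- int (2*k+1)))) sums
      (\<Sum>k<N. I_prim \<rho> b (- m + of_int (int (2*k+1))) 1 + I_prim \<rho> b (- m + of_int (- int (2*k+1))) 1)"
      by (intro sums_sum sums_add val)
    moreover have "(\<Sum>k<N. D n / (z + of_nat (2*n) + of_int (int (2*k+1))) + D n / (z + of_nat (2*n) + of_int (- int (2*k+1)))) = D n * odd_pfd N (z + of_nat (2*n))" for n
      unfolding odd_pfd_def sum_distrib_left by (intro sum.cong refl) (simp add: distrib_left del: of_nat_Suc)
    ultimately have "(\<lambda>n. D n * odd_pfd N (z + of_nat (2*n))) sums (\<Sum>k<N. I_prim \<rho> b (- m + of_int (int (2*k+1))) 1 + I_prim \<rho> b (- m + of_int (- int (2*k+1))) 1)" by simp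
    from sums_unique[OF this] show ?thesis
      by (simp only: of_int_minus of_int_of_nat_eq add_uminus_conv_diff)
  qed
  have tan: "(\<lambda>N. odd_pfd N (z + of_nat (2*n))) \<longlonglongrightarrow> - (of_real pi / 2) * tan (of_real pi * z / 2)" for n
  proof -
    have "(z + of_nat (2*n) + 1) / 2 \<notin> \<int>"
    proof
      assume "(z + of_nat (2*n) + 1) / 2 \<in> \<int>"
      hence "2 * ((z + of_nat (2*n) + 1) / 2) - of_nat (2*n+1) \<in> \<int>" by (intro Ints_diff Ints_mult) auto
      moreover have "2 * ((z + of_nat (2*n) + 1) / 2) - of_nat (2*n+1) = z" by (simp add: field_simps)
      ultimately show False using z by metis
    qed
    note odd_pfd_tendsto[OF this]
    moreover have "tan (of_real pi * (z + of_nat (2*n)) / 2) = tan (of_real pi * z / 2)"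
    proof -
      have e: "of_real pi * (z + of_nat (2*n)) / 2 = of_real pi * z / 2 + of_real (real n * pi)" by (simp add: field_simps)
      have "sin (complex_of_real (real n * pi)) = 0" "cos (complex_of_real (real n * pi)) = (- 1) ^ n"
        by (simp_all only: sin_of_real cos_of_real) simp_all
      thus ?thesis unfolding e by (simp add: tan_def sin_add cos_add)
    qed
    ultimately show ?thesis by simp
  qed
  have "(\<forall>\<^sub>F N in sequentially. summable (\<lambda>n. norm (D n * odd_pfd N (z + of_nat (2*n))))) \<and>
      summable (\<lambda>n. norm (D n * (- (of_real pi / 2) * tan (of_real pi * z / 2)))) \<and>
      ((\<lambda>N. \<Sum>n. D n * odd_pfd N (z + of_nat (2*n))) \<longlonglongrightarrow> (\<Sum>n. D n * (- (of_real pi / 2) * tan (of_real pi * z / 2))))"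
  proof (rule tannerys_theorem)
    show "(\<lambda>N. D n * odd_pfd N (z + of_nat (2*n))) \<longlonglongrightarrow> D n * (- (of_real pi / 2) * tan (of_real pi * z / 2))" for n
      by (intro tendsto_intros tan)
    show "\<forall>\<^sub>F (n, N) in at_top \<times>\<^sub>F sequentially. norm (D n * odd_pfd N (z + of_nat (2*n))) \<le> C * (norm (I_coeff \<rho> b n * 1 ^ n) * (1 + real n))"
    proof (rule always_eventually, safe)
      fix n N
      have "norm (D n * odd_pfd N (z + of_nat (2*n))) \<le> norm (D n) * (C * (1 + real n))"
        unfolding norm_mult by (intro mult_left_mono C) auto
      thus "norm (D n * odd_pfd N (z + of_nat (2*n))) \<le> C * (norm (I_coeff \<rho> b n * 1 ^ n) * (1 + real n))"
        by (simp add: D_def mult_ac)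
    qed
    show "summable (\<lambda>n. C * (norm (I_coeff \<rho> b n * 1 ^ n) * (1 + real n)))"
      by (intro summable_mult summable_norm_I_coeff_poly)
  qed simp
  hence "(\<lambda>N. \<Sum>n. D n * odd_pfd N (z + of_nat (2*n))) \<longlonglongrightarrow> (\<Sum>n. D n * (- (of_real pi / 2) * tan (of_real pi * z / 2)))" by blast
  also have "(\<Sum>n. D n * (- (of_real pi / 2) * tan (of_real pi * z / 2))) = bessel_I \<rho> (of_real b) * (- (of_real pi / 2) * tan (of_real pi * z / 2))"
  proof -
    have "bessel_I \<rho> (of_real b) = suminf D"
      using bessel_I_scaled[OF b, of 1 \<rho>] by (simp add: power_series_powr_def D_def)
    moreover have "summable D" using summable_I_coeff[of \<rho> b 1] by (simp add: D_def)
    ultimately show ?thesis by (simp only: suminf_mult2)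
  qed
  finally show ?thesis unfolding eq by (simp add: z_def mult_ac)
qed

end

text \<open>Where the cosines do not vanish, this is \<open>lommel_factor \<nu> m\<close> times
  -i^(1-m) s_{m,\<nu>}(i b), the first summand of T, with the Gamma products already reflected into
  cosines.\<close>

definition lommel_sum :: "complex \<Rightarrow> real \<Rightarrow> complex \<Rightarrow> complex" where
  "lommel_sum \<nu> b m = of_real pi ^ 2 / (4 * cos ((m - \<nu>) * of_real pi / 2) * cos ((m + \<nu>) * of_real pi / 2)) *
     (of_real (b / 2) powr (m + 1) * rGamma_series2 ((m - \<nu> + 1) / 2) ((m + \<nu> + 1) / 2) (of_real (b\<^sup>2 / 4)))"

lemma sin_half_shift: "sin (of_real pi * ((w + 1) / 2)) = cos (w * of_real pi / 2 :: complex)"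
proof -
  have "of_real pi * ((w + 1) / 2) = w * of_real pi / 2 + of_real pi / 2" by (simp add: field_simps)
  thus ?thesis by (simp only: sin_add) simp
qed

lemma half_nonint:
  assumes "w \<notin> \<int>"
  shows "(w + 1) / 2 \<notin> (\<int> :: complex set)"
proof
  assume "(w + 1) / 2 \<in> \<int>"
  hence "2 * ((w + 1) / 2) - 1 \<in> \<int>" by (intro Ints_diff Ints_mult) auto
  moreover have "2 * ((w + 1) / 2) - 1 = w" by (simp add: field_simps)
  ultimately show False using assms by metis
qed

context generic_order
begin

text \<open>Reflection turns both Gamma factors into reciprocal ones; the two signs (-1)^k cancel
  and the sines become the cosines of \<open>lommel_sum\<close>. What remains is exactly the series
  \<open>rGamma_series2\<close>.\<close>

lemma K_mellin_partial_sums: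
  assumes g: "generic (- m)"
  shows "(\<lambda>N. \<Sum>k<N. K_mellin \<nu> b (- m - of_nat (2*k+1))) \<longlonglongrightarrow> lommel_sum \<nu> b m"
proof -
  define \<alpha> where "\<alpha> = (m - \<nu> + 1) / 2"
  define \<beta> where "\<beta> = (m + \<nu> + 1) / 2"
  have "- (\<nu> + - m) \<notin> \<int>" "- (- \<nu> + - m) \<notin> \<int>" using g minus_of_nat_nonint(2) unfolding generic_def by blast+
  hence "m - \<nu> \<notin> \<int>" "m + \<nu> \<notin> \<int>" by (simp_all add: add.commute)
  hence "\<alpha> \<notin> \<int>" "\<beta> \<notin> \<int>" unfolding \<alpha>_def \<beta>_def by (auto intro!: half_nonint)
  hence nn: "- \<alpha> \<notin> \<int>" "- \<beta> \<notin> \<int>" using minus_of_nat_nonint(2) by blast+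
  define A where "A = of_real pi ^ 2 / (4 * cos ((m - \<nu>) * of_real pi / 2) * cos ((m + \<nu>) * of_real pi / 2)) * of_real (b / 2) powr (m + 1)"
  have term_eq: "K_mellin \<nu> b (- m - of_nat (2*k+1)) = A * (rGamma (\<alpha> + of_nat k + 1) * rGamma (\<beta> + of_nat k + 1) * of_real (b\<^sup>2 / 4) ^ k)" for k
  proof -
    have e: "(- m - of_nat (2*k+1) - \<nu>) / 2 = - \<beta> - of_nat k" "(- m - of_nat (2*k+1) + \<nu>) / 2 = - \<alpha> - of_nat k"
      "- (- m - of_nat (2*k+1)) = (m + 1) + of_nat (2*k)" "- m - of_nat (2*k+1) - 2 = - (m + 1) - 2 - of_nat (2*k)"
      by (simp_all add: \<alpha>_def \<beta>_def field_simps)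
    have r: "1 - - \<alpha> + of_nat k = \<alpha> + of_nat k + 1" "1 - - \<beta> + of_nat k = \<beta> + of_nat k + 1" by simp_all
    have s: "sin (of_real pi * - \<alpha>) = - cos ((m - \<nu>) * of_real pi / 2)" "sin (of_real pi * - \<beta>) = - cos ((m + \<nu>) * of_real pi / 2)"
      using sin_half_shift[of "m - \<nu>"] sin_half_shift[of "m + \<nu>"] by (simp_all add: \<alpha>_def \<beta>_def)
    have "of_real b powr ((m + 1) + of_nat (2*k)) * 2 powr (- (m + 1) - 2 - of_nat (2*k)) =
        (of_real b powr (m + 1) * 2 powr (- (m + 1))) / 4 * of_real (b\<^sup>2 / 4) ^ k"
      using b by (simp only: powr_add powr_diff) (simp add: powr_nat' power_mult power_divide flip: of_nat_mult)
    also have "of_real b powr (m + 1) * 2 powr (- (m + 1)) = of_real (b / 2) powr (m + 1)"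
    proof -
      have f: "of_real b powr (m + 1) = of_real (b / 2) powr (m + 1) * 2 powr (m + 1)"
        using b powr_times_real[of "of_real (b / 2)" 2 "m + 1"] by simp
      show ?thesis unfolding f powr_minus by simp
    qed
    finally have p: "of_real b powr ((m + 1) + of_nat (2*k)) * 2 powr (- (m + 1) - 2 - of_nat (2*k)) =
        of_real (b / 2) powr (m + 1) / 4 * of_real (b\<^sup>2 / 4) ^ k" .
    have sq: "(- 1) ^ k * (- 1) ^ k = (1 :: complex)" by (simp flip: power_mult_distrib)
    have "K_mellin \<nu> b (- m - of_nat (2*k+1)) = of_real (b / 2) powr (m + 1) / 4 * of_real (b\<^sup>2 / 4) ^ k *
       (((- 1) ^ k * (- 1) ^ k) * (of_real pi / - cos ((m + \<nu>) * of_real pi / 2) * rGamma (\<beta> + of_nat k + 1)) *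
        (of_real pi / - cos ((m - \<nu>) * of_real pi / 2) * rGamma (\<alpha> + of_nat k + 1)))"
      unfolding K_mellin_def e p Gamma_diff_nat_nonint[OF nn(1)] Gamma_diff_nat_nonint[OF nn(2)] r s by (simp only: divide_inverse mult_ac)
    thus ?thesis unfolding sq A_def by (simp add: power2_eq_square mult_ac)
  qed
  have "(\<lambda>k. A * (rGamma (\<alpha> + of_nat k + 1) * rGamma (\<beta> + of_nat k + 1) * of_real (b\<^sup>2 / 4) ^ k)) sums (A * rGamma_series2 \<alpha> \<beta> (of_real (b\<^sup>2 / 4)))"
    unfolding rGamma_series2_def by (rule sums_mult[OF summable_sums[OF summable_norm_cancel[OF summable_norm_rGamma_series2]]])
  thus ?thesis unfolding sums_def term_eq by (simp add: A_def lommel_sum_def \<alpha>_def \<beta>_def mult.assoc)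
qed

definition tan_part :: "complex \<Rightarrow> complex" where
  "tan_part m = K_factor \<nu> * (of_real pi / 2) *
    (tan ((m + \<nu>) * of_real pi / 2) * bessel_I (- \<nu>) (of_real b) - tan ((m - \<nu>) * of_real pi / 2) * bessel_I \<nu> (of_real b))"

lemma K_prim_partial_sums:
  assumes g: "generic (- m)"
  shows "(\<lambda>N. \<Sum>k<N. K_prim \<nu> b (- m + of_nat (2*k+1)) 1 + K_prim \<nu> b (- m - of_nat (2*k+1)) 1) \<longlonglongrightarrow> tan_part m"
proof -
  have g': "\<nu> + - m \<notin> \<int>" "- \<nu> + - m \<notin> \<int>" using g by (auto simp: generic_def)
  have e: "of_real pi * (- \<nu> - m) / 2 = - ((m + \<nu>) * of_real pi / 2)" "of_real pi * (\<nu> - m) / 2 = - ((m - \<nu>) * of_real pi / 2)"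
    by (simp_all add: field_simps)
  have "(\<lambda>N. K_factor \<nu> * ((\<Sum>k<N. I_prim (- \<nu>) b (- m + of_nat (2*k+1)) 1 + I_prim (- \<nu>) b (- m - of_nat (2*k+1)) 1) -
     (\<Sum>k<N. I_prim \<nu> b (- m + of_nat (2*k+1)) 1 + I_prim \<nu> b (- m - of_nat (2*k+1)) 1))) \<longlonglongrightarrow>
     K_factor \<nu> * (- (of_real pi / 2) * tan (of_real pi * (- \<nu> - m) / 2) * bessel_I (- \<nu>) (of_real b)
        - - (of_real pi / 2) * tan (of_real pi * (\<nu> - m) / 2) * bessel_I \<nu> (of_real b))"
    by (intro tendsto_intros I_prim_partial_sums g')
  also have "(\<lambda>N. K_factor \<nu> * ((\<Sum>k<N. I_prim (- \<nu>) b (- m + of_nat (2*k+1)) 1 + I_prim (- \<nu>) b (- m - of_nat (2*k+1)) 1) -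
     (\<Sum>k<N. I_prim \<nu> b (- m + of_nat (2*k+1)) 1 + I_prim \<nu> b (- m - of_nat (2*k+1)) 1))) =
     (\<lambda>N. \<Sum>k<N. K_prim \<nu> b (- m + of_nat (2*k+1)) 1 + K_prim \<nu> b (- m - of_nat (2*k+1)) 1)"
    unfolding sum_subtractf[symmetric] sum_distrib_left K_prim_def
    by (intro ext sum.cong refl) (simp add: algebra_simps)
  also have "K_factor \<nu> * (- (of_real pi / 2) * tan (of_real pi * (- \<nu> - m) / 2) * bessel_I (- \<nu>) (of_real b)
        - - (of_real pi / 2) * tan (of_real pi * (\<nu> - m) / 2) * bessel_I \<nu> (of_real b)) = tan_part m"
    unfolding e tan_minus tan_part_def by (simp add: algebra_simps)
  finally show ?thesis .
qed

text \<open>On each half of the axis the two indices were summed together. After adding the halves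
  the terms regroup by index, because the pairs of \<open>K_prim\<close> values from both sides of 1
  converge for each index alone.\<close>

lemma diff_integral_generic_sums:
  assumes g: "generic (- m1)" "generic (- m2)" and m: "Re m1 < 1 - \<bar>Re \<nu>\<bar>" "Re m2 < 1 - \<bar>Re \<nu>\<bar>"
  shows "diff_integral \<nu> b m1 m2 = (tan_part m1 - lommel_sum \<nu> b m1) - (tan_part m2 - lommel_sum \<nu> b m2)"
proof -
  have "(\<lambda>N. (\<Sum>k<N. K_prim \<nu> b (- m1 + of_nat (2*k+1)) 1 - K_prim \<nu> b (- m2 + of_nat (2*k+1)) 1) +
     - (\<Sum>k<N. (K_mellin \<nu> b (- m1 - of_nat (2*k+1)) - K_prim \<nu> b (- m1 - of_nat (2*k+1)) 1)
             - (K_mellin \<nu> b (- m2 - of_nat (2*k+1)) - K_prim \<nu> b (- m2 - of_nat (2*k+1)) 1)))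
     \<longlonglongrightarrow> diff_integral \<nu> b m1 m2"
    unfolding diff_integral_def set_integral_split_at_1(3)[OF diff_integrable[OF b m]]
    by (intro tendsto_add unit_partial_sums Ioi_partial_sums g m)
  moreover have "(\<lambda>N. ((\<Sum>k<N. K_prim \<nu> b (- m1 + of_nat (2*k+1)) 1 + K_prim \<nu> b (- m1 - of_nat (2*k+1)) 1) -
        (\<Sum>k<N. K_mellin \<nu> b (- m1 - of_nat (2*k+1)))) -
      ((\<Sum>k<N. K_prim \<nu> b (- m2 + of_nat (2*k+1)) 1 + K_prim \<nu> b (- m2 - of_nat (2*k+1)) 1) -
        (\<Sum>k<N. K_mellin \<nu> b (- m2 - of_nat (2*k+1)))))
     \<longlonglongrightarrow> (tan_part m1 - lommel_sum \<nu> b m1) - (tan_part m2 - lommel_sum \<nu> b m2)"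
    by (intro tendsto_diff K_prim_partial_sums K_mellin_partial_sums g)
  moreover have "(\<Sum>k<N. K_prim \<nu> b (- m1 + of_nat (2*k+1)) 1 - K_prim \<nu> b (- m2 + of_nat (2*k+1)) 1) +
     - (\<Sum>k<N. (K_mellin \<nu> b (- m1 - of_nat (2*k+1)) - K_prim \<nu> b (- m1 - of_nat (2*k+1)) 1)
             - (K_mellin \<nu> b (- m2 - of_nat (2*k+1)) - K_prim \<nu> b (- m2 - of_nat (2*k+1)) 1)) =
     ((\<Sum>k<N. K_prim \<nu> b (- m1 + of_nat (2*k+1)) 1 + K_prim \<nu> b (- m1 - of_nat (2*k+1)) 1) -
        (\<Sum>k<N. K_mellin \<nu> b (- m1 - of_nat (2*k+1)))) -
      ((\<Sum>k<N. K_prim \<nu> b (- m2 + of_nat (2*k+1)) 1 + K_prim \<nu> b (- m2 - of_nat (2*k+1)) 1) -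
        (\<Sum>k<N. K_mellin \<nu> b (- m2 - of_nat (2*k+1))))" for N
    by (simp add: sum_subtractf sum.distrib)
  ultimately show ?thesis by (simp only: LIMSEQ_unique)
qed

end

text \<open>
  The candidate for \<open>2\<^bsup>-\<mu>-1\<^esup> \<Gamma>((1-\<mu>+\<nu>)/2) \<Gamma>((1-\<mu>-\<nu>)/2) T\<^bsub>\<mu>,\<nu>\<^esub>(b)\<close>, in a form that makes sense for all
  \<open>\<nu>\<close>, integers included.
\<close>

definition lommel_closed :: "complex \<Rightarrow> real \<Rightarrow> complex \<Rightarrow> complex" where
  "lommel_closed \<nu> b m = lommel_sum \<nu> b m
     - of_real pi ^ 2 / (4 * cos ((m - \<nu>) * of_real pi / 2) * cos ((m + \<nu>) * of_real pi / 2)) * bessel_I \<nu> (of_real b)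
     - of_real pi / 2 * (\<i> + tan ((m + \<nu>) * of_real pi / 2)) * K_bessel \<nu> b"

lemma tan_diff_cos:
  assumes "cos x \<noteq> 0" "cos y \<noteq> (0 :: complex)"
  shows "tan x - tan y = sin (x - y) / (cos x * cos y)"
  using assms by (simp add: tan_def sin_diff field_simps)

lemma cos_half_nonzero:
  assumes "w \<notin> \<int>"
  shows "cos (w * of_real pi / 2 :: complex) \<noteq> 0"
  using sin_pi_nonzero[OF half_nonint[OF assms]] unfolding sin_half_shift .

text \<open>I_{-\<nu>} is eliminated in favour of K_\<nu>. The coefficient left at I_\<nu> is a
  difference of tangents, which equals sin (pi \<nu>) over the two cosines and cancels the sine in
  \<open>K_factor\<close>; the result makes sense at integral \<nu>. The extra multiple of K does
  not depend on m and disappears in differences.\<close>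

lemma (in generic_order) tan_part_eq:
  assumes "generic (- m)"
  shows "lommel_sum \<nu> b m - tan_part m = lommel_closed \<nu> b m + \<i> * of_real pi / 2 * K_bessel \<nu> b"
proof -
  have "- (\<nu> + - m) \<notin> \<int>" "- (- \<nu> + - m) \<notin> \<int>" using assms minus_of_nat_nonint(2) unfolding generic_def by blast+
  hence mn: "m - \<nu> \<notin> \<int>" "m + \<nu> \<notin> \<int>" by (simp_all add: add.commute)
  define c1 where "c1 = cos ((m - \<nu>) * of_real pi / 2)"
  define c2 where "c2 = cos ((m + \<nu>) * of_real pi / 2)"
  define t1 where "t1 = tan ((m - \<nu>) * of_real pi / 2)"
  define t2 where "t2 = tan ((m + \<nu>) * of_real pi / 2)"
  define F where "F = K_factor \<nu>"
  have c: "c1 \<noteq> 0" "c2 \<noteq> 0" unfolding c1_def c2_def by (intro cos_half_nonzero mn)+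
  have s: "sin (of_real pi * \<nu>) \<noteq> 0" by (rule sin_pi_nonzero[OF nonint])
  have "(m + \<nu>) * of_real pi / 2 - (m - \<nu>) * of_real pi / 2 = of_real pi * \<nu>" by (simp add: field_simps)
  hence t: "t2 - t1 = sin (of_real pi * \<nu>) / (c2 * c1)"
    using tan_diff_cos[of "(m + \<nu>) * of_real pi / 2" "(m - \<nu>) * of_real pi / 2"] c by (simp add: t1_def t2_def c1_def c2_def)
  have Ft: "F * (t2 - t1) = of_real pi / 2 / (c1 * c2)"
    unfolding t F_def K_factor_def using s c by (simp add: field_simps)
  have K: "K_bessel \<nu> b = F * (bessel_I (- \<nu>) (of_real b) - bessel_I \<nu> (of_real b))"
    unfolding F_def by (rule K_bessel_nonint'[OF nonint b])
  have "tan_part m = of_real pi / 2 * (F * (t2 - t1) * bessel_I \<nu> (of_real b) + t2 * K_bessel \<nu> b)"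
    unfolding K tan_part_def F_def[symmetric] t1_def[symmetric] t2_def[symmetric] by (simp add: algebra_simps)
  also have "\<dots> = of_real pi ^ 2 / (4 * c1 * c2) * bessel_I \<nu> (of_real b) + of_real pi / 2 * t2 * K_bessel \<nu> b"
    unfolding Ft by (simp add: power2_eq_square algebra_simps)
  finally show ?thesis
    unfolding lommel_closed_def c1_def[symmetric] c2_def[symmetric] t2_def[symmetric] by (simp add: algebra_simps)
qed

lemma (in generic_order) diff_integral_generic:
  assumes g: "generic (- m1)" "generic (- m2)" and m: "Re m1 < 1 - \<bar>Re \<nu>\<bar>" "Re m2 < 1 - \<bar>Re \<nu>\<bar>"
  shows "diff_integral \<nu> b m1 m2 = lommel_closed \<nu> b m2 - lommel_closed \<nu> b m1"
  using diff_integral_generic_sums[OF assms] tan_part_eq[OF g(1)] tan_part_eq[OF g(2)] by (simp add: algebra_simps)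

lemma bessel_I_LIMSEQ:
  assumes x: "x > 0" and X: "X \<longlonglongrightarrow> \<nu>"
  shows "(\<lambda>n. bessel_I (X n) (of_real x)) \<longlonglongrightarrow> bessel_I \<nu> (of_real x)"
  unfolding bessel_I_of_real[OF x] using x by (intro tendsto_intros tendsto_of_real_powr tendsto_rGamma_series2 X) auto

lemma lommel_closed_LIMSEQ:
  assumes b: "b > 0" and X: "X \<longlonglongrightarrow> \<nu>" and M: "M \<longlonglongrightarrow> m"
    and c: "cos ((m - \<nu>) * of_real pi / 2) \<noteq> 0" "cos ((m + \<nu>) * of_real pi / 2) \<noteq> 0"
  shows "(\<lambda>n. lommel_closed (X n) b (M n)) \<longlonglongrightarrow> lommel_closed \<nu> b m"
  unfolding lommel_closed_def lommel_sum_def tan_def using b c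
  by (intro tendsto_intros tendsto_of_real_powr tendsto_rGamma_series2 bessel_I_LIMSEQ K_bessel_LIMSEQ X M isCont_tendsto_compose[OF isCont_cos] isCont_tendsto_compose[OF isCont_sin]) auto

text \<open>Eventually the imaginary part is nonzero: a nonzero Im z survives small shifts, and if
  Im z = 0 the shift itself is the imaginary part.\<close>

lemma eventually_imaginary_shift_nonint:
  assumes "c \<noteq> 0"
  shows "\<forall>\<^sub>F n in sequentially. z + of_real c * \<i> * of_real (inverse (real (Suc n))) \<notin> \<int>"
proof -
  have "\<forall>\<^sub>F n in sequentially. Im z + c * inverse (real (Suc n)) \<noteq> 0"
  proof (cases "Im z = 0")
    case False
    have "(\<lambda>n. Im z + c * inverse (real (Suc n))) \<longlonglongrightarrow> Im z + c * 0"
      by (intro tendsto_intros LIMSEQ_inverse_real_of_nat)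
    thus ?thesis using False tendsto_imp_eventually_ne by force
  qed (use assms in auto)
  thus ?thesis
  proof eventually_elim
    case (elim n)
    have "Im (z + of_real c * \<i> * of_real e) = Im z + c * e" for e by simp
    with elim show ?case by (metis complex_is_Int_iff)
  qed
qed

text \<open>
  Shifting \<open>\<nu>\<close> by \<open>\<i>\<epsilon>\<close> and the indices by \<open>3\<i>\<epsilon>\<close> makes \<open>\<nu>\<close> and all \<open>m \<plusminus> \<nu>\<close> non-integral at once.
\<close>

lemma diff_integral_eq:
  assumes b: "b > 0" and m: "Re m1 < 1 - \<bar>Re \<nu>\<bar>" "Re m2 < 1 - \<bar>Re \<nu>\<bar>"
    and c1: "cos ((m1 - \<nu>) * of_real pi / 2) \<noteq> 0" "cos ((m1 + \<nu>) * of_real pi / 2) \<noteq> 0"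
    and c2: "cos ((m2 - \<nu>) * of_real pi / 2) \<noteq> 0" "cos ((m2 + \<nu>) * of_real pi / 2) \<noteq> 0"
  shows "diff_integral \<nu> b m1 m2 = lommel_closed \<nu> b m2 - lommel_closed \<nu> b m1"
proof -
  define \<epsilon> where "\<epsilon> n = \<i> * of_real (inverse (real (Suc n)))" for n
  have "(\<lambda>n. \<i> * complex_of_real (inverse (real (Suc n)))) \<longlonglongrightarrow> \<i> * of_real 0"
    by (intro tendsto_intros LIMSEQ_inverse_real_of_nat)
  hence \<epsilon>0: "\<epsilon> \<longlonglongrightarrow> 0" by (simp add: \<epsilon>_def[abs_def])
  have lim: "(\<lambda>n. z + of_real c * \<epsilon> n) \<longlonglongrightarrow> z" for z c
    using tendsto_add[OF tendsto_const tendsto_mult[OF tendsto_const \<epsilon>0], of z "of_real c"] by simp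
  let ?X = "\<lambda>n. \<nu> + of_real 1 * \<epsilon> n" and ?M1 = "\<lambda>n. m1 + of_real 3 * \<epsilon> n" and ?M2 = "\<lambda>n. m2 + of_real 3 * \<epsilon> n"
  have ni: "\<forall>\<^sub>F n in sequentially. z + of_real c * \<epsilon> n \<notin> \<int>" if "c \<noteq> 0" for z c
    using eventually_imaginary_shift_nonint[OF that, of z] by (simp add: \<epsilon>_def mult.assoc)
  \<comment> \<open>The combinations \<nu> - m and -\<nu> - m are shifted by 1 - 3 = -2 and -1 - 3 =
    -4 times \<epsilon>.\<close>
  have neq2: "- 2 \<noteq> (0 :: real)" and neq4: "- 4 \<noteq> (0 :: real)" by simp_all
  have L1: "(\<lambda>n. diff_integral (?X n) b (?M1 n) (?M2 n)) \<longlonglongrightarrow> diff_integral \<nu> b m1 m2"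
    by (intro diff_integral_LIMSEQ b m lim)
  have L2: "(\<lambda>n. lommel_closed (?X n) b (?M2 n) - lommel_closed (?X n) b (?M1 n)) \<longlonglongrightarrow> lommel_closed \<nu> b m2 - lommel_closed \<nu> b m1"
    by (intro tendsto_diff lommel_closed_LIMSEQ b c1 c2 lim)
  \<comment> \<open>The shifts are purely imaginary, so the conditions on real parts are
    untouched.\<close>
  have reg: "\<forall>\<^sub>F n in sequentially. Re (?M1 n) < 1 - \<bar>Re (?X n)\<bar> \<and> Re (?M2 n) < 1 - \<bar>Re (?X n)\<bar>"
    using m by (intro always_eventually) (auto simp: \<epsilon>_def)
  have "\<forall>\<^sub>F n in sequentially. diff_integral (?X n) b (?M1 n) (?M2 n) = lommel_closed (?X n) b (?M2 n) - lommel_closed (?X n) b (?M1 n)"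
    using ni[OF one_neq_zero, of \<nu>] ni[OF neq2, of "\<nu> - m1"] ni[OF neq4, of "- \<nu> - m1"] ni[OF neq2, of "\<nu> - m2"]
      ni[OF neq4, of "- \<nu> - m2"] reg
  proof eventually_elim
    case (elim n)
    interpret generic_order "?X n" b by unfold_locales (use elim b in auto)
    have e: "?X n + - (m + of_real 3 * \<epsilon> n) = (\<nu> - m) + of_real (- 2) * \<epsilon> n"
      "- ?X n + - (m + of_real 3 * \<epsilon> n) = (- \<nu> - m) + of_real (- 4) * \<epsilon> n" for m by (simp_all add: algebra_simps)
    have "generic (- ?M1 n)" "generic (- ?M2 n)" unfolding generic_def e using elim by blast+
    thus ?case using elim by (intro diff_integral_generic) auto
  qed
  from Lim_transform_eventually[OF L1 this] L2 show ?thesis by (rule LIMSEQ_unique)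
qed

section \<open>Lommel functions of imaginary argument\<close>

lemma i_powr: "\<i> powr z = exp (\<i> * (z * of_real pi / 2))"
  by (simp add: powr_def mult_ac)

lemma i_powr_neq_0 [simp]: "\<i> powr z \<noteq> 0"
  by (simp add: i_powr)

lemma i_times_of_real_powr:
  assumes "b > 0"
  shows "(\<i> * of_real b) powr z = \<i> powr z * of_real b powr z"
proof -
  have "Ln (\<i> * of_real b) = Ln \<i> + of_real (ln b)"
    using Ln_times_of_real[of b \<i>] assms by (simp add: mult.commute add.commute Ln_of_real)
  thus ?thesis using assms by (simp add: powr_def Ln_of_real distrib_left exp_add)
qed

lemma bessel_J_imaginary:
  assumes b: "b > 0"
  shows "bessel_J \<nu> (\<i> * of_real b) = \<i> powr \<nu> * bessel_I \<nu> (of_real b)"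
proof -
  have "(\<i> * of_real b / 2) powr \<nu> = \<i> powr \<nu> * (of_real b / 2) powr \<nu>"
    using i_times_of_real_powr[of "b / 2" \<nu>] b by simp
  moreover have "(- 1) ^ k * rGamma (\<nu> + of_nat k + 1) / fact k * (\<i> * complex_of_real b / 2) ^ (2 * k) =
      rGamma (\<nu> + of_nat k + 1) / fact k * (of_real b / 2) ^ (2 * k)" for k
  proof -
    have "(\<i> * complex_of_real b / 2) ^ (2 * k) = ((\<i> * complex_of_real b / 2)\<^sup>2) ^ k" by (simp only: power_mult)
    also have "(\<i> * complex_of_real b / 2)\<^sup>2 = (- 1) * (of_real b / 2)\<^sup>2" by (simp add: power_mult_distrib power_divide)
    also have "((- 1) * (complex_of_real b / 2)\<^sup>2) ^ k = (- 1) ^ k * (of_real b / 2) ^ (2 * k)"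
      by (simp only: power_mult_distrib power_mult)
    finally have "(\<i> * complex_of_real b / 2) ^ (2 * k) = (- 1) ^ k * (of_real b / 2) ^ (2 * k)" .
    moreover have "(- 1) ^ k * (- 1) ^ k = (1 :: complex)" by (simp flip: power_mult_distrib)
    ultimately show ?thesis by simp
  qed
  ultimately show ?thesis unfolding bessel_J_def bessel_I_def by (simp only: mult.assoc)
qed

lemma bessel_I_uminus_nonint:
  assumes "\<nu> \<notin> \<int>" "x > 0"
  shows "bessel_I (- \<nu>) (of_real x) = bessel_I \<nu> (of_real x) + 2 / of_real pi * sin (of_real pi * \<nu>) * K_bessel \<nu> x"
  using K_bessel_nonint[OF assms] sin_pi_nonzero[OF assms(1)] by simp

lemma bessel_I_tendsto: "x > 0 \<Longrightarrow> ((\<lambda>\<nu>. bessel_I \<nu> (of_real x)) \<longlongrightarrow> bessel_I \<nu>0 (of_real x)) (at \<nu>0)"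
  unfolding tendsto_at_iff_sequentially comp_def using bessel_I_LIMSEQ by blast

text \<open>The definition of K solved for I_{-\<nu>}, extended to integral order by continuity;
  there the sine vanishes and I_{-n} = I_n remains.\<close>

lemma bessel_I_uminus:
  assumes x: "x > 0"
  shows "bessel_I (- \<nu>) (of_real x) = bessel_I \<nu> (of_real x) + 2 / of_real pi * sin (of_real pi * \<nu>) * K_bessel \<nu> x"
proof (rule tendsto_unique)
  have "filterlim (\<lambda>w. - w) (at (- \<nu>)) (at \<nu>)"
    by (auto simp: filterlim_at eventually_at_filter intro!: tendsto_intros)
  from filterlim_compose[OF bessel_I_tendsto[OF x] this]
  show "((\<lambda>w. bessel_I (- w) (of_real x)) \<longlongrightarrow> bessel_I (- \<nu>) (of_real x)) (at \<nu>)" .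
  have "((\<lambda>w. bessel_I w (of_real x) + 2 / of_real pi * sin (of_real pi * w) * K_bessel w x) \<longlongrightarrow>
      bessel_I \<nu> (of_real x) + 2 / of_real pi * sin (of_real pi * \<nu>) * K_bessel \<nu> x) (at \<nu>)"
    by (intro tendsto_intros bessel_I_tendsto tendsto_K_bessel x isCont_tendsto_compose[OF isCont_sin])
  moreover have "\<forall>\<^sub>F w in at \<nu>. bessel_I w (of_real x) + 2 / of_real pi * sin (of_real pi * w) * K_bessel w x = bessel_I (- w) (of_real x)"
    using eventually_nonint by eventually_elim (simp add: bessel_I_uminus_nonint x)
  ultimately show "((\<lambda>w. bessel_I (- w) (of_real x)) \<longlongrightarrow>
      bessel_I \<nu> (of_real x) + 2 / of_real pi * sin (of_real pi * \<nu>) * K_bessel \<nu> x) (at \<nu>)"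
    by (rule Lim_transform_eventually)
qed simp

text \<open>J at i b is a power of i times I, and i^(-\<nu>) = i^\<nu> (cos (pi \<nu>) - i sin (pi
  \<nu>)). Replacing I_{-\<nu>} by I_\<nu> and K_\<nu> then makes a factor sin (pi \<nu>) appear
  that cancels the denominator.\<close>

lemma bessel_Y_imaginary_nonint:
  assumes \<nu>: "\<nu> \<notin> \<int>" and b: "b > 0"
  shows "(cos (\<nu> * of_real pi) * bessel_J \<nu> (\<i> * of_real b) - bessel_J (- \<nu>) (\<i> * of_real b)) / sin (\<nu> * of_real pi) =
     \<i> * \<i> powr \<nu> * bessel_I \<nu> (of_real b) - 2 / of_real pi * (\<i> powr (- \<nu>)) * K_bessel \<nu> b"
proof -
  define S where "S = sin (\<nu> * of_real pi)"
  have S: "S \<noteq> 0" "sin (of_real pi * \<nu>) = S" using sin_pi_nonzero[OF \<nu>] by (simp_all add: S_def mult.commute)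
  have "\<i> powr (- \<nu>) = \<i> powr \<nu> * \<i> powr (- (2 * \<nu>))" by (simp add: powr_add[symmetric])
  also have "\<i> powr (- (2 * \<nu>)) = cos (\<nu> * of_real pi) - \<i> * S"
    using exp_Euler[of "- (\<nu> * of_real pi)"] by (simp add: i_powr S_def)
  finally have e: "\<i> powr (- \<nu>) = \<i> powr \<nu> * (cos (\<nu> * of_real pi) - \<i> * S)" .
  have "cos (\<nu> * of_real pi) * bessel_J \<nu> (\<i> * of_real b) - bessel_J (- \<nu>) (\<i> * of_real b) =
      S * (\<i> * \<i> powr \<nu> * bessel_I \<nu> (of_real b) - 2 / of_real pi * (\<i> powr (- \<nu>)) * K_bessel \<nu> b)"
    unfolding bessel_J_imaginary[OF b] bessel_I_uminus[OF b] S(2) by (simp only: e) (simp add: algebra_simps)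
  thus ?thesis using S(1) unfolding S_def[symmetric] by simp
qed

text \<open>The right-hand side is continuous in the order, so it is the limit by which Y is defined
  at integers.\<close>

lemma bessel_Y_imaginary:
  assumes b: "b > 0"
  shows "bessel_Y \<nu> (\<i> * of_real b) = \<i> * \<i> powr \<nu> * bessel_I \<nu> (of_real b) - 2 / of_real pi * (\<i> powr (- \<nu>)) * K_bessel \<nu> b"
proof (cases "\<nu> \<in> \<int>")
  case False
  thus ?thesis using bessel_Y_imaginary_nonint[OF False b] by (simp add: bessel_Y_def)
next
  case True
  let ?Y = "\<lambda>w. (cos (w * of_real pi) * bessel_J w (\<i> * of_real b) - bessel_J (- w) (\<i> * of_real b)) / sin (w * of_real pi)"
  have "((\<lambda>w. \<i> * \<i> powr w * bessel_I w (of_real b) - 2 / of_real pi * (\<i> powr (- w)) * K_bessel w b) \<longlongrightarrow>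
      \<i> * \<i> powr \<nu> * bessel_I \<nu> (of_real b) - 2 / of_real pi * (\<i> powr (- \<nu>)) * K_bessel \<nu> b) (at \<nu>)"
    unfolding i_powr by (intro tendsto_intros bessel_I_tendsto tendsto_K_bessel b) auto
  moreover have "\<forall>\<^sub>F w in at \<nu>. \<i> * \<i> powr w * bessel_I w (of_real b) - 2 / of_real pi * (\<i> powr (- w)) * K_bessel w b = ?Y w"
    using eventually_nonint
  proof eventually_elim
    case (elim w)
    show ?case by (rule bessel_Y_imaginary_nonint[OF elim b, symmetric])
  qed
  ultimately have "(?Y \<longlongrightarrow> \<i> * \<i> powr \<nu> * bessel_I \<nu> (of_real b) - 2 / of_real pi * (\<i> powr (- \<nu>)) * K_bessel \<nu> b) (at \<nu>)"
    by (rule Lim_transform_eventually)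
  hence "Lim (at \<nu>) ?Y = \<i> * \<i> powr \<nu> * bessel_I \<nu> (of_real b) - 2 / of_real pi * (\<i> powr (- \<nu>)) * K_bessel \<nu> b"
    by (intro tendsto_Lim) auto
  thus ?thesis using True by (simp add: bessel_Y_def)
qed

text \<open>Expanding the cosine of (m + \<nu>) pi / 2 = (m - \<nu>) pi / 2 + \<nu> pi turns the
  formula for non-integral order into the one for integral order, and the case distinction
  disappears.\<close>

lemma lommel_S_regular_eq:
  "lommel_S_regular m \<nu> w = lommel_s m \<nu> w + 2 powr (m - 1) * Gamma ((m - \<nu> + 1) / 2) * Gamma ((m + \<nu> + 1) / 2) *
      (sin ((m - \<nu>) * of_real pi / 2) * bessel_J \<nu> w - cos ((m - \<nu>) * of_real pi / 2) * bessel_Y \<nu> w)"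
proof (cases "\<nu> \<in> \<int>")
  case True
  thus ?thesis by (simp add: lommel_S_regular_def)
next
  case False
  define S where "S = sin (\<nu> * of_real pi)"
  define C where "C = cos (\<nu> * of_real pi)"
  define c where "c = cos ((m - \<nu>) * of_real pi / 2)"
  define s where "s = sin ((m - \<nu>) * of_real pi / 2)"
  have S: "S \<noteq> 0" using sin_pi_nonzero[OF False] by (simp add: S_def mult.commute)
  have "(m + \<nu>) * of_real pi / 2 = (m - \<nu>) * of_real pi / 2 + \<nu> * of_real pi" by (simp add: field_simps)
  hence c2: "cos ((m + \<nu>) * of_real pi / 2) = c * C - s * S"
    by (simp only: cos_add c_def s_def S_def C_def)
  have Y: "bessel_Y \<nu> w = (C * bessel_J \<nu> w - bessel_J (- \<nu>) w) / S" using False by (simp add: bessel_Y_def S_def C_def)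
  have "(c * bessel_J (- \<nu>) w - (c * C - s * S) * bessel_J \<nu> w) / S = s * bessel_J \<nu> w - c * bessel_Y \<nu> w"
    unfolding Y using S by (simp add: field_simps)
  hence "1 / S * (c * bessel_J (- \<nu>) w - (c * C - s * S) * bessel_J \<nu> w) = s * bessel_J \<nu> w - c * bessel_Y \<nu> w" by simp
  thus ?thesis using False unfolding lommel_S_regular_def c2 unfolding c_def[symmetric] s_def[symmetric] S_def[symmetric]
    by (simp only: if_False divide_inverse mult.assoc) simp
qed

lemma sin_pi_Ints:
  assumes "z \<in> \<int>"
  shows "sin (of_real pi * z :: complex) = 0"
proof -
  obtain n where "z = of_int n" using assms by (rule Ints_cases)
  hence "of_real pi * z = of_real (real_of_int n * pi)" by simp
  thus ?thesis unfolding Complex_Transcendental.sin_eq_0 by blast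
qed

lemma pochhammer_inverse:
  fixes a :: complex
  assumes "a \<notin> \<int>"
  shows "1 / pochhammer (a + 1) k = a * Gamma a * rGamma (a + of_nat k + 1)"
proof -
  have "a \<notin> \<int>\<^sub>\<le>\<^sub>0" "a + 1 \<notin> \<int>\<^sub>\<le>\<^sub>0" using assms nonint_add_int[of a 1] by (auto dest: nonpos_Ints_Int)
  moreover have "a + 1 + of_nat k = a + of_nat k + 1" by simp
  ultimately have "pochhammer (a + 1) k = Gamma (a + of_nat k + 1) / (a * Gamma a)"
    by (simp only: pochhammer_Gamma Gamma_plus1 not_False_eq_True)
  thus ?thesis by (simp add: rGamma_inverse_Gamma divide_inverse)
qed

text \<open>The Pochhammer symbols in the denominator are quotients of Gamma values. Pulling the
  constant ones out front leaves a series that is entire in both indices.\<close>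

lemma lommel_s_eq:
  assumes \<alpha>: "(m - \<nu> + 1) / 2 \<notin> \<int>" and \<beta>: "(m + \<nu> + 1) / 2 \<notin> \<int>"
  shows "lommel_s m \<nu> w = w powr (m + 1) / 4 * (Gamma ((m - \<nu> + 1) / 2) * Gamma ((m + \<nu> + 1) / 2)) *
     rGamma_series2 ((m - \<nu> + 1) / 2) ((m + \<nu> + 1) / 2) (- (w\<^sup>2 / 4))"
proof -
  define a where "a = (m - \<nu> + 1) / 2"
  define c where "c = (m + \<nu> + 1) / 2"
  have nn: "a \<notin> \<int>" "c \<notin> \<int>" using \<alpha> \<beta> by (simp_all add: a_def c_def)
  hence nz: "a \<noteq> 0" "c \<noteq> 0" by auto
  have e: "(m - \<nu> + 3) / 2 = a + 1" "(m + \<nu> + 3) / 2 = c + 1" "m - \<nu> + 1 = 2 * a" "m + \<nu> + 1 = 2 * c"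
    by (simp_all add: a_def c_def field_simps)
  define q where "q = - (w\<^sup>2 / 4)"
  have "pochhammer 1 k / (pochhammer (a + 1) k * pochhammer (c + 1) k) * (q ^ k / fact k) =
      (a * Gamma a * (c * Gamma c)) * (rGamma (a + of_nat k + 1) * rGamma (c + of_nat k + 1) * q ^ k)" for k
  proof -
    have "pochhammer 1 k = (fact k :: complex)" by (simp add: pochhammer_fact)
    hence "pochhammer 1 k / (pochhammer (a + 1) k * pochhammer (c + 1) k) * (q ^ k / fact k) =
        (1 / pochhammer (a + 1) k) * (1 / pochhammer (c + 1) k) * q ^ k" by simp
    thus ?thesis unfolding pochhammer_inverse[OF nn(1)] pochhammer_inverse[OF nn(2)] by (simp only: mult_ac)
  qed
  hence "hypergeom_1F2 1 (a + 1) (c + 1) q = (a * Gamma a * (c * Gamma c)) * rGamma_series2 a c q"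
    unfolding hypergeom_1F2_def rGamma_series2_def
    using suminf_mult[OF summable_norm_cancel[OF summable_norm_rGamma_series2[of a c q]], of "a * Gamma a * (c * Gamma c)"] by simp
  thus ?thesis unfolding lommel_s_def e q_def[symmetric] a_def[symmetric] c_def[symmetric] using nz by simp
qed

text \<open>The two Gamma arguments complement those in \<open>lommel_S_regular\<close> to 1, so
  that all Gamma products reflect to cosines. For Re m < 1 - |Re \<nu>| they have positive real
  part, and the factor has neither pole nor zero.\<close>

definition lommel_factor :: "complex \<Rightarrow> complex \<Rightarrow> complex" where
  "lommel_factor \<nu> m = 2 powr (- m - 1) * Gamma ((1 - m + \<nu>) / 2) * Gamma ((1 - m - \<nu>) / 2)"

text \<open>The four Gamma factors reflect to pi^2 over the product of the two cosines; the powers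
  of 2 leave 1/4. Then J and Y at i b are replaced by I and K, and the powers of i are resolved by
  Euler's formula.\<close>

lemma lommel_S_regular_closed:
  assumes b: "b > 0" and c: "cos ((m - \<nu>) * of_real pi / 2) \<noteq> 0" "cos ((m + \<nu>) * of_real pi / 2) \<noteq> 0"
  shows "lommel_factor \<nu> m * (- (\<i> powr (1 - m)) * lommel_S_regular m \<nu> (\<i> * of_real b)) = lommel_closed \<nu> b m"
proof -
  define a where "a = (m - \<nu> + 1) / 2"
  define d where "d = (m + \<nu> + 1) / 2"
  define c1 where "c1 = cos ((m - \<nu>) * of_real pi / 2)"
  define s1 where "s1 = sin ((m - \<nu>) * of_real pi / 2)"
  define c2 where "c2 = cos ((m + \<nu>) * of_real pi / 2)"
  define I where "I = bessel_I \<nu> (of_real b)"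
  define K where "K = K_bessel \<nu> b"
  define G where "G = Gamma a * Gamma d"
  have sa: "sin (of_real pi * a) = c1" "sin (of_real pi * d) = c2"
    using sin_half_shift[of "m - \<nu>"] sin_half_shift[of "m + \<nu>"] by (simp_all add: a_def d_def c1_def c2_def)
  have c0: "c1 \<noteq> 0" "c2 \<noteq> 0" using c by (simp_all add: c1_def c2_def)
  have nn: "a \<notin> \<int>" "d \<notin> \<int>" using sa c0 sin_pi_Ints by metis+
  have fac: "lommel_factor \<nu> m * G = 2 powr (- m - 1) * (of_real pi ^ 2 / (c1 * c2))"
  proof -
    have e: "(1 - m + \<nu>) / 2 = 1 - a" "(1 - m - \<nu>) / 2 = 1 - d" by (simp_all add: a_def d_def field_simps)
    have "lommel_factor \<nu> m * G = 2 powr (- m - 1) * ((Gamma a * Gamma (1 - a)) * (Gamma d * Gamma (1 - d)))"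
      unfolding lommel_factor_def G_def e by (simp only: mult_ac)
    thus ?thesis unfolding Gamma_reflection_complex sa by (simp add: power2_eq_square)
  qed
  have two: "2 powr (- m - 1) * 2 powr (m - 1) = (1 / 4 :: complex)"
    by (simp add: powr_add[symmetric] powr_minus)
  have i1: "\<i> powr (1 - m) * \<i> powr (m + 1) = - 1"
    by (simp add: powr_add[symmetric])
  have s_part: "lommel_factor \<nu> m * (- (\<i> powr (1 - m)) * lommel_s m \<nu> (\<i> * of_real b)) = lommel_sum \<nu> b m"
  proof -
    define W where "W = rGamma_series2 a d (of_real (b\<^sup>2 / 4))"
    have q: "- ((\<i> * complex_of_real b)\<^sup>2 / 4) = of_real (b\<^sup>2 / 4)" by (simp add: power_mult_distrib)
    have "lommel_s m \<nu> (\<i> * of_real b) = (\<i> * of_real b) powr (m + 1) / 4 * G * W"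
      using lommel_s_eq[of m \<nu> "\<i> * of_real b"] nn unfolding q by (simp add: a_def d_def G_def W_def)
    hence "lommel_factor \<nu> m * (- (\<i> powr (1 - m)) * lommel_s m \<nu> (\<i> * of_real b)) =
        - (\<i> powr (1 - m) * \<i> powr (m + 1)) * (lommel_factor \<nu> m * G) * (of_real b powr (m + 1) / 4) * W"
      unfolding i_times_of_real_powr[OF b] by simp
    also have "\<dots> = of_real pi ^ 2 / (4 * c1 * c2) * ((of_real b powr (m + 1) * 2 powr (- m - 1)) * W)"
      unfolding i1 fac by (simp add: mult_ac)
    also have "of_real b powr (m + 1) * 2 powr (- m - 1) = complex_of_real (b / 2) powr (m + 1)"
    proof -
      have f: "of_real b powr (m + 1) = of_real (b / 2) powr (m + 1) * 2 powr (m + 1)"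
        using b powr_times_real[of "of_real (b / 2)" 2 "m + 1"] by simp
      have g: "- m - 1 = - (m + 1)" by simp
      show ?thesis unfolding f g powr_minus by simp
    qed
    finally show ?thesis by (simp only: lommel_sum_def c1_def c2_def W_def a_def d_def)
  qed
  have JY: "s1 * bessel_J \<nu> (\<i> * of_real b) - c1 * bessel_Y \<nu> (\<i> * of_real b) =
      - \<i> * \<i> powr m * I + 2 / of_real pi * c1 * \<i> powr (- \<nu>) * K"
  proof -
    have "\<i> powr m = \<i> powr (m - \<nu>) * \<i> powr \<nu>" by (simp add: powr_add[symmetric])
    also have "\<i> powr (m - \<nu>) = c1 + \<i> * s1"
      unfolding i_powr c1_def s1_def by (rule exp_Euler)
    finally have e: "\<i> powr m = (c1 + \<i> * s1) * \<i> powr \<nu>" .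
    show ?thesis unfolding bessel_J_imaginary[OF b] bessel_Y_imaginary[OF b] e I_def[symmetric] K_def[symmetric]
      by (simp add: algebra_simps)
  qed
  have h_part: "lommel_factor \<nu> m * (- (\<i> powr (1 - m)) * (2 powr (m - 1) * Gamma a * Gamma d * (s1 * bessel_J \<nu> (\<i> * of_real b) - c1 * bessel_Y \<nu> (\<i> * of_real b))))
     = - (of_real pi ^ 2 / (4 * c1 * c2)) * I - of_real pi / 2 * (\<i> + tan ((m + \<nu>) * of_real pi / 2)) * K"
  proof -
    have "lommel_factor \<nu> m * (- (\<i> powr (1 - m)) * (2 powr (m - 1) * Gamma a * Gamma d * (s1 * bessel_J \<nu> (\<i> * of_real b) - c1 * bessel_Y \<nu> (\<i> * of_real b))))
      = - (lommel_factor \<nu> m * G * 2 powr (m - 1)) * (\<i> powr (1 - m) * (- \<i> * \<i> powr m * I + 2 / of_real pi * c1 * \<i> powr (- \<nu>) * K))"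
      unfolding JY G_def by simp
    also have "lommel_factor \<nu> m * G * 2 powr (m - 1) = of_real pi ^ 2 / (4 * c1 * c2)"
    proof -
      have "lommel_factor \<nu> m * G * 2 powr (m - 1) = (2 powr (- m - 1) * 2 powr (m - 1)) * (of_real pi ^ 2 / (c1 * c2))"
        unfolding fac by (simp only: mult_ac)
      thus ?thesis unfolding two by simp
    qed
    also have "\<i> powr (1 - m) * (- \<i> * \<i> powr m * I + 2 / of_real pi * c1 * \<i> powr (- \<nu>) * K) =
        - \<i> * (\<i> powr (1 - m) * \<i> powr m) * I + 2 / of_real pi * c1 * (\<i> powr (1 - m) * \<i> powr (- \<nu>)) * K"
      by (simp add: algebra_simps)
    also have "\<i> powr (1 - m) * \<i> powr m = \<i>" by (simp add: powr_add[symmetric])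
    \<comment> \<open>Divided by the cosine \<open>c2\<close> this becomes i plus the tangent, the
      origin of the imaginary constant in \<open>lommel_closed\<close>.\<close>
    also have "\<i> powr (1 - m) * \<i> powr (- \<nu>) = \<i> * c2 + sin ((m + \<nu>) * of_real pi / 2)"
    proof -
      have "\<i> powr (1 - m) * \<i> powr (- \<nu>) = \<i> powr (1 + - (m + \<nu>))" by (simp add: powr_add[symmetric] algebra_simps)
      also have "\<dots> = \<i> * \<i> powr (- (m + \<nu>))" by (simp only: powr_add) simp
      also have "\<i> powr (- (m + \<nu>)) = c2 - \<i> * sin ((m + \<nu>) * of_real pi / 2)"
      proof -
        have "- (m + \<nu>) * of_real pi / 2 = - ((m + \<nu>) * of_real pi / 2)"
          by (simp only: mult_minus_left minus_divide_left)
        thus ?thesis unfolding i_powr c2_def by (simp only: exp_Euler cos_minus sin_minus) simp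
      qed
      finally show ?thesis by (simp add: algebra_simps)
    qed
    also have "- (of_real pi ^ 2 / (4 * c1 * c2)) * (- \<i> * \<i> * I + 2 / of_real pi * c1 * (\<i> * c2 + sin ((m + \<nu>) * of_real pi / 2)) * K) =
       - (of_real pi ^ 2 / (4 * c1 * c2)) * I - of_real pi / 2 * (\<i> + tan ((m + \<nu>) * of_real pi / 2)) * K"
      using c0 unfolding tan_def c2_def[symmetric] by (simp add: power2_eq_square field_simps)
    finally show ?thesis .
  qed
  have S: "lommel_S_regular m \<nu> (\<i> * of_real b) = lommel_s m \<nu> (\<i> * of_real b) +
      2 powr (m - 1) * Gamma a * Gamma d * (s1 * bessel_J \<nu> (\<i> * of_real b) - c1 * bessel_Y \<nu> (\<i> * of_real b))"
    unfolding lommel_S_regular_eq a_def d_def s1_def c1_def ..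
  have "lommel_factor \<nu> m * (- (\<i> powr (1 - m)) * lommel_S_regular m \<nu> (\<i> * of_real b)) =
     lommel_sum \<nu> b m + (- (of_real pi ^ 2 / (4 * c1 * c2)) * I - of_real pi / 2 * (\<i> + tan ((m + \<nu>) * of_real pi / 2)) * K)"
    unfolding S distrib_left s_part h_part ..
  thus ?thesis unfolding lommel_closed_def c1_def[symmetric] c2_def[symmetric] I_def[symmetric] K_def[symmetric] by simp
qed

section \<open>The exceptional indices and the principal value\<close>

text \<open>The change of sign replaces I_\<nu> by I_{-\<nu>} and the tangent of (m + \<nu>) pi / 2
  by that of (m - \<nu>) pi / 2. The tangents differ by sin (pi \<nu>) over the two cosines, and the
  multiple of K_\<nu> in \<open>bessel_I_uminus\<close> compensates this exactly.\<close>

lemma lommel_closed_uminus: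
  assumes b: "b > 0" and c: "cos ((m - \<nu>) * of_real pi / 2) \<noteq> 0" "cos ((m + \<nu>) * of_real pi / 2) \<noteq> 0"
  shows "lommel_closed (- \<nu>) b m = lommel_closed \<nu> b m"
proof -
  define c1 where "c1 = cos ((m - \<nu>) * of_real pi / 2)"
  define c2 where "c2 = cos ((m + \<nu>) * of_real pi / 2)"
  define t1 where "t1 = tan ((m - \<nu>) * of_real pi / 2)"
  define t2 where "t2 = tan ((m + \<nu>) * of_real pi / 2)"
  define S where "S = sin (of_real pi * \<nu>)"
  have c0: "c1 \<noteq> 0" "c2 \<noteq> 0" using c by (simp_all add: c1_def c2_def)
  have "(m + \<nu>) * of_real pi / 2 - (m - \<nu>) * of_real pi / 2 = of_real pi * \<nu>" by (simp add: field_simps)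
  hence "t2 - t1 = S / (c2 * c1)"
    using tan_diff_cos[OF c(2,1)] by (simp only: t1_def t2_def c1_def c2_def S_def)
  hence t: "t2 = t1 + S / (c2 * c1)" by (simp add: diff_eq_eq add.commute)
  have W: "rGamma_series2 a d q = rGamma_series2 d a q" for a d q
    by (simp add: rGamma_series2_def mult.commute)
  have sum: "lommel_sum (- \<nu>) b m = lommel_sum \<nu> b m"
    unfolding lommel_sum_def by (simp add: W[of "(m + \<nu> + 1) / 2"] mult_ac)
  have "lommel_closed (- \<nu>) b m = lommel_sum \<nu> b m - of_real pi ^ 2 / (4 * c2 * c1) * bessel_I (- \<nu>) (of_real b)
      - of_real pi / 2 * (\<i> + t1) * K_bessel \<nu> b"
    unfolding lommel_closed_def sum K_bessel_uminus[OF b] by (simp add: c1_def c2_def t1_def)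
  also have "\<dots> = lommel_sum \<nu> b m - of_real pi ^ 2 / (4 * c1 * c2) * bessel_I \<nu> (of_real b)
      - of_real pi / 2 * (\<i> + t2) * K_bessel \<nu> b"
    unfolding bessel_I_uminus[OF b] t S_def[symmetric] using c0 by (simp add: field_simps power2_eq_square)
  finally show ?thesis by (simp only: lommel_closed_def c1_def c2_def t2_def)
qed

lemma diff_integral_uminus: "b > 0 \<Longrightarrow> diff_integral (- \<nu>) b m1 m2 = diff_integral \<nu> b m1 m2"
  unfolding diff_integral_def by (rule set_lebesgue_integral_cong) (auto simp: K_bessel_uminus)

text \<open>The kernels subtract pointwise. This lets both indices be compared with a regular third
  one, so that either may be exceptional.\<close>

lemma diff_integral_chain:
  assumes b: "b > 0" and m: "Re m1 < 1 - \<bar>Re \<nu>\<bar>" "Re m2 < 1 - \<bar>Re \<nu>\<bar>" "Re m3 < 1 - \<bar>Re \<nu>\<bar>"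
  shows "diff_integral \<nu> b m1 m2 = diff_integral \<nu> b m1 m3 - diff_integral \<nu> b m2 m3"
proof -
  have "diff_integral \<nu> b m1 m3 - diff_integral \<nu> b m2 m3 =
      (LINT t:{0<..}|lborel. diff_kernel m1 m3 t * K_bessel \<nu> (b * t) - diff_kernel m2 m3 t * K_bessel \<nu> (b * t))"
    unfolding diff_integral_def by (rule set_integral_diff(2)[symmetric]) (intro diff_integrable b m)+
  also have "\<dots> = diff_integral \<nu> b m1 m2" unfolding diff_integral_def
    by (rule set_lebesgue_integral_cong) (auto simp: diff_kernel_def diff_divide_distrib algebra_simps)
  finally show ?thesis ..
qed

lemma cos_half_eq_0_iff: "cos (w * of_real pi / 2 :: complex) = 0 \<longleftrightarrow> (\<exists>n :: int. w = of_int (2 * n + 1))"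
proof -
  have "w * of_real pi / 2 = complex_of_real (real_of_int n * pi) + of_real pi / 2 \<longleftrightarrow> w = of_int (2 * n + 1)" for n :: int
  proof -
    have "w * of_real pi / 2 = complex_of_real (real_of_int n * pi) + of_real pi / 2 \<longleftrightarrow> w * of_real pi = of_int (2 * n + 1) * complex_of_real pi"
      by (auto simp: field_simps)
    thus ?thesis by simp
  qed
  thus ?thesis unfolding cos_eq_0 by blast
qed

text \<open>The zeros of the cosine are all odd integers, and Re w < 1 leaves only the negative
  ones.\<close>

lemma odd_neg_Ints_iff:
  assumes "Re w < 1"
  shows "w \<in> odd_neg_Ints \<longleftrightarrow> cos (w * of_real pi / 2) = 0"
proof
  assume "w \<in> odd_neg_Ints"
  then obtain k where "w = - of_nat (2 * k + 1)" unfolding odd_neg_Ints_def by blast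
  hence "w = of_int (2 * (- int k - 1) + 1)" by simp
  thus "cos (w * of_real pi / 2) = 0" unfolding cos_half_eq_0_iff by blast
next
  assume "cos (w * of_real pi / 2) = 0"
  then obtain n :: int where n: "w = of_int (2 * n + 1)" unfolding cos_half_eq_0_iff by blast
  with assms have "real_of_int (2 * n + 1) < 1" by simp
  hence "n < 0" by linarith
  then obtain k :: nat where "n = - int k - 1" by (intro that[of "nat (- n - 1)"]) simp
  hence "w = - of_nat (2 * k + 1)" using n by simp
  thus "w \<in> odd_neg_Ints" unfolding odd_neg_Ints_def by blast
qed

lemma eventually_cos_half_nonzero: "\<forall>\<^sub>F w in at m. cos ((w + z) * of_real pi / 2 :: complex) \<noteq> 0"
proof -
  have "filterlim (\<lambda>w. w + z) (at (m + z)) (at m)"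
    by (auto simp: filterlim_at eventually_at_filter intro!: tendsto_intros)
  from eventually_compose_filterlim[OF eventually_nonint this] show ?thesis
    by eventually_elim (rule cos_half_nonzero)
qed

text \<open>
  For the exceptional \<open>m\<close> the identity for nearby regular indices shows that the limit defining
  \<open>S\<^bsub>m,\<nu>\<^esub>\<close> exists, since the integral is continuous in \<open>m\<close>.
\<close>

lemma modified_lommel_T_eq:
  assumes b: "b > 0" and m: "Re m < 1 - \<bar>Re \<nu>\<bar>" and r: "Re r < 1 - \<bar>Re \<nu>\<bar>"
    and cr: "cos ((r - \<nu>) * of_real pi / 2) \<noteq> 0" "cos ((r + \<nu>) * of_real pi / 2) \<noteq> 0"
  shows "lommel_factor \<nu> m * modified_lommel_T m \<nu> b = lommel_closed \<nu> b r - diff_integral \<nu> b m r"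
proof -
  have odd: "m - \<nu> \<in> odd_neg_Ints \<longleftrightarrow> cos ((m - \<nu>) * of_real pi / 2) = 0" "m + \<nu> \<in> odd_neg_Ints \<longleftrightarrow> cos ((m + \<nu>) * of_real pi / 2) = 0"
    by (rule odd_neg_Ints_iff; use m in simp)+
  show ?thesis
  proof (cases "cos ((m - \<nu>) * of_real pi / 2) = 0 \<or> cos ((m + \<nu>) * of_real pi / 2) = 0")
    case False
    hence "modified_lommel_T m \<nu> b = - (\<i> powr (1 - m)) * lommel_S_regular m \<nu> (\<i> * of_real b)"
      unfolding modified_lommel_T_def lommel_S_def odd by simp
    hence "lommel_factor \<nu> m * modified_lommel_T m \<nu> b = lommel_closed \<nu> b m"
      using lommel_S_regular_closed[OF b] False by simp
    thus ?thesis using diff_integral_eq[OF b m r _ _ cr] False by simp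
  next
    case True
    \<comment> \<open>Both Gamma arguments have positive real part, hence are not poles, and Gamma
      has no zeros.\<close>
    have F_nz: "lommel_factor \<nu> w \<noteq> 0" if "Re w < 1 - \<bar>Re \<nu>\<bar>" for w
    proof -
      have "(1 - w + \<nu>) / 2 \<notin> \<int>\<^sub>\<le>\<^sub>0" "(1 - w - \<nu>) / 2 \<notin> \<int>\<^sub>\<le>\<^sub>0"
        using that by (auto elim!: nonpos_Ints_cases simp: complex_eq_iff)
      thus ?thesis by (simp add: lommel_factor_def Gamma_eq_zero_iff)
    qed
    have D: "((\<lambda>w. diff_integral \<nu> b w r) \<longlongrightarrow> diff_integral \<nu> b m r) (at m)"
      unfolding tendsto_at_iff_sequentially comp_def
      using diff_integral_LIMSEQ[OF b m r tendsto_const _ tendsto_const] by blast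
    have "isCont (lommel_factor \<nu>) m"
    proof -
      have "(1 - m + \<nu>) / 2 \<notin> \<int>\<^sub>\<le>\<^sub>0" "(1 - m - \<nu>) / 2 \<notin> \<int>\<^sub>\<le>\<^sub>0"
        using m by (auto elim!: nonpos_Ints_cases simp: complex_eq_iff)
      thus ?thesis unfolding lommel_factor_def[abs_def] powr_def by (intro continuous_intros) auto
    qed
    hence F: "(lommel_factor \<nu> \<longlongrightarrow> lommel_factor \<nu> m) (at m)" by (simp add: isCont_def)
    have P: "((\<lambda>w. - (\<i> powr (1 - w))) \<longlongrightarrow> - (\<i> powr (1 - m))) (at m)"
      unfolding i_powr by (intro tendsto_intros) auto
    have "((\<lambda>w. (lommel_closed \<nu> b r - diff_integral \<nu> b w r) / (lommel_factor \<nu> w * - (\<i> powr (1 - w)))) \<longlongrightarrow>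
       (lommel_closed \<nu> b r - diff_integral \<nu> b m r) / (lommel_factor \<nu> m * - (\<i> powr (1 - m)))) (at m)"
      using F_nz[OF m] by (intro tendsto_intros D F P) auto
    moreover have "\<forall>\<^sub>F w in at m. (lommel_closed \<nu> b r - diff_integral \<nu> b w r) / (lommel_factor \<nu> w * - (\<i> powr (1 - w))) =
       lommel_S_regular w \<nu> (\<i> * of_real b)"
    proof -
      have "\<forall>\<^sub>F w in at m. Re w < 1 - \<bar>Re \<nu>\<bar>"
        using order_tendstoD(2)[OF tendsto_Re[OF tendsto_ident_at] m] .
      moreover have "\<forall>\<^sub>F w in at m. cos ((w - \<nu>) * of_real pi / 2) \<noteq> 0"
        using eventually_cos_half_nonzero[of "- \<nu>" m] by simp
      ultimately show ?thesis using eventually_cos_half_nonzero[of \<nu> m]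
      proof eventually_elim
        case (elim w)
        have "lommel_closed \<nu> b r - diff_integral \<nu> b w r = lommel_closed \<nu> b w"
          using diff_integral_eq[OF b elim(1) r elim(2,3) cr] by simp
        also have "\<dots> = lommel_factor \<nu> w * - (\<i> powr (1 - w)) * lommel_S_regular w \<nu> (\<i> * of_real b)"
          using lommel_S_regular_closed[OF b elim(2,3)] by (simp add: mult.assoc)
        finally show ?case using F_nz[OF elim(1)] by simp
      qed
    qed
    ultimately have "((\<lambda>w. lommel_S_regular w \<nu> (\<i> * of_real b)) \<longlongrightarrow>
       (lommel_closed \<nu> b r - diff_integral \<nu> b m r) / (lommel_factor \<nu> m * - (\<i> powr (1 - m)))) (at m)"
      by (rule Lim_transform_eventually)
    hence "Lim (at m) (\<lambda>w. lommel_S_regular w \<nu> (\<i> * of_real b)) = (lommel_closed \<nu> b r - diff_integral \<nu> b m r) / (lommel_factor \<nu> m * - (\<i> powr (1 - m)))"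
      by (intro tendsto_Lim) auto
    hence "lommel_S m \<nu> (\<i> * of_real b) = (lommel_closed \<nu> b r - diff_integral \<nu> b m r) / (lommel_factor \<nu> m * - (\<i> powr (1 - m)))"
      using True unfolding lommel_S_def odd by simp
    thus ?thesis using F_nz[OF m] by (simp add: modified_lommel_T_def)
  qed
qed

text \<open>Both T values are compared with the closed form at one regular index r, which cancels in
  the difference. The second one may be taken at order -\<nu> because the closed form and the
  integral are even in \<nu>.\<close>

lemma diff_integral_lommel_T:
  assumes b: "b > 0" and m: "Re m1 < 1 - \<bar>Re \<nu>\<bar>" "Re m2 < 1 - \<bar>Re \<nu>\<bar>"
  shows "diff_integral \<nu> b m1 m2 =
    lommel_factor (- \<nu>) m2 * modified_lommel_T m2 (- \<nu>) b - lommel_factor \<nu> m1 * modified_lommel_T m1 \<nu> b"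
proof -
  \<comment> \<open>The imaginary part exceeds |Im \<nu>|, so neither r - \<nu> nor r + \<nu> is
    real; the real part keeps r in the half-plane of convergence.\<close>
  define r where "r = Complex (- \<bar>Re \<nu>\<bar>) (\<bar>Im \<nu>\<bar> + 1)"
  have r: "Re r < 1 - \<bar>Re \<nu>\<bar>" by (simp add: r_def)
  have "r - \<nu> \<notin> \<int>" "r + \<nu> \<notin> \<int>" by (auto simp: r_def complex_is_Int_iff)
  hence cr: "cos ((r - \<nu>) * of_real pi / 2) \<noteq> 0" "cos ((r + \<nu>) * of_real pi / 2) \<noteq> 0"
    by (auto intro!: cos_half_nonzero)
  have 1: "lommel_factor \<nu> m1 * modified_lommel_T m1 \<nu> b = lommel_closed \<nu> b r - diff_integral \<nu> b m1 r"
    by (rule modified_lommel_T_eq[OF b m(1) r cr])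
  have "lommel_factor (- \<nu>) m2 * modified_lommel_T m2 (- \<nu>) b = lommel_closed (- \<nu>) b r - diff_integral (- \<nu>) b m2 r"
    by (rule modified_lommel_T_eq) (use b m r cr in auto)
  also have "\<dots> = lommel_closed \<nu> b r - diff_integral \<nu> b m2 r"
    by (simp only: lommel_closed_uminus[OF b cr] diff_integral_uminus[OF b])
  finally show ?thesis using 1 diff_integral_chain[OF b m r] by simp
qed

text \<open>For an absolutely integrable function the excised intervals shrink to the null set {c},
  so dominated convergence gives the ordinary integral. It applies because the singularity of the
  integrand in question is removable.\<close>

lemma has_PV_integral_of_integrable:
  assumes int: "set_integrable lborel A f" and A: "A \<in> sets borel"
  shows "has_PV_integral f (LINT x:A|lborel. f x) A c"
  unfolding has_PV_integral_def
proof (intro conjI allI impI)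
  show "set_integrable lborel (A - ball c \<epsilon>) f" for \<epsilon>
    by (rule set_integrable_subset[OF int]) (use A in auto)
  show "((\<lambda>\<epsilon>. LINT x:A - ball c \<epsilon>|lborel. f x) \<longlongrightarrow> (LINT x:A|lborel. f x)) (at_right 0)"
    unfolding tendsto_at_iff_sequentially comp_def
  proof (intro allI impI)
    fix X :: "nat \<Rightarrow> real" assume X: "\<forall>i. X i \<in> {0<..} - {0}" "X \<longlonglongrightarrow> 0"
    have Am: "(\<lambda>x. indicat_real A x *\<^sub>R f x) \<in> borel_measurable borel"
      using borel_measurable_integrable[OF int[unfolded set_integrable_def]] by simp
    show "(\<lambda>n. LINT x:A - ball c (X n)|lborel. f x) \<longlonglongrightarrow> (LINT x:A|lborel. f x)"
      unfolding set_lebesgue_integral_def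
    proof (rule integral_dominated_convergence[where w = "\<lambda>x. norm (indicat_real A x *\<^sub>R f x)"])
      show "integrable lborel (\<lambda>x. norm (indicat_real A x *\<^sub>R f x))"
        using int unfolding set_integrable_def by (rule integrable_norm)
      show "AE x in lborel. (\<lambda>n. indicat_real (A - ball c (X n)) x *\<^sub>R f x) \<longlonglongrightarrow> indicat_real A x *\<^sub>R f x"
        using AE_lborel_singleton[of c]
      proof eventually_elim
        case (elim x)
        have "\<forall>\<^sub>F n in sequentially. X n < dist c x" using order_tendstoD(2)[OF X(2), of "dist c x"] elim by simp
        hence "\<forall>\<^sub>F n in sequentially. indicat_real A x *\<^sub>R f x = indicat_real (A - ball c (X n)) x *\<^sub>R f x"
          by eventually_elim (auto simp: indicator_def)
        from Lim_transform_eventually[OF tendsto_const this] show ?case .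
      qed
      show "AE x in lborel. norm (indicat_real (A - ball c (X n)) x *\<^sub>R f x) \<le> norm (indicat_real A x *\<^sub>R f x)" for n
        by (intro AE_I2) (auto simp: indicator_def)
      show "(\<lambda>x. indicat_real (A - ball c (X n)) x *\<^sub>R f x) \<in> borel_measurable lborel" for n
        using set_integrable_subset[OF int, of "A - ball c (X n)"] A unfolding set_integrable_def by auto
    qed (use Am in simp)
  qed
qed

theorem theorem15p10:
  fixes s :: complex and y \<alpha> :: real
  assumes "-2 < Re s" and "Re s < 3" and "y > 0" and "\<alpha> > 0"
  shows "has_PV_integral
     (\<lambda>x. of_real x powr (2 - s / 2) * bessel_K (s / 2) (of_real (2 * pi * \<alpha> * x)) *
          ((of_real y powr (s - 1) - of_real x powr (s - 1)) / of_real (y\<^sup>2 - x\<^sup>2)))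
     (of_real (2 * y) powr (s / 2) * Gamma (1 + s / 2)
          * modified_lommel_T (- 1 - s / 2) (- (s / 2)) (2 * pi * \<alpha> * y)
      - of_real (sqrt pi) * of_real (y / 2) powr (s / 2) * Gamma ((3 - s) / 2)
          * modified_lommel_T (- 2 + s / 2) (s / 2) (2 * pi * \<alpha> * y))
     {0<..} y"
proof -
  define \<nu> where "\<nu> = s / 2"
  define b where "b = 2 * pi * \<alpha> * y"
  define f where "f x = of_real x powr (2 - s / 2) * bessel_K (s / 2) (of_real (2 * pi * \<alpha> * x)) *
          ((of_real y powr (s - 1) - of_real x powr (s - 1)) / of_real (y\<^sup>2 - x\<^sup>2))" for x :: real
  have y: "y > 0" and b: "b > 0" using assms by (simp_all add: b_def)
  have s: "s = 2 * \<nu>" by (simp add: \<nu>_def)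
  \<comment> \<open>The first inequality comes from Re s < 3, the second from Re s > -2.\<close>
  have m: "Re (- 2 + \<nu>) < 1 - \<bar>Re \<nu>\<bar>" "Re (- 1 - \<nu>) < 1 - \<bar>Re \<nu>\<bar>" using assms by (auto simp: s abs_if)
  let ?g = "\<lambda>t. diff_kernel (- 2 + \<nu>) (- 1 - \<nu>) t * K_bessel \<nu> (b * t)"
  \<comment> \<open>The powers of y are 2 - \<nu> from the prefactor and 2 \<nu> - 1 - 2 from the
    quotient, together \<nu> - 1.\<close>
  have fy: "f (y * t) = of_real y powr (\<nu> - 1) * ?g t" if t: "t > 0" for t
  proof -
    have "2 * pi * \<alpha> * (y * t) = b * t" by (simp add: b_def)
    hence K: "bessel_K (s / 2) (of_real (2 * pi * \<alpha> * (y * t))) = K_bessel \<nu> (b * t)"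
      using bessel_K_of_real[of "b * t" \<nu>] b t by (simp only: \<nu>_def mult_pos_pos)
    have p: "complex_of_real (y * t) powr w = of_real y powr w * of_real t powr w" for w
      using y t by (simp add: powr_times_real)
    define T where "T = complex_of_real t"
    define Y where "Y = complex_of_real y"
    have Y0: "Y \<noteq> 0" and T0: "T \<noteq> 0" using y t by (simp_all add: Y_def T_def)
    have d: "complex_of_real (y\<^sup>2 - (y * t)\<^sup>2) = Y\<^sup>2 * of_real (1 - t\<^sup>2)"
      by (simp add: Y_def power_mult_distrib algebra_simps)
    have "T powr (2 - \<nu>) * T powr (2 * \<nu> - 1) = T powr (1 + \<nu>)" by (simp add: powr_add[symmetric] add.commute)
    hence t1: "T powr (2 - \<nu>) * (Y powr (2 * \<nu> - 1) - Y powr (2 * \<nu> - 1) * T powr (2 * \<nu> - 1)) =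
        Y powr (2 * \<nu> - 1) * (T powr (2 - \<nu>) - T powr (1 + \<nu>))" by (simp add: algebra_simps)
    have "Y powr (2 - \<nu>) * Y powr (2 * \<nu> - 1) = Y powr (\<nu> - 1 + 2)" by (simp add: powr_add[symmetric] add.commute)
    also have "\<dots> = Y powr (\<nu> - 1) * Y\<^sup>2" using Y0 by (simp only: powr_add) simp
    finally have t2: "Y powr (2 - \<nu>) * Y powr (2 * \<nu> - 1) = Y powr (\<nu> - 1) * Y\<^sup>2" .
    have "f (y * t) = (Y powr (2 - \<nu>) * (T powr (2 - \<nu>) * (Y powr (2 * \<nu> - 1) - Y powr (2 * \<nu> - 1) * T powr (2 * \<nu> - 1)))) *
        K_bessel \<nu> (b * t) / (Y\<^sup>2 * of_real (1 - t\<^sup>2))"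
      unfolding f_def unfolding K p d unfolding \<nu>_def[symmetric] unfolding s Y_def[symmetric] T_def[symmetric] by (simp add: mult_ac)
    also have "\<dots> = (Y powr (2 - \<nu>) * Y powr (2 * \<nu> - 1)) * (T powr (2 - \<nu>) - T powr (1 + \<nu>)) *
        K_bessel \<nu> (b * t) / (Y\<^sup>2 * of_real (1 - t\<^sup>2))" unfolding t1 by (simp add: mult_ac)
    also have "\<dots> = Y powr (\<nu> - 1) * ((T powr (2 - \<nu>) - T powr (1 + \<nu>)) / of_real (1 - t\<^sup>2) * K_bessel \<nu> (b * t))"
      unfolding t2 using Y0 by simp
    finally show ?thesis by (simp add: diff_kernel_def T_def Y_def add.commute)
  qed
  have gi: "set_integrable lborel {0<..} ?g" by (rule diff_integrable[OF b m])
  hence "set_integrable lborel {0<..} (\<lambda>t. of_real y powr (\<nu> - 1) * ?g t)" by (rule set_integrable_mult_right)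
  also have "?this \<longleftrightarrow> set_integrable lborel {0<..} (\<lambda>t. f (y * t))"
    by (rule set_integrable_cong[OF refl refl fy[symmetric]]) simp
  finally have fi: "set_integrable lborel {0<..} f" using set_integrable_scale_pos[OF y, of f] by blast
  have "(LINT x:{0<..}|lborel. f x) = of_real y * (LINT t:{0<..}|lborel. f (y * t))" by (rule set_integral_scale_pos[OF y])
  also have "(LINT t:{0<..}|lborel. f (y * t)) = (LINT t:{0<..}|lborel. of_real y powr (\<nu> - 1) * ?g t)"
    by (rule set_lebesgue_integral_cong; (intro allI impI fy)?; simp)
  also have "\<dots> = of_real y powr (\<nu> - 1) * (LINT t:{0<..}|lborel. ?g t)" by (rule set_integral_mult_right)
  also have "of_real y * \<dots> = of_real y powr \<nu> * diff_integral \<nu> b (- 2 + \<nu>) (- 1 - \<nu>)"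
    using y by (simp add: diff_integral_def powr_diff)
  also have "\<dots> = of_real y powr \<nu> * lommel_factor (- \<nu>) (- 1 - \<nu>) * modified_lommel_T (- 1 - \<nu>) (- \<nu>) b
      - of_real y powr \<nu> * lommel_factor \<nu> (- 2 + \<nu>) * modified_lommel_T (- 2 + \<nu>) \<nu> b"
    unfolding diff_integral_lommel_T[OF b m] by (simp add: algebra_simps)
  also have "of_real y powr \<nu> * lommel_factor (- \<nu>) (- 1 - \<nu>) = of_real (2 * y) powr \<nu> * Gamma (1 + \<nu>)"
  proof -
    have "lommel_factor (- \<nu>) (- 1 - \<nu>) = 2 powr \<nu> * Gamma (1 + \<nu>)"
    proof -
      \<comment> \<open>Here one Gamma argument is 1 and only Gamma (1 + \<nu>) survives. At the
        other index the corresponding argument is 3/2, which is where sqrt pi comes from.\<close>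
      have e: "- (- 1 - \<nu>) - 1 = \<nu>" "(1 - (- 1 - \<nu>) + - \<nu>) / 2 = 1" "(1 - (- 1 - \<nu>) - - \<nu>) / 2 = 1 + \<nu>" by (simp_all add: field_simps)
      show ?thesis unfolding lommel_factor_def e by simp
    qed
    thus ?thesis using y powr_times_real[of 2 "of_real y" \<nu>] by simp
  qed
  also have "of_real y powr \<nu> * lommel_factor \<nu> (- 2 + \<nu>) = of_real (sqrt pi) * of_real (y / 2) powr \<nu> * Gamma ((3 - s) / 2)"
  proof -
    have e: "- (- 2 + \<nu>) - 1 = 1 - \<nu>" "(1 - (- 2 + \<nu>) + \<nu>) / 2 = 1 / 2 + 1" "(1 - (- 2 + \<nu>) - \<nu>) / 2 = (3 - s) / 2" by (simp_all add: s field_simps)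
    have g: "Gamma (1 / 2 + 1 :: complex) = 1 / 2 * of_real (sqrt pi)"
      by (subst Gamma_plus1) (auto simp: Gamma_one_half_complex elim!: nonpos_Ints_cases simp: complex_eq_iff)
    have p: "(2 :: complex) powr (1 - \<nu>) = 2 * 2 powr (- \<nu>)" using powr_add[of 2 1 "- \<nu>" ] by simp
    have q: "complex_of_real y powr \<nu> = of_real (y / 2) powr \<nu> * 2 powr \<nu>"
      using y powr_times_real[of "of_real (y / 2)" 2 \<nu>] by simp
    show ?thesis unfolding lommel_factor_def e g p q powr_minus by simp
  qed
  finally have "(LINT x:{0<..}|lborel. f x) = of_real (2 * y) powr (s / 2) * Gamma (1 + s / 2)
          * modified_lommel_T (- 1 - s / 2) (- (s / 2)) (2 * pi * \<alpha> * y)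
      - of_real (sqrt pi) * of_real (y / 2) powr (s / 2) * Gamma ((3 - s) / 2)
          * modified_lommel_T (- 2 + s / 2) (s / 2) (2 * pi * \<alpha> * y)"
    by (simp only: \<nu>_def b_def)
  moreover have "has_PV_integral f (LINT x:{0<..}|lborel. f x) {0<..} y"
    by (rule has_PV_integral_of_integrable[OF fi]) simp
  ultimately show ?thesis by (simp only: f_def[abs_def])
qed

end
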